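(* Let $(H\to N,\Gamma^\infty,\nabla)$ be a smooth field of Hilbert spaces. Let $\{U_i\}_{i\in I}$ be an open cover of $N$ and $\{\mathcal H_i\}_{i\in I}$ a family of Hilbert spaces, and assume that for each $\lambda\in U_i$ there is a unitary operator $T_i(\lambda):\mathcal H(\lambda)\to\mathcal H_i$. Also assume that $T_i(\Gamma^\infty|_{U_i})\subseteq C^\infty(U_i,\mathcal H_i)$ and that $T_i^*x$ belongs to $\Gamma^\infty(U_i)$ for every $x\in\mathcal H_i$ (where $x$ is regarded as a constant section). Then: a) $\hat\nabla_{X_1}\cdots\hat\nabla_{X_k}(T_i)$ is a field of bounded operators, for every $k\in\mathbb N$ and $X_1,\dots,X_k\in\operatorname{Vect}(U_i)$. b) $T_i(\Gamma^\infty(U_i))\subseteq C^\infty(U_i,\mathcal H_i)$ if and only if $\hat\nabla_{X_1}\cdots\hat\nabla_{X_k}(T_i)$ maps $\Gamma^\infty(U_i)$ into $C(U_i,\mathcal H_i)$, for every $k\in\mathbb N$ and $X_1,\dots,X_k\in\operatorname{Vect}(U_i)$. c) Let $A_i(X):=T_i^*\hat\nabla_X(T_i)$. If $A_i(X)(\Gamma^\infty(U_i))\subseteq\Gamma^\infty(U_i)$ (for every $X\in\operatorname{Vect}(U_i)$), then $T_i(\Gamma^\infty(U_i))\subseteq C^\infty(U_i,\mathcal H_i)$.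
   Context: $N$ is a finite-dimensional smooth manifold, $C^\infty(N)$ the smooth complex functions, $\operatorname{Vect}(N)$ the complexified smooth vector fields. A field of Hilbert spaces is a surjective map $p:H\to N$ whose fibers $\mathcal H(\lambda)=p^{-1}(\lambda)$ are complex Hilbert spaces (inner products antilinear in the second variable); $h(\varphi,\psi)(\lambda)=\langle\varphi(\lambda),\psi(\lambda)\rangle_\lambda$ for sections $\varphi,\psi$. Smooth field of Hilbert spaces $(H\to N,\Gamma^\infty,\nabla)$: $\Gamma^\infty$ is a set of sections closed under addition and multiplication by $C^\infty(N)$, and $\nabla:\operatorname{Vect}(N)\times\Gamma^\infty\to\Gamma^\infty$ satisfies (i) $\nabla_{X+Y}=\nabla_X+\nabla_Y$, $\nabla_{aX}=a\nabla_X$, $\nabla_X(a\varphi)=X(a)\varphi+a\nabla_X\varphi$; (ii) $h(\varphi,\psi)\in C^\infty(N)$, $Xh(\varphi,\psi)=h(\nabla_X\varphi,\psi)+h(\varphi,\nabla_{\overline X}\psi)$; (iii) $\{\varphi(\lambda)\mid\varphi\in\Gamma^\infty\}$ is dense in $\mathcal H(\lambda)$ for all $\lambda$. Spaces $\Gamma^n(U)$, $U\subseteq N$ open: $\nabla$ induces a connection on restrictions $\Gamma^\infty|_U$, $\nabla_X(\varphi|_U)=(\nabla_X\varphi)|_U$, giving a smooth structure on $H|_U\to U$. $\Gamma^0(U)$: sections over $U$ that are locally uniform limits of sequences in $\Gamma^\infty$. $\Gamma^1(U)$: those $\varphi\in\Gamma^0(U)$ for which there is a sequence $\varphi_j\in\Gamma^\infty$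 with $\varphi_j\to\varphi$ and $\nabla_X\varphi_j$ convergent, locally uniformly on $U$, for all $X\in\operatorname{Vect}(U)$; then $\nabla_X\varphi:=\lim\nabla_X\varphi_j$. Inductively $\varphi\in\Gamma^n(U)$ if $\varphi,\nabla_X\varphi\in\Gamma^{n-1}(U)$ for all $X\in\operatorname{Vect}(U)$; $\Gamma^\infty(U)=\bigcap_n\Gamma^n(U)$. Fields of operators act on sections by $(T_i\varphi)(\lambda)=T_i(\lambda)\varphi(\lambda)$. The trivial field $U_i\times\mathcal H_i$ carries the connection $X$ (ordinary derivation of $\mathcal H_i$-valued functions). For a field of operators $A$ from $H|_{U_i}$ to $U_i\times\mathcal H_i$ mapping $\Gamma^\infty|_{U_i}$ into $C^\infty(U_i,\mathcal H_i)$ whose adjoint field maps constant sections into $\Gamma^\infty(U_i)$, $\hat\nabla_X(A)$ is the field of operators, defined at $\lambda$ on $\{\varphi(\lambda)\mid\varphi\in\Gamma^\infty|_{U_i}\}$, given by $\hat\nabla_X(A)\varphi=X(A\varphi)-A\nabla_X\varphi$ for $\varphi\in\Gamma^\infty|_{U_i}$ (it is well defined pointwise and of the same type). A densely defined operator that is bounded is identified with its bounded extension to the whole fiber; this is how these fields act on $\Gamma^\infty(U_i)$. *)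

theory Defs
  imports "HOL-Analysis.Analysis"
begin

section \<open>Complex Hilbert spaces\<close>

text \<open>
  Complex Hilbert spaces as a type class on top of the real one, so that the norm, limits and
  derivatives of HOL-Analysis apply. The inner product is antilinear in the second variable.
\<close>

class complex_hilbert = real_inner + banach +
  fixes scaleC :: "complex \<Rightarrow> 'a \<Rightarrow> 'a" (infixr "*\<^sub>C" 75)
    and cinner :: "'a \<Rightarrow> 'a \<Rightarrow> complex"
  assumes scaleC_add_right: "a *\<^sub>C (x + y) = a *\<^sub>C x + a *\<^sub>C y"
    and scaleC_add_left: "(a + b) *\<^sub>C x = a *\<^sub>C x + b *\<^sub>C x"
    and scaleC_scaleC: "a *\<^sub>C (b *\<^sub>C x) = (a * b) *\<^sub>C x"
    and scaleC_of_real: "complex_of_real r *\<^sub>C x = r *\<^sub>R x"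
    and cinner_add_left: "cinner (x + y) z = cinner x z + cinner y z"
    and cinner_scaleC_left: "cinner (a *\<^sub>C x) y = a * cinner x y"
    and cinner_commute: "cinner y x = cnj (cinner x y)"
    and Re_cinner: "Re (cinner x y) = inner x y"

instantiation complex :: complex_hilbert
begin

definition scaleC_complex :: "complex \<Rightarrow> complex \<Rightarrow> complex"
  where "scaleC_complex a x = a * x"

definition cinner_complex :: "complex \<Rightarrow> complex \<Rightarrow> complex"
  where "cinner_complex x y = x * cnj y"

instance
  by standard
    (simp_all add: scaleC_complex_def cinner_complex_def algebra_simps scaleR_conv_of_real
      inner_complex_def)

end

text \<open>
  A family of Hilbert spaces is represented by closed subspaces of one complex Hilbert space of
  arbitrary type (every family embeds isometrically in its Hilbert direct sum), because a type
  cannot depend on the index.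
\<close>

definition closed_csubspace :: "'k::complex_hilbert set \<Rightarrow> bool" where
  "closed_csubspace K \<longleftrightarrow> closed K \<and> 0 \<in> K \<and> (\<forall>x\<in>K. \<forall>y\<in>K. x + y \<in> K) \<and>
     (\<forall>a. \<forall>x\<in>K. a *\<^sub>C x \<in> K)"

text \<open>
  The fibers of a field of Hilbert spaces are pairwise disjoint subsets of the total space, each
  with its own vector space structure; hence a carrier-based version is needed as well.
\<close>

locale complex_hilbert_on =
  fixes V :: "'h set"
    and add :: "'h \<Rightarrow> 'h \<Rightarrow> 'h"
    and scale :: "complex \<Rightarrow> 'h \<Rightarrow> 'h"
    and ip :: "'h \<Rightarrow> 'h \<Rightarrow> complex"
  assumes add_closed: "\<lbrakk>x \<in> V; y \<in> V\<rbrakk> \<Longrightarrow> add x y \<in> V"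
    and add_assoc: "\<lbrakk>x \<in> V; y \<in> V; z \<in> V\<rbrakk> \<Longrightarrow> add (add x y) z = add x (add y z)"
    and add_commute: "\<lbrakk>x \<in> V; y \<in> V\<rbrakk> \<Longrightarrow> add x y = add y x"
    and zero_neg: "\<exists>z\<in>V. (\<forall>x\<in>V. add x z = x) \<and> (\<forall>x\<in>V. \<exists>y\<in>V. add x y = z)"
    and scale_closed: "x \<in> V \<Longrightarrow> scale a x \<in> V"
    and scale_add_right: "\<lbrakk>x \<in> V; y \<in> V\<rbrakk> \<Longrightarrow> scale a (add x y) = add (scale a x) (scale a y)"
    and scale_add_left: "x \<in> V \<Longrightarrow> scale (a + b) x = add (scale a x) (scale b x)"
    and scale_scale: "x \<in> V \<Longrightarrow> scale a (scale b x) = scale (a * b) x"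
    and scale_one: "x \<in> V \<Longrightarrow> scale 1 x = x"
    and ip_add_left: "\<lbrakk>x \<in> V; y \<in> V; z \<in> V\<rbrakk> \<Longrightarrow> ip (add x y) z = ip x z + ip y z"
    and ip_scale_left: "\<lbrakk>x \<in> V; y \<in> V\<rbrakk> \<Longrightarrow> ip (scale a x) y = a * ip x y"
    and ip_commute: "\<lbrakk>x \<in> V; y \<in> V\<rbrakk> \<Longrightarrow> ip y x = cnj (ip x y)"
    and ip_nonneg: "x \<in> V \<Longrightarrow> Re (ip x x) \<ge> 0"
    and ip_definite: "\<lbrakk>x \<in> V; ip x x = 0; y \<in> V\<rbrakk> \<Longrightarrow> add y x = y"
    and complete:
      "\<lbrakk>\<forall>n. s n \<in> V;
        \<forall>e>0. \<exists>M. \<forall>m\<ge>M. \<forall>n\<ge>M.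
          (let d = add (s m) (scale (- 1) (s n)) in sqrt (Re (ip d d)) < e)\<rbrakk>
       \<Longrightarrow> \<exists>x\<in>V. (\<lambda>n. let d = add (s n) (scale (- 1) x) in sqrt (Re (ip d d))) \<longlonglongrightarrow> 0"


section \<open>Smooth manifolds\<close>

text \<open>Continuity of all directional derivatives amounts to the usual $C^n$ condition because the
  model space will be finite-dimensional.\<close>

fun Ck_on :: "nat \<Rightarrow> 'a::real_normed_vector set \<Rightarrow> ('a \<Rightarrow> 'b::real_normed_vector) \<Rightarrow> bool" where
  "Ck_on 0 W f \<longleftrightarrow> continuous_on W f"
| "Ck_on (Suc n) W f \<longleftrightarrow> (\<forall>x\<in>W. f differentiable (at x)) \<and>
     (\<forall>v. Ck_on n W (\<lambda>x. frechet_derivative f (at x) v))"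

definition smooth_on :: "'a::real_normed_vector set \<Rightarrow> ('a \<Rightarrow> 'b::real_normed_vector) \<Rightarrow> bool" where
  "smooth_on W f \<longleftrightarrow> (\<forall>n. Ck_on n W f)"

text \<open>A chart is a pair of its domain and its coordinate map (irrelevant off the domain).\<close>

type_synonym ('m, 'e) chart = "'m set \<times> ('m \<Rightarrow> 'e)"

abbreviation chart_inv :: "('m, 'e) chart \<Rightarrow> 'e \<Rightarrow> 'm" where
  "chart_inv c \<equiv> inv_into (fst c) (snd c)"

text \<open>
  The manifold is the whole type \<open>'m\<close>; Hausdorff and second countable are
  imposed as type classes. The model space is a finite-dimensional \<open>real_inner\<close> type rather than a
  \<open>euclidean_space\<close> type, as the latter excludes dimension 0.
\<close>

definition smooth_atlas ::
  "('m::{t2_space,second_countable_topology}, 'e::real_inner) chart set \<Rightarrow> bool" where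
  "smooth_atlas \<A> \<longleftrightarrow>
     (\<exists>B::'e set. finite B \<and> span B = UNIV) \<and>
     (\<Union>c\<in>\<A>. fst c) = UNIV \<and>
     (\<forall>c\<in>\<A>. open (fst c) \<and> open (snd c ` fst c) \<and>
        homeomorphism (fst c) (snd c ` fst c) (snd c) (chart_inv c)) \<and>
     (\<forall>c\<in>\<A>. \<forall>d\<in>\<A>. smooth_on (snd c ` (fst c \<inter> fst d)) (snd d \<circ> chart_inv c))"

definition smooth_map ::
  "('m, 'e::real_normed_vector) chart set \<Rightarrow> 'm set \<Rightarrow> ('m \<Rightarrow> 'f::real_normed_vector) \<Rightarrow> bool" where
  "smooth_map \<A> U f \<longleftrightarrow> (\<forall>c\<in>\<A>. smooth_on (snd c ` (fst c \<inter> U)) (f \<circ> chart_inv c))"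

definition chart_deriv ::
  "('m, 'e::real_normed_vector) chart \<Rightarrow> ('m \<Rightarrow> 'f::real_normed_vector) \<Rightarrow> 'm \<Rightarrow> 'e \<Rightarrow> 'f" where
  "chart_deriv c f \<xi> = frechet_derivative (f \<circ> chart_inv c) (at (snd c \<xi>))"

text \<open>
  A complexified tangent vector at \<open>\<xi>\<close> is given by its coordinate representations in the charts
  around \<open>\<xi>\<close>, related by the derivatives of the transition maps; the pair \<open>(u, v)\<close> stands for
  \<open>u + \<i>v\<close>. Values are forced to be 0 at points outside \<open>U\<close> and in charts not containing the
  point, so that equality of functions is equality of vector fields.
\<close>

type_synonym ('m, 'e) vfield = "'m \<Rightarrow> ('m, 'e) chart \<Rightarrow> 'e \<times> 'e"

definition vect ::
  "('m, 'e::real_normed_vector) chart set \<Rightarrow> 'm set \<Rightarrow> ('m, 'e) vfield set" where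
  "vect \<A> U = {X.
     (\<forall>\<xi> c. \<not> (c \<in> \<A> \<and> \<xi> \<in> fst c \<inter> U) \<longrightarrow> X \<xi> c = 0) \<and>
     (\<forall>c\<in>\<A>. \<forall>d\<in>\<A>. \<forall>\<xi> \<in> fst c \<inter> fst d \<inter> U.
        X \<xi> d = map_prod (chart_deriv c (snd d) \<xi>) (chart_deriv c (snd d) \<xi>) (X \<xi> c)) \<and>
     (\<forall>c\<in>\<A>. smooth_on (snd c ` (fst c \<inter> U)) (\<lambda>y. X (chart_inv c y) c))}"

definition vf_add ::
  "('m, 'e::real_normed_vector) vfield \<Rightarrow> ('m, 'e) vfield \<Rightarrow> ('m, 'e) vfield" where
  "vf_add X Y = (\<lambda>\<xi> c. X \<xi> c + Y \<xi> c)"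

definition vf_mult ::
  "('m \<Rightarrow> complex) \<Rightarrow> ('m, 'e::real_normed_vector) vfield \<Rightarrow> ('m, 'e) vfield" where
  "vf_mult a X = (\<lambda>\<xi> c. case X \<xi> c of (u, v) \<Rightarrow>
     (Re (a \<xi>) *\<^sub>R u - Im (a \<xi>) *\<^sub>R v, Re (a \<xi>) *\<^sub>R v + Im (a \<xi>) *\<^sub>R u))"

definition vf_cnj :: "('m, 'e::real_normed_vector) vfield \<Rightarrow> ('m, 'e) vfield" where
  "vf_cnj X = (\<lambda>\<xi> c. map_prod id uminus (X \<xi> c))"

text \<open>\<open>X f\<close>, for functions \<open>f\<close> with values in the complex numbers or in any complex Hilbert space;
  the result does not depend on the chart if \<open>f\<close> is differentiable.\<close>

definition vf_apply ::
  "('m, 'e::real_normed_vector) chart set \<Rightarrow> ('m, 'e) vfield \<Rightarrow>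
    ('m \<Rightarrow> 'f::complex_hilbert) \<Rightarrow> 'm \<Rightarrow> 'f" where
  "vf_apply \<A> X f \<xi> = (let c = (SOME c. c \<in> \<A> \<and> \<xi> \<in> fst c) in
     chart_deriv c f \<xi> (fst (X \<xi> c)) + \<i> *\<^sub>C chart_deriv c f \<xi> (snd (X \<xi> c)))"


section \<open>Smooth fields of Hilbert spaces\<close>

text \<open>The total space is the whole type \<open>'h\<close>.\<close>

record ('m, 'e, 'h) hfield =
  atlas :: "('m, 'e) chart set"
  proj :: "'h \<Rightarrow> 'm"
  fadd :: "'h \<Rightarrow> 'h \<Rightarrow> 'h"
  fscale :: "complex \<Rightarrow> 'h \<Rightarrow> 'h"
  finner :: "'h \<Rightarrow> 'h \<Rightarrow> complex"
  ssec :: "('m \<Rightarrow> 'h) set"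
  conn :: "('m, 'e) vfield \<Rightarrow> ('m \<Rightarrow> 'h) \<Rightarrow> 'm \<Rightarrow> 'h"

definition fiber :: "('m, 'e, 'h) hfield \<Rightarrow> 'm \<Rightarrow> 'h set" where
  "fiber S \<xi> = proj S -` {\<xi>}"

definition fnorm :: "('m, 'e, 'h) hfield \<Rightarrow> 'h \<Rightarrow> real" where
  "fnorm S v = sqrt (Re (finner S v v))"

definition fdist :: "('m, 'e, 'h) hfield \<Rightarrow> 'h \<Rightarrow> 'h \<Rightarrow> real" where
  "fdist S v w = fnorm S (fadd S v (fscale S (- 1) w))"

text \<open>Sections over \<open>U\<close> are represented by functions whose values outside \<open>U\<close> are irrelevant.\<close>

definition sections :: "('m, 'e, 'h) hfield \<Rightarrow> 'm set \<Rightarrow> ('m \<Rightarrow> 'h) set" where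
  "sections S U = {\<phi>. \<forall>\<xi>\<in>U. \<phi> \<xi> \<in> fiber S \<xi>}"

definition sec_add ::
  "('m, 'e, 'h) hfield \<Rightarrow> ('m \<Rightarrow> 'h) \<Rightarrow> ('m \<Rightarrow> 'h) \<Rightarrow> 'm \<Rightarrow> 'h" where
  "sec_add S \<phi> \<psi> = (\<lambda>\<xi>. fadd S (\<phi> \<xi>) (\<psi> \<xi>))"

definition sec_mult ::
  "('m, 'e, 'h) hfield \<Rightarrow> ('m \<Rightarrow> complex) \<Rightarrow> ('m \<Rightarrow> 'h) \<Rightarrow> 'm \<Rightarrow> 'h" where
  "sec_mult S a \<phi> = (\<lambda>\<xi>. fscale S (a \<xi>) (\<phi> \<xi>))"

definition sec_inner ::
  "('m, 'e, 'h) hfield \<Rightarrow> ('m \<Rightarrow> 'h) \<Rightarrow> ('m \<Rightarrow> 'h) \<Rightarrow> 'm \<Rightarrow> complex" where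
  "sec_inner S \<phi> \<psi> = (\<lambda>\<xi>. finner S (\<phi> \<xi>) (\<psi> \<xi>))"

definition values_at :: "('m, 'e, 'h) hfield \<Rightarrow> 'm \<Rightarrow> 'h set" where
  "values_at S \<xi> = {\<phi> \<xi> | \<phi>. \<phi> \<in> ssec S}"

definition smooth_hilbert_field ::
  "('m::{t2_space,second_countable_topology}, 'e::real_inner, 'h) hfield \<Rightarrow> bool" where
  "smooth_hilbert_field S \<longleftrightarrow>
     \<comment> \<open>a field of Hilbert spaces over a smooth manifold\<close>
     smooth_atlas (atlas S) \<and> surj (proj S) \<and>
     (\<forall>\<xi>. complex_hilbert_on (fiber S \<xi>) (fadd S) (fscale S) (finner S)) \<and>
     \<comment> \<open>\<open>\<Gamma>\<^sup>\<infinity>\<close> and \<open>\<nabla>\<close>\<close>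
     ssec S \<subseteq> sections S UNIV \<and>
     (\<forall>\<phi>\<in>ssec S. \<forall>\<psi>\<in>ssec S. sec_add S \<phi> \<psi> \<in> ssec S) \<and>
     (\<forall>a. \<forall>\<phi>\<in>ssec S. smooth_map (atlas S) UNIV a \<longrightarrow> sec_mult S a \<phi> \<in> ssec S) \<and>
     (\<forall>X \<in> vect (atlas S) UNIV. \<forall>\<phi>\<in>ssec S. conn S X \<phi> \<in> ssec S) \<and>
     \<comment> \<open>(i)\<close>
     (\<forall>X \<in> vect (atlas S) UNIV. \<forall>Y \<in> vect (atlas S) UNIV. \<forall>\<phi>\<in>ssec S.
        conn S (vf_add X Y) \<phi> = sec_add S (conn S X \<phi>) (conn S Y \<phi>)) \<and>
     (\<forall>a. \<forall>X \<in> vect (atlas S) UNIV. \<forall>\<phi>\<in>ssec S. smooth_map (atlas S) UNIV a \<longrightarrow>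
        conn S (vf_mult a X) \<phi> = sec_mult S a (conn S X \<phi>) \<and>
        conn S X (sec_mult S a \<phi>) =
          sec_add S (sec_mult S (vf_apply (atlas S) X a) \<phi>) (sec_mult S a (conn S X \<phi>))) \<and>
     \<comment> \<open>(ii)\<close>
     (\<forall>\<phi>\<in>ssec S. \<forall>\<psi>\<in>ssec S. smooth_map (atlas S) UNIV (sec_inner S \<phi> \<psi>) \<and>
        (\<forall>X \<in> vect (atlas S) UNIV. \<forall>\<xi>.
           vf_apply (atlas S) X (sec_inner S \<phi> \<psi>) \<xi> =
             sec_inner S (conn S X \<phi>) \<psi> \<xi> + sec_inner S \<phi> (conn S (vf_cnj X) \<psi>) \<xi>)) \<and>
     \<comment> \<open>(iii)\<close>
     (\<forall>\<xi>. \<forall>v \<in> fiber S \<xi>. \<forall>e>0. \<exists>w \<in> values_at S \<xi>. fdist S v w < e)"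


subsection \<open>The spaces \<open>\<Gamma>\<^sup>n(U)\<close>\<close>

definition loc_unif_lim ::
  "('m::topological_space, 'e, 'h) hfield \<Rightarrow> 'm set \<Rightarrow>
    (nat \<Rightarrow> 'm \<Rightarrow> 'h) \<Rightarrow> ('m \<Rightarrow> 'h) \<Rightarrow> bool" where
  "loc_unif_lim S U s \<phi> \<longleftrightarrow> (\<forall>\<xi>\<in>U. \<exists>V. open V \<and> \<xi> \<in> V \<and> V \<subseteq> U \<and>
     uniform_limit V (\<lambda>j \<mu>. fdist S (s j \<mu>) (\<phi> \<mu>)) (\<lambda>_. 0) sequentially)"

text \<open>
  The connection induced on \<open>\<Gamma>\<^sup>\<infinity>|\<^sub>U\<close>. A field \<open>X\<close> in \<open>Vect(U)\<close> need not extend to the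
  manifold, so \<open>\<nabla>\<^sub>X\<phi>\<close> is computed at \<open>\<xi>\<close> with a global field that agrees with \<open>X\<close> near \<open>\<xi>\<close>.
\<close>

definition conn_on ::
  "('m::topological_space, 'e::real_normed_vector, 'h) hfield \<Rightarrow> 'm set \<Rightarrow>
    ('m, 'e) vfield \<Rightarrow> ('m \<Rightarrow> 'h) \<Rightarrow> 'm \<Rightarrow> 'h" where
  "conn_on S U X \<phi> \<xi> = conn S (SOME Y. Y \<in> vect (atlas S) UNIV \<and>
     (\<exists>V. open V \<and> \<xi> \<in> V \<and> V \<subseteq> U \<and> (\<forall>\<mu>\<in>V. Y \<mu> = X \<mu>))) \<phi> \<xi>"

definition C1_approx ::
  "('m::topological_space, 'e::real_normed_vector, 'h) hfield \<Rightarrow> 'm set \<Rightarrow>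
    (nat \<Rightarrow> 'm \<Rightarrow> 'h) \<Rightarrow> ('m \<Rightarrow> 'h) \<Rightarrow> bool" where
  "C1_approx S U s \<phi> \<longleftrightarrow> (\<forall>j. s j \<in> ssec S) \<and> loc_unif_lim S U s \<phi> \<and>
     (\<forall>X \<in> vect (atlas S) U. \<exists>\<psi> \<in> sections S U.
        loc_unif_lim S U (\<lambda>j. conn_on S U X (s j)) \<psi>)"

definition conn_ext ::
  "('m::topological_space, 'e::real_normed_vector, 'h) hfield \<Rightarrow> 'm set \<Rightarrow>
    ('m, 'e) vfield \<Rightarrow> ('m \<Rightarrow> 'h) \<Rightarrow> 'm \<Rightarrow> 'h" where
  "conn_ext S U X \<phi> \<xi> = (THE v. v \<in> fiber S \<xi> \<and>
     (\<exists>s. C1_approx S U s \<phi> \<and> (\<lambda>j. fdist S (conn_on S U X (s j) \<xi>) v) \<longlonglongrightarrow> 0))"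

fun Gamma_n ::
  "('m::topological_space, 'e::real_normed_vector, 'h) hfield \<Rightarrow> 'm set \<Rightarrow> nat \<Rightarrow>
    ('m \<Rightarrow> 'h) set" where
  "Gamma_n S U 0 = {\<phi> \<in> sections S U. \<exists>s. (\<forall>j. s j \<in> ssec S) \<and> loc_unif_lim S U s \<phi>}"
| "Gamma_n S U (Suc 0) = {\<phi> \<in> Gamma_n S U 0. \<exists>s. C1_approx S U s \<phi>}"
| "Gamma_n S U (Suc (Suc n)) = {\<phi> \<in> Gamma_n S U (Suc n).
     \<forall>X \<in> vect (atlas S) U. conn_ext S U X \<phi> \<in> Gamma_n S U (Suc n)}"

definition Gamma_inf ::
  "('m::topological_space, 'e::real_normed_vector, 'h) hfield \<Rightarrow> 'm set \<Rightarrow> ('m \<Rightarrow> 'h) set" where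
  "Gamma_inf S U = (\<Inter>n. Gamma_n S U n)"


section \<open>Fields of operators\<close>

definition op_apply :: "('m \<Rightarrow> 'a \<Rightarrow> 'b) \<Rightarrow> ('m \<Rightarrow> 'a) \<Rightarrow> 'm \<Rightarrow> 'b" where
  "op_apply A \<phi> = (\<lambda>\<xi>. A \<xi> (\<phi> \<xi>))"

definition cont_maps :: "'m::topological_space set \<Rightarrow> 'k::topological_space set \<Rightarrow> ('m \<Rightarrow> 'k) set" where
  "cont_maps U K = {f. continuous_on U f \<and> f ` U \<subseteq> K}"

definition smooth_maps ::
  "('m, 'e::real_normed_vector) chart set \<Rightarrow> 'm set \<Rightarrow> 'k::real_normed_vector set \<Rightarrow> ('m \<Rightarrow> 'k) set" where
  "smooth_maps \<A> U K = {f. smooth_map \<A> U f \<and> f ` U \<subseteq> K}"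

definition unitary_at ::
  "('m, 'e, 'h) hfield \<Rightarrow> 'm \<Rightarrow> 'k::complex_hilbert set \<Rightarrow> ('h \<Rightarrow> 'k) \<Rightarrow> bool" where
  "unitary_at S \<xi> K L \<longleftrightarrow> bij_betw L (fiber S \<xi>) K \<and>
     (\<forall>v \<in> fiber S \<xi>. \<forall>w \<in> fiber S \<xi>. L (fadd S v w) = L v + L w) \<and>
     (\<forall>a. \<forall>v \<in> fiber S \<xi>. L (fscale S a v) = a *\<^sub>C L v) \<and>
     (\<forall>v \<in> fiber S \<xi>. \<forall>w \<in> fiber S \<xi>. cinner (L v) (L w) = finner S v w)"

definition adj_field ::
  "('m, 'e, 'h) hfield \<Rightarrow> ('m \<Rightarrow> 'h \<Rightarrow> 'k::complex_hilbert) \<Rightarrow> 'm \<Rightarrow> 'k \<Rightarrow> 'h" where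
  "adj_field S A \<xi> x = (THE v. v \<in> fiber S \<xi> \<and>
     (\<forall>u \<in> fiber S \<xi>. cinner (A \<xi> u) x = finner S u v))"

text \<open>\<open>op_conn S U X A\<close> is the field \<open>X(A \<sqdot>) - A \<nabla>\<^sub>X\<close>; at \<open>\<xi>\<close> it is meaningful on \<open>values_at S \<xi>\<close>
  only.\<close>

definition op_conn ::
  "('m::topological_space, 'e::real_normed_vector, 'h) hfield \<Rightarrow> 'm set \<Rightarrow>
    ('m, 'e) vfield \<Rightarrow> ('m \<Rightarrow> 'h \<Rightarrow> 'k::complex_hilbert) \<Rightarrow> 'm \<Rightarrow> 'h \<Rightarrow> 'k" where
  "op_conn S U X A = (\<lambda>\<xi> v. THE w. \<exists>\<phi> \<in> ssec S. \<phi> \<xi> = v \<and>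
     w = vf_apply (atlas S) X (op_apply A \<phi>) \<xi> - A \<xi> (conn_on S U X \<phi> \<xi>))"

definition op_conns ::
  "('m::topological_space, 'e::real_normed_vector, 'h) hfield \<Rightarrow> 'm set \<Rightarrow>
    ('m, 'e) vfield list \<Rightarrow> ('m \<Rightarrow> 'h \<Rightarrow> 'k::complex_hilbert) \<Rightarrow> 'm \<Rightarrow> 'h \<Rightarrow> 'k" where
  "op_conns S U Xs A = foldr (op_conn S U) Xs A"

definition bounded_op_field ::
  "('m, 'e, 'h) hfield \<Rightarrow> 'm set \<Rightarrow> 'k::complex_hilbert set \<Rightarrow> ('m \<Rightarrow> 'h \<Rightarrow> 'k) \<Rightarrow> bool" where
  "bounded_op_field S U K A \<longleftrightarrow> (\<forall>\<xi>\<in>U.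
     (\<forall>v \<in> values_at S \<xi>. A \<xi> v \<in> K) \<and>
     (\<forall>v \<in> values_at S \<xi>. \<forall>w \<in> values_at S \<xi>. A \<xi> (fadd S v w) = A \<xi> v + A \<xi> w) \<and>
     (\<forall>a. \<forall>v \<in> values_at S \<xi>. A \<xi> (fscale S a v) = a *\<^sub>C A \<xi> v) \<and>
     (\<exists>C. \<forall>v \<in> values_at S \<xi>. norm (A \<xi> v) \<le> C * fnorm S v))"

text \<open>Extension by continuity from \<open>values_at S \<xi>\<close> to the whole fiber.\<close>

definition op_ext ::
  "('m, 'e, 'h) hfield \<Rightarrow> ('m \<Rightarrow> 'h \<Rightarrow> 'k::complex_hilbert) \<Rightarrow> 'm \<Rightarrow> 'h \<Rightarrow> 'k" where
  "op_ext S A \<xi> v = (THE w. \<forall>s. (\<forall>n. s n \<in> values_at S \<xi>) \<and> (\<lambda>n. fdist S (s n) v) \<longlonglongrightarrow> 0 \<longrightarrow>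
     (\<lambda>n. A \<xi> (s n)) \<longlonglongrightarrow> w)"

definition conn_form ::
  "('m::topological_space, 'e::real_normed_vector, 'h) hfield \<Rightarrow> 'm set \<Rightarrow>
    ('m \<Rightarrow> 'h \<Rightarrow> 'k::complex_hilbert) \<Rightarrow> ('m, 'e) vfield \<Rightarrow> 'm \<Rightarrow> 'h \<Rightarrow> 'h" where
  "conn_form S U T X = (\<lambda>\<xi> v. adj_field S T \<xi> (op_ext S (op_conn S U X T) \<xi> v))"

end

theory Submission
  imports Defs
begin

text \<open>
  Over \<open>U\<close> the unitary maps \<open>T(\<xi>)\<close> identify every fiber with \<open>K\<close>, so that norms and inner products in
  the fibers can be computed in \<open>K\<close> and a section \<open>\<phi>\<close> becomes the \<open>K\<close>-valued function \<open>T\<phi>\<close>. In this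
  picture \<open>\<nabla>\<^sub>X\<close> differs from the ordinary derivation \<open>X\<close> by \<open>\<nabla>\<^sub>X(T)\<close> (written with a hat in the
  literature), which is defined only on the dense set of values of smooth sections and on which no
  bound is known that is uniform in the base point.

  The remedy is to differentiate inner products with constant vectors. Let \<open>A\<close> be a field of
  operators whose adjoint maps each constant section \<open>x\<close> to some \<open>\<sigma>\<^sub>x\<close> in \<open>\<Gamma>\<^sup>\<infinity>(U)\<close>, that is,
  \<open>\<langle>A\<phi>, x\<rangle> = \<langle>\<phi>, \<sigma>\<^sub>x\<rangle>\<close>. The product rule of the metric connection gives
  \<open>\<langle>\<nabla>\<^sub>X(A)\<phi>, x\<rangle> = \<langle>\<phi>, \<nabla>\<^sub>Y \<sigma>\<^sub>x\<rangle>\<close> with \<open>Y\<close> the conjugate of \<open>X\<close>. So \<open>\<nabla>\<^sub>X(A)\<close> is well defined pointwise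
  and is again a field of this kind (\<open>op_conn_eq\<close>, \<open>smooth_adjoint_op_conn\<close>); by induction so are all
  the iterated derivatives of \<open>T\<close>. As \<open>\<sigma>\<^sub>x\<close> is merely a limit of smooth sections, the product rule
  must first be extended to such limits (\<open>product_rule\<close>), by interchanging limits and derivatives
  (\<open>vf_apply_limit\<close>).

  Part a) is then the theorem of Hellinger and Toeplitz: at a fixed point, \<open>\<langle>Av, x\<rangle>\<close> is bounded for
  \<open>v\<close> in the unit ball, for each \<open>x\<close>, and the principle of uniform boundedness
  (\<open>weakly_bounded_imp_bounded\<close>) bounds \<open>Av\<close>.

  For b) and c), the same product rule, for \<open>\<phi>\<close> in \<open>\<Gamma>\<^sup>\<infinity>(U)\<close>, says that \<open>A\<phi>\<close> has the weak derivative
  \<open>\<nabla>\<^sub>X(A)\<phi> + A\<nabla>\<^sub>X\<phi>\<close> along \<open>X\<close> (\<open>weak_derivative_op_ext\<close>). A continuous weak derivative is a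
  derivative (\<open>weak_derivative_imp_derivative\<close>); hence \<open>A\<phi>\<close> is \<open>n + 1\<close> times continuously
  differentiable as soon as both summands are so \<open>n\<close> times for every \<open>X\<close> (\<open>op_ext_Ck_map_Suc\<close>).
  If all iterated derivatives map \<open>\<Gamma>\<^sup>\<infinity>(U)\<close> to continuous functions, induction on \<open>n\<close>, for all iterated derivatives and all \<open>\<phi>\<close> at once,
  gives smoothness of \<open>T\<phi>\<close>. Conversely, if \<open>T\<phi>\<close> is always smooth, then so is
  \<open>\<nabla>\<^sub>X(A)\<phi> = X(A\<phi>) - A\<nabla>\<^sub>X\<phi>\<close>, by induction on the number of derivatives. In c),
  \<open>\<nabla>\<^sub>X(T)\<phi> = T(T\<^sup>*\<nabla>\<^sub>X(T)\<phi>)\<close> is the image under \<open>T\<close> of an element of \<open>\<Gamma>\<^sup>\<infinity>(U)\<close>, so the induction closes on \<open>T\<close>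
  alone; it starts because \<open>T\<phi>\<close> is a locally uniform limit of continuous functions.
\<close>

section \<open>Parseval frames of the model space\<close>

text \<open>
  Orthonormal bases have this property, in dimension 0 as well. The expansion reduces a derivative in
  any direction to finitely many of them.
\<close>

definition parseval_frame :: "'e::real_inner set \<Rightarrow> bool" where
  "parseval_frame B \<longleftrightarrow> finite B \<and> (\<forall>u. (\<Sum>b\<in>B. (u \<bullet> b) *\<^sub>R b) = u)"

lemma parseval_frame_exists:
  assumes "finite (A::'e::real_inner set)" and "span A = UNIV"
  shows "\<exists>B::'e set. parseval_frame B"
proof -
  obtain C :: "'e set" where C: "finite C" "span C = UNIV" "pairwise orthogonal C"
    using basis_orthogonal[OF assms(1)] assms(2) by metis
  define C' where "C' = C - {0}"
  have C': "finite C'" "span C' = UNIV" "0 \<notin> C'" "pairwise orthogonal C'"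
    using C by (auto simp: C'_def pairwise_def)
  have coef: "(\<Sum>b\<in>C'. (u \<bullet> b / (b \<bullet> b)) *\<^sub>R b) = u" for u
  proof -
    have "u \<in> span C'" using C'(2) by simp
    then obtain a where u: "u = (\<Sum>b\<in>C'. a b *\<^sub>R b)"
      using C'(1) by (auto simp: span_finite)
    have "u \<bullet> b = a b * (b \<bullet> b)" if "b \<in> C'" for b
    proof -
      have "u \<bullet> b = (\<Sum>d\<in>C'. a d * (d \<bullet> b))"
        by (simp add: u inner_sum_left)
      also have "\<dots> = (\<Sum>d\<in>C'. if d = b then a b * (b \<bullet> b) else 0)"
        using C'(4) that by (intro sum.cong) (auto simp: pairwise_def orthogonal_def)
      finally show ?thesis using that C'(1) by simp
    qed
    then have "(u \<bullet> b / (b \<bullet> b)) *\<^sub>R b = a b *\<^sub>R b" if "b \<in> C'" for b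
      using that C'(3) by auto
    then have "(\<Sum>b\<in>C'. (u \<bullet> b / (b \<bullet> b)) *\<^sub>R b) = (\<Sum>b\<in>C'. a b *\<^sub>R b)"
      by (rule sum.cong[OF refl])
    with u show ?thesis by (simp only:)
  qed
  define n where "n b = b /\<^sub>R norm b" for b :: 'e
  have inj: "inj_on n C'"
  proof (rule inj_onI, rule ccontr)
    fix b d assume bd: "b \<in> C'" "d \<in> C'" "n b = n d" "b \<noteq> d"
    have "b \<bullet> d = 0" using pairwiseD[OF C'(4) bd(1,2,4)] by (simp only: orthogonal_def)
    then have "n b \<bullet> n d = 0" by (simp add: n_def)
    moreover have "b \<noteq> 0" using bd(1) C'(3) by blast
    then have "n b \<bullet> n b = 1" by (simp add: n_def dot_square_norm power2_eq_square)
    ultimately show False using bd(3) by simp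
  qed
  have "(\<Sum>b\<in>n ` C'. (u \<bullet> b) *\<^sub>R b) = u" for u
  proof -
    have "(\<Sum>b\<in>n ` C'. (u \<bullet> b) *\<^sub>R b) = (\<Sum>b\<in>C'. (u \<bullet> n b) *\<^sub>R n b)"
      by (simp add: sum.reindex inj)
    also have "\<dots> = (\<Sum>b\<in>C'. (u \<bullet> b / (b \<bullet> b)) *\<^sub>R b)"
      by (intro sum.cong refl)
        (simp add: n_def dot_square_norm power2_eq_square divide_inverse mult_ac)
    finally show ?thesis using coef by simp
  qed
  then show ?thesis
    unfolding parseval_frame_def using C'(1) by (intro exI[of _ "n ` C'"]) auto
qed

lemma linear_parseval_frame:
  assumes "linear L" and "parseval_frame B"
  shows "L u = (\<Sum>b\<in>B. (u \<bullet> b) *\<^sub>R L b)"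
proof -
  have "L (\<Sum>b\<in>B. (u \<bullet> b) *\<^sub>R b) = (\<Sum>b\<in>B. (u \<bullet> b) *\<^sub>R L b)"
    using assms(1) by (simp add: linear_sum linear_scale)
  then show ?thesis using assms(2) by (simp add: parseval_frame_def)
qed

text \<open>
  A ball lies in the image of a box of coefficients, and such images are compact by adding one
  coordinate at a time.
\<close>

lemma compact_cball_parseval_frame:
  fixes p :: "'e::real_inner"
  assumes "parseval_frame (B::'e set)"
  shows "compact (cball p r)"
proof -
  have box: "finite C \<Longrightarrow> compact {\<Sum>b\<in>C. t b *\<^sub>R b | t. \<forall>b\<in>C. \<bar>t b\<bar> \<le> s}" for C :: "'e set" and s
  proof (induction C rule: finite_induct)
    case (insert c C)
    let ?K = "\<lambda>C. {\<Sum>b\<in>C. t b *\<^sub>R b | t. \<forall>b\<in>C. \<bar>t b\<bar> \<le> s}"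
    have "?K (insert c C) = (\<lambda>(a, z). a *\<^sub>R c + z) ` ({-s..s} \<times> ?K C)"
    proof (intro equalityI subsetI)
      fix z assume "z \<in> ?K (insert c C)"
      then obtain t where "z = (\<Sum>b\<in>insert c C. t b *\<^sub>R b)" "\<forall>b\<in>insert c C. \<bar>t b\<bar> \<le> s" by blast
      then show "z \<in> (\<lambda>(a, z). a *\<^sub>R c + z) ` ({-s..s} \<times> ?K C)"
        using insert.hyps by (intro image_eqI[of _ _ "(t c, \<Sum>b\<in>C. t b *\<^sub>R b)"]) auto
    next
      fix z assume "z \<in> (\<lambda>(a, z). a *\<^sub>R c + z) ` ({-s..s} \<times> ?K C)"
      then obtain a t where z: "z = a *\<^sub>R c + (\<Sum>b\<in>C. t b *\<^sub>R b)" "-s \<le> a" "a \<le> s" "\<forall>b\<in>C. \<bar>t b\<bar> \<le> s"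
        by force
      have "(\<Sum>b\<in>C. (t(c := a)) b *\<^sub>R b) = (\<Sum>b\<in>C. t b *\<^sub>R b)"
        using insert.hyps by (intro sum.cong) auto
      then show "z \<in> ?K (insert c C)"
        using z insert.hyps by (intro CollectI exI[of _ "t(c := a)"]) auto
    qed
    moreover have "compact ((\<lambda>(a::real, z). a *\<^sub>R c + z) ` ({-s..s} \<times> ?K C))"
      using insert.IH
      by (intro compact_continuous_image compact_Times) (auto simp: split_def intro!: continuous_intros)
    ultimately show ?case by simp
  qed simp
  have fin: "finite B" and B: "\<And>u. (\<Sum>b\<in>B. (u \<bullet> b) *\<^sub>R b) = u"
    using assms by (auto simp: parseval_frame_def)
  define M where "M = (\<Sum>b\<in>B. norm b)"
  have M: "norm b \<le> M" if "b \<in> B" for b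
    using that fin by (auto simp: M_def intro: member_le_sum)
  let ?Q = "{\<Sum>b\<in>B. t b *\<^sub>R b | t. \<forall>b\<in>B. \<bar>t b\<bar> \<le> r * M}"
  have "cball 0 r \<subseteq> ?Q"
  proof
    fix u :: 'e assume u: "u \<in> cball 0 r"
    have "\<bar>u \<bullet> b\<bar> \<le> r * M" if "b \<in> B" for b
    proof -
      have "\<bar>u \<bullet> b\<bar> \<le> norm u * norm b" by (rule Cauchy_Schwarz_ineq2)
      also have "\<dots> \<le> r * M" using u M[OF that] by (intro mult_mono) (auto intro: order_trans[OF norm_ge_zero])
      finally show ?thesis .
    qed
    then show "u \<in> ?Q" using B[of u, symmetric] by (intro CollectI exI[of _ "\<lambda>b. u \<bullet> b"]) auto
  qed
  then have "compact (cball (0::'e) r)"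
    using compact_Int_closed[OF box[OF fin, of "r * M"] closed_cball[of 0 r]] by (simp add: Int_absorb1)
  then have "compact ((+) p ` cball 0 r)" by (rule compact_translation)
  then show ?thesis by simp
qed


section \<open>Calculus of \<open>C\<^sup>n\<close> functions\<close>

lemma frechet_derivative_eqI:
  "(f has_derivative f') (at x) \<Longrightarrow> frechet_derivative f (at x) = f'"
  by (metis frechet_derivative_at)

lemma differentiable_derivative:
  "f differentiable (at x) \<Longrightarrow> (f has_derivative frechet_derivative f (at x)) (at x)"
  by (simp add: frechet_derivative_works)

lemma Ck_on_subset: "Ck_on n W f \<Longrightarrow> V \<subseteq> W \<Longrightarrow> Ck_on n V f"
  by (induction n arbitrary: f) (auto intro: continuous_on_subset)

lemma Ck_on_cong_imp:
  assumes "open W" and "\<And>x. x \<in> W \<Longrightarrow> f x = g x" and "Ck_on n W f"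
  shows "Ck_on n W g"
  using assms(2,3)
proof (induction n arbitrary: f g)
  case 0
  then show ?case using continuous_on_cong by force
next
  case (Suc n)
  have d: "(g has_derivative frechet_derivative f (at x)) (at x)" if "x \<in> W" for x
    using Suc.prems that assms(1)
    by (intro has_derivative_transform_within_open[OF differentiable_derivative[of f]]) auto
  have "Ck_on n W (\<lambda>x. frechet_derivative g (at x) v)" for v
  proof (rule Suc.IH[of "\<lambda>x. frechet_derivative f (at x) v"])
    show "Ck_on n W (\<lambda>x. frechet_derivative f (at x) v)" using Suc.prems(2) by simp
  qed (simp add: frechet_derivative_eqI[OF d])
  then show ?case using d by (auto simp: differentiable_def)
qed

lemma Ck_on_Suc_I:
  assumes "open W" and "\<And>x. x \<in> W \<Longrightarrow> (f has_derivative f' x) (at x)"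
    and "\<And>v. Ck_on n W (\<lambda>x. f' x v)"
  shows "Ck_on (Suc n) W f"
proof -
  have "Ck_on n W (\<lambda>x. frechet_derivative f (at x) v)" for v
    by (intro Ck_on_cong_imp[OF assms(1) _ assms(3)[of v]]) (simp add: frechet_derivative_eqI[OF assms(2)])
  then show ?thesis using assms(2) by (auto simp: differentiable_def)
qed

lemma Ck_on_SucD:
  assumes "Ck_on (Suc n) W f"
  shows "\<And>x. x \<in> W \<Longrightarrow> (f has_derivative frechet_derivative f (at x)) (at x)"
    and "Ck_on n W (\<lambda>x. frechet_derivative f (at x) v)"
  using assms by (auto intro: differentiable_derivative)

lemma Ck_on_imp_continuous_on: "Ck_on n W f \<Longrightarrow> continuous_on W f"
  by (cases n)
    (auto intro!: continuous_at_imp_continuous_on differentiable_imp_continuous_within)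

lemma Ck_on_lower: "Ck_on (Suc n) W f \<Longrightarrow> Ck_on n W f"
proof (induction n arbitrary: f)
  case 0
  then show ?case by (metis Ck_on.simps(1) Ck_on_imp_continuous_on)
next
  case (Suc n)
  then show ?case by (metis Ck_on.simps(2))
qed

lemma Ck_on_local:
  assumes "\<And>x. x \<in> W \<Longrightarrow> \<exists>V. open V \<and> x \<in> V \<and> Ck_on n V f"
  shows "Ck_on n W f"
  using assms
proof (induction n arbitrary: f)
  case 0
  show ?case
    unfolding Ck_on.simps
  proof (rule continuous_at_imp_continuous_on, rule ballI)
    fix x assume "x \<in> W"
    with 0 obtain V where "open V" "x \<in> V" "continuous_on V f" by auto
    then show "isCont f x" by (simp add: continuous_on_eq_continuous_at)
  qed
next
  case (Suc n)
  show ?case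
    unfolding Ck_on.simps
  proof (intro conjI ballI allI)
    show "f differentiable (at x)" if "x \<in> W" for x using Suc.prems[OF that] by auto
    show "Ck_on n W (\<lambda>x. frechet_derivative f (at x) v)" for v
    proof (rule Suc.IH)
      fix x assume "x \<in> W"
      from Suc.prems[OF this] obtain V where "open V" "x \<in> V" "Ck_on (Suc n) V f" by blast
      then show "\<exists>V. open V \<and> x \<in> V \<and> Ck_on n V (\<lambda>x. frechet_derivative f (at x) v)"
        using Ck_on_SucD(2) by blast
    qed
  qed
qed

lemma Ck_on_const: "Ck_on n W (\<lambda>x. c)"
  by (induction n arbitrary: c) auto

lemma Ck_on_bounded_linear_compose:
  assumes "bounded_linear L" and "open W" and "Ck_on n W f"
  shows "Ck_on n W (\<lambda>x. L (f x))"
  using assms(3)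
proof (induction n arbitrary: f)
  case 0
  then show ?case
    by (simp add: bounded_linear.continuous_on[OF assms(1)])
next
  case (Suc n)
  show ?case
  proof (rule Ck_on_Suc_I[OF assms(2)])
    show "((\<lambda>x. L (f x)) has_derivative (\<lambda>v. L (frechet_derivative f (at x) v))) (at x)"
      if "x \<in> W" for x
      using Ck_on_SucD(1)[OF Suc.prems that] by (rule bounded_linear.has_derivative[OF assms(1)])
  qed (use Suc in auto)
qed

lemma Ck_on_bounded_linear:
  assumes "bounded_linear L" and "open W"
  shows "Ck_on n W L"
proof (cases n)
  case 0
  then show ?thesis using assms by (simp add: linear_continuous_on)
next
  case (Suc m)
  have "Ck_on (Suc m) W L"
    by (rule Ck_on_Suc_I[OF assms(2), where f' = "\<lambda>_. L"])
      (auto intro: Ck_on_const bounded_linear_imp_has_derivative assms)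
  with Suc show ?thesis by simp
qed

lemma Ck_on_ident: "open W \<Longrightarrow> Ck_on n W (\<lambda>x. x)"
  by (rule Ck_on_bounded_linear[OF bounded_linear_ident])

lemma Ck_on_add:
  assumes "open W" and "Ck_on n W f" and "Ck_on n W g"
  shows "Ck_on n W (\<lambda>x. f x + g x)"
  using assms(2,3)
proof (induction n arbitrary: f g)
  case (Suc n)
  show ?case
    by (rule Ck_on_Suc_I[OF assms(1) has_derivative_add])
      (use Suc in \<open>auto intro: differentiable_derivative\<close>)
qed (auto intro: continuous_on_add)

lemma Ck_on_minus: "open W \<Longrightarrow> Ck_on n W f \<Longrightarrow> Ck_on n W (\<lambda>x. - f x)"
  by (rule Ck_on_bounded_linear_compose[OF bounded_linear_minus[OF bounded_linear_ident]])

lemma Ck_on_diff: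
  "open W \<Longrightarrow> Ck_on n W f \<Longrightarrow> Ck_on n W g \<Longrightarrow> Ck_on n W (\<lambda>x. f x - g x)"
  using Ck_on_add[of W n f "\<lambda>x. - g x"] by (simp add: Ck_on_minus)

lemma Ck_on_sum:
  assumes "open W" and "\<And>i. i \<in> I \<Longrightarrow> Ck_on n W (f i)"
  shows "Ck_on n W (\<lambda>x. \<Sum>i\<in>I. f i x)"
  using assms(2)
proof (induction I rule: infinite_finite_induct)
  case (insert i I)
  then show ?case using Ck_on_add[OF assms(1), of n "f i"] by simp
qed (auto simp: Ck_on_const)

lemma Ck_on_bilinear:
  assumes "bounded_bilinear P" and "open W" and "Ck_on n W f" and "Ck_on n W g"
  shows "Ck_on n W (\<lambda>x. P (f x) (g x))"
  using assms(3,4)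
proof (induction n arbitrary: f g)
  case 0
  then show ?case by (simp add: bounded_bilinear.continuous_on[OF assms(1)])
next
  case (Suc n)
  show ?case
  proof (rule Ck_on_Suc_I[OF assms(2)])
    show "((\<lambda>x. P (f x) (g x)) has_derivative
        (\<lambda>v. P (f x) (frechet_derivative g (at x) v) + P (frechet_derivative f (at x) v) (g x))) (at x)"
      if "x \<in> W" for x
      by (rule bounded_bilinear.FDERIV[OF assms(1) Ck_on_SucD(1)[OF Suc.prems(1) that]
            Ck_on_SucD(1)[OF Suc.prems(2) that]])
    show "Ck_on n W (\<lambda>x. P (f x) (frechet_derivative g (at x) v) + P (frechet_derivative f (at x) v) (g x))"
      for v
      by (rule Ck_on_add[OF assms(2)]; rule Suc.IH)
        (rule Suc.prems[THEN Ck_on_lower] Suc.prems[THEN Ck_on_SucD(2)])+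
  qed
qed

lemmas Ck_on_scaleR = Ck_on_bilinear[OF bounded_bilinear_scaleR]
lemmas Ck_on_inner = Ck_on_bilinear[OF bounded_bilinear_inner]

text \<open>
  Expanding a direction in a frame reduces a derivative in a varying direction to finitely many
  derivatives in constant directions, the only ones about which \<open>Ck_on\<close> speaks directly. This is
  where the finite dimension of the model space enters the calculus.
\<close>

lemma Ck_on_derivative_apply:
  fixes F' :: "'c::real_normed_vector \<Rightarrow> 'a::real_inner \<Rightarrow> 'b::real_normed_vector"
  assumes "parseval_frame (B::'a set)" and "open W"
    and "\<And>x. x \<in> W \<Longrightarrow> linear (F' x)"
    and "\<And>b. Ck_on n W (\<lambda>x. F' x b)"
    and "Ck_on n W u"
  shows "Ck_on n W (\<lambda>x. F' x (u x))"
proof -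
  have "Ck_on n W (\<lambda>x. \<Sum>b\<in>B. (u x \<bullet> b) *\<^sub>R F' x b)"
    by (rule Ck_on_sum[OF assms(2)], rule Ck_on_scaleR[OF assms(2)], rule Ck_on_inner[OF assms(2)],
        rule assms(5), rule Ck_on_const, rule assms(4))
  then show ?thesis
    by (rule Ck_on_cong_imp[OF assms(2), rotated])
      (simp add: linear_parseval_frame[OF assms(3) assms(1), symmetric])
qed

text \<open>
  The derivative of the composition is that of \<open>g\<close>, evaluated along \<open>f\<close> and in the varying direction
  given by the derivative of \<open>f\<close>; for a constant direction the induction hypothesis applies to it.
\<close>

lemma Ck_on_compose:
  fixes g :: "'a::real_inner \<Rightarrow> 'b::real_normed_vector"
  assumes "parseval_frame (B::'a set)" and "open W" and "open V" and "f ` W \<subseteq> V"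
    and "Ck_on n W f" and "Ck_on n V g"
  shows "Ck_on n W (\<lambda>x. g (f x))"
  using assms(5,6)
proof (induction n arbitrary: g)
  case 0
  then show ?case using assms(4) by (auto intro: continuous_on_compose2)
next
  case (Suc n)
  have fx: "f x \<in> V" if "x \<in> W" for x using that assms(4) by auto
  show ?case
  proof (rule Ck_on_Suc_I[OF assms(2)])
    show "((\<lambda>x. g (f x)) has_derivative
        (\<lambda>v. frechet_derivative g (at (f x)) (frechet_derivative f (at x) v))) (at x)" if "x \<in> W" for x
      using Ck_on_SucD(1)[OF Suc.prems(1) that] Ck_on_SucD(1)[OF Suc.prems(2) fx[OF that]]
      by (rule has_derivative_compose)
    have "Ck_on n W (\<lambda>x. frechet_derivative g (at (f x)) b)" for b
      by (rule Suc.IH[of "\<lambda>y. frechet_derivative g (at y) b",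
            OF Ck_on_lower[OF Suc.prems(1)] Ck_on_SucD(2)[OF Suc.prems(2)]])
    then show "Ck_on n W (\<lambda>x. frechet_derivative g (at (f x)) (frechet_derivative f (at x) v))" for v
    proof (rule Ck_on_derivative_apply[OF assms(1,2), rotated])
      show "linear (frechet_derivative g (at (f x)))" if "x \<in> W" for x
        using Ck_on_SucD(1)[OF Suc.prems(2) fx[OF that]] by (rule has_derivative_linear)
    qed (rule Ck_on_SucD(2)[OF Suc.prems(1)])
  qed
qed

lemma smooth_onD: "smooth_on W f \<Longrightarrow> Ck_on n W f"
  by (simp add: smooth_on_def)

lemma smooth_on_frechet_derivative:
  "smooth_on W f \<Longrightarrow> smooth_on W (\<lambda>x. frechet_derivative f (at x) v)"
  by (auto simp: smooth_on_def intro: Ck_on_SucD(2))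

lemma smooth_on_has_derivative:
  "smooth_on W f \<Longrightarrow> x \<in> W \<Longrightarrow> (f has_derivative frechet_derivative f (at x)) (at x)"
  unfolding smooth_on_def using Ck_on_SucD(1)[of 0] by blast


section \<open>Bump functions\<close>

text \<open>
  Dividing \<open>exp (- 1 / t)\<close> by powers of \<open>t\<close> yields a family whose derivatives, also at 0, are linear
  combinations of its members; so all members are smooth.
\<close>

definition flat_exp :: "nat \<Rightarrow> real \<Rightarrow> real" where
  "flat_exp k t = (if t > 0 then exp (- (1 / t)) / t ^ k else 0)"

lemma flat_exp_tendsto_0: "(flat_exp k \<longlongrightarrow> 0) (at 0)"
proof (rule filterlim_split_at)
  show "(flat_exp k \<longlongrightarrow> 0) (at_left 0)"
    by (rule tendsto_eventually) (auto simp: flat_exp_def eventually_at_filter)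
  have "((\<lambda>t::real. inverse t ^ k / exp (inverse t)) \<longlongrightarrow> 0) (at_right 0)"
    by (rule filterlim_compose[OF tendsto_power_div_exp_0 filterlim_inverse_at_top_right])
  then show "(flat_exp k \<longlongrightarrow> 0) (at_right 0)"
    by (rule Lim_transform_eventually)
      (auto simp: flat_exp_def eventually_at_filter exp_minus field_simps)
qed

lemma flat_exp_has_derivative:
  "(flat_exp k has_real_derivative flat_exp (k + 2) t - k * flat_exp (k + 1) t) (at t)"
proof (rule linorder_cases[of t 0])
  assume t: "t < 0"
  have "((\<lambda>_. 0) has_real_derivative 0) (at t)" by simp
  then have "(flat_exp k has_real_derivative 0) (at t)"
    by (rule has_field_derivative_transform_within_open[where S = "{..<0}"])
      (use t in \<open>auto simp: flat_exp_def\<close>)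
  then show ?thesis using t by (simp add: flat_exp_def)
next
  assume t: "t = 0"
  have "((\<lambda>h. (flat_exp k (0 + h) - flat_exp k 0) / h) \<longlongrightarrow> 0) (at 0)"
    by (rule Lim_transform_eventually[OF flat_exp_tendsto_0[of "Suc k"]])
      (auto simp: flat_exp_def eventually_at_filter field_simps)
  then show ?thesis using t by (simp add: DERIV_def flat_exp_def)
next
  assume t: "0 < t"
  have "((\<lambda>t. exp (- (1 / t)) / t ^ k) has_real_derivative
      flat_exp (k + 2) t - k * flat_exp (k + 1) t) (at t)"
  proof -
    have "((\<lambda>t. exp (- (1 / t))) has_real_derivative exp (- (1 / t)) / t\<^sup>2) (at t)"
      using t by (auto simp: power2_eq_square intro!: derivative_eq_intros)
    from DERIV_divide[OF this DERIV_pow[of k]] t show ?thesis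
      by (cases k) (auto elim!: DERIV_cong simp: flat_exp_def field_simps power2_eq_square)
  qed
  then show ?thesis
    by (rule has_field_derivative_transform_within_open[where S = "{0<..}"])
      (use t in \<open>auto simp: flat_exp_def\<close>)
qed

lemma Ck_on_flat_exp: "Ck_on n UNIV (flat_exp k)"
proof (induction n arbitrary: k)
  case 0
  have "isCont (flat_exp k) t" for t using flat_exp_has_derivative by (rule DERIV_isCont)
  then show ?case by (simp add: continuous_at_imp_continuous_on)
next
  case (Suc n)
  have d: "(flat_exp k has_derivative (\<lambda>v. v *\<^sub>R (flat_exp (k + 2) t - k *\<^sub>R flat_exp (k + 1) t))) (at t)" for t
    using flat_exp_has_derivative[of k t] by (simp add: has_field_derivative_def mult_commute_abs)
  show ?case
  proof (rule Ck_on_Suc_I[OF _ d])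
    show "Ck_on n UNIV (\<lambda>t. v *\<^sub>R (flat_exp (k + 2) t - k *\<^sub>R flat_exp (k + 1) t))" for v
      by (rule Ck_on_scaleR[OF open_UNIV Ck_on_const], rule Ck_on_diff[OF open_UNIV], rule Suc.IH,
          rule Ck_on_scaleR[OF open_UNIV Ck_on_const], rule Suc.IH)
  qed simp
qed

lemma parseval_frame_real: "parseval_frame {1::real}"
  by (simp add: parseval_frame_def)

lemma Ck_on_flat_exp_compose:
  assumes "open W" and "Ck_on n W f"
  shows "Ck_on n W (\<lambda>x. flat_exp k (f x))"
  by (rule Ck_on_compose[OF parseval_frame_real assms(1) open_UNIV subset_UNIV assms(2) Ck_on_flat_exp])

lemma flat_exp_pos: "0 < t \<Longrightarrow> 0 < flat_exp k t"
  by (simp add: flat_exp_def)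

lemma flat_exp_0_mono: "s \<le> t \<Longrightarrow> flat_exp 0 s \<le> flat_exp 0 t"
  by (auto simp: flat_exp_def frac_le)

text \<open>
  As a function of the squared distance to \<open>p\<close>, \<open>h\<close> vanishes up to \<open>e\<^sup>2 / 2\<close> and then increases, reaching
  \<open>a\<close> at \<open>e\<^sup>2\<close>. Hence \<open>flat_exp 0 (a - h)\<close> is constant near \<open>p\<close> and vanishes off the ball of radius \<open>e\<close>.
\<close>

lemma smooth_bump_exists:
  fixes p :: "'e::real_inner"
  assumes frame: "parseval_frame (B::'e set)" and "open W" and "p \<in> W"
  shows "\<exists>\<beta> V Q. smooth_on UNIV (\<beta>::'e \<Rightarrow> real) \<and> open V \<and> p \<in> V \<and> (\<forall>x\<in>V. \<beta> x = 1) \<and>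
    compact Q \<and> Q \<subseteq> W \<and> (\<forall>x. x \<notin> Q \<longrightarrow> \<beta> x = 0)"
proof -
  obtain e where e: "e > 0" "cball p e \<subseteq> W"
    using assms(2,3) open_contains_cball by blast
  define h where "h s = flat_exp 0 (s - e\<^sup>2 / 2)" for s
  define a where "a = h (e\<^sup>2)"
  have a: "a > 0" using e by (auto simp: a_def h_def intro!: flat_exp_pos)
  define \<beta> where "\<beta> x = (1 / flat_exp 0 a) *\<^sub>R flat_exp 0 (a - h ((x - p) \<bullet> (x - p)))" for x
  have "Ck_on n UNIV \<beta>" for n
  proof -
    have x: "Ck_on n UNIV (\<lambda>x::'e. x - p)"
      by (rule Ck_on_diff[OF open_UNIV Ck_on_ident[OF open_UNIV] Ck_on_const])
    have "Ck_on n UNIV (\<lambda>x. h ((x - p) \<bullet> (x - p)))"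
      unfolding h_def
      by (rule Ck_on_flat_exp_compose[OF open_UNIV], rule Ck_on_diff[OF open_UNIV _ Ck_on_const],
          rule Ck_on_inner[OF open_UNIV x x])
    then show ?thesis
      unfolding \<beta>_def
      by (intro Ck_on_scaleR[OF open_UNIV Ck_on_const] Ck_on_flat_exp_compose[OF open_UNIV]
          Ck_on_diff[OF open_UNIV Ck_on_const])
  qed
  moreover have "\<beta> x = 1" if "x \<in> ball p (e / 2)" for x
  proof -
    have "(x - p) \<bullet> (x - p) \<le> (e / 2)\<^sup>2"
      using that by (auto simp: dot_square_norm dist_norm norm_minus_commute intro!: power_mono)
    also have "\<dots> \<le> e\<^sup>2 / 2" by (simp add: power_divide)
    finally have "h ((x - p) \<bullet> (x - p)) = 0" by (simp add: h_def flat_exp_def)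
    then show ?thesis using flat_exp_pos[OF a, of 0] by (simp add: \<beta>_def)
  qed
  moreover have "\<beta> x = 0" if "x \<notin> cball p e" for x
  proof -
    have "e\<^sup>2 \<le> (x - p) \<bullet> (x - p)"
      using that e by (auto simp: dot_square_norm dist_norm norm_minus_commute intro!: power_mono)
    then have "a \<le> h ((x - p) \<bullet> (x - p))"
      by (auto simp: a_def h_def intro: flat_exp_0_mono)
    then show ?thesis by (simp add: \<beta>_def flat_exp_def)
  qed
  ultimately show ?thesis
    using e compact_cball_parseval_frame[OF frame, of p e]
    by (intro exI[of _ \<beta>] exI[of _ "ball p (e / 2)"] exI[of _ "cball p e"]) (auto simp: smooth_on_def)
qed


section \<open>Complex Hilbert spaces\<close>

lemma cinner_add_right: "cinner z (x + y) = cinner z x + cinner z (y::'k::complex_hilbert)"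
  by (metis cinner_add_left cinner_commute complex_cnj_add)

lemma cinner_scaleC_right: "cinner x (a *\<^sub>C y) = cnj a * cinner x (y::'k::complex_hilbert)"
  by (metis cinner_commute cinner_scaleC_left complex_cnj_mult)

lemma scaleC_minus_one: "(- 1) *\<^sub>C (x::'k::complex_hilbert) = - x"
  using scaleC_of_real[of "- 1" x] by simp

lemma scaleC_scaleR: "a *\<^sub>C (r *\<^sub>R x) = r *\<^sub>R (a *\<^sub>C (x::'k::complex_hilbert))"
  by (simp add: scaleC_scaleC mult.commute flip: scaleC_of_real)

lemma norm_scaleC: "norm (a *\<^sub>C (x::'k::complex_hilbert)) = cmod a * norm x"
proof -
  have "cinner (a *\<^sub>C x) (a *\<^sub>C x) = complex_of_real ((cmod a)\<^sup>2) * cinner x x"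
    by (simp add: cinner_scaleC_left cinner_scaleC_right complex_norm_square mult_ac del: of_real_power)
  then have "(a *\<^sub>C x) \<bullet> (a *\<^sub>C x) = (cmod a)\<^sup>2 * (x \<bullet> x)"
    by (simp flip: Re_cinner)
  then have "(norm (a *\<^sub>C x))\<^sup>2 = (cmod a * norm x)\<^sup>2"
    by (simp add: dot_square_norm power_mult_distrib)
  then show ?thesis by (simp add: power2_eq_iff_nonneg)
qed

lemma bounded_linear_scaleC: "bounded_linear (\<lambda>x::'k::complex_hilbert. a *\<^sub>C x)"
  by (rule bounded_linear_intro[where K = "cmod a"])
    (auto simp: scaleC_add_right scaleC_scaleR norm_scaleC)

lemma norm_cinner_le: "norm (cinner x (y::'k::complex_hilbert)) \<le> norm x * norm y"
proof -
  \<comment> \<open>A phase that turns the inner product into its absolute value, which is then real.\<close>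
  define a where "a = (if cinner x y = 0 then 1 else cnj (sgn (cinner x y)))"
  have a: "cmod a = 1" by (simp add: a_def norm_sgn)
  have "a * cinner x y = complex_of_real (cmod (cinner x y))"
  proof (cases "cinner x y = 0")
    case False
    have "cnj (sgn (cinner x y)) * cinner x y = complex_of_real ((cmod (cinner x y))\<^sup>2) / complex_of_real (cmod (cinner x y))"
      by (simp only: complex_norm_square sgn_eq complex_cnj_divide complex_cnj_complex_of_real) simp
    then show ?thesis using False by (simp add: a_def power2_eq_square)
  qed simp
  then have "cmod (cinner x y) = Re (a * cinner x y)" by simp
  also have "\<dots> = (a *\<^sub>C x) \<bullet> y" by (simp add: Re_cinner flip: cinner_scaleC_left)
  also have "\<dots> \<le> norm (a *\<^sub>C x) * norm y" by (rule norm_cauchy_schwarz)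
  finally show ?thesis by (simp add: norm_scaleC a)
qed

lemma bounded_bilinear_cinner: "bounded_bilinear (cinner :: 'k::complex_hilbert \<Rightarrow> 'k \<Rightarrow> complex)"
proof
  fix x y :: 'k and r
  show "cinner (r *\<^sub>R x) y = r *\<^sub>R cinner x y"
    by (simp add: cinner_scaleC_left scaleR_conv_of_real flip: scaleC_of_real)
  show "cinner x (r *\<^sub>R y) = r *\<^sub>R cinner x y"
    by (simp add: cinner_scaleC_right scaleR_conv_of_real flip: scaleC_of_real)
  show "\<exists>K. \<forall>x y::'k. norm (cinner x y) \<le> norm x * norm y * K"
    using norm_cinner_le by (intro exI[of _ 1]) auto
qed (auto simp: cinner_add_left cinner_add_right)

lemmas bounded_linear_cinner_left = bounded_bilinear.bounded_linear_left[OF bounded_bilinear_cinner]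
lemmas bounded_linear_cinner_right = bounded_bilinear.bounded_linear_right[OF bounded_bilinear_cinner]
lemmas cinner_diff_left = bounded_bilinear.diff_left[OF bounded_bilinear_cinner]

lemma closed_csubspace_add: "closed_csubspace K \<Longrightarrow> x \<in> K \<Longrightarrow> y \<in> K \<Longrightarrow> x + y \<in> K"
  by (simp add: closed_csubspace_def)

lemma closed_csubspace_scaleC: "closed_csubspace K \<Longrightarrow> x \<in> K \<Longrightarrow> a *\<^sub>C x \<in> K"
  by (simp add: closed_csubspace_def)

lemma closed_csubspace_scaleR: "closed_csubspace K \<Longrightarrow> x \<in> K \<Longrightarrow> r *\<^sub>R x \<in> K"
  using closed_csubspace_scaleC[of K x "complex_of_real r"] by (simp add: scaleC_of_real)

lemma closed_csubspace_diff: "closed_csubspace K \<Longrightarrow> x \<in> K \<Longrightarrow> y \<in> K \<Longrightarrow> x - y \<in> K"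
  using closed_csubspace_add[of K x "- y"] closed_csubspace_scaleR[of K y "- 1"] by simp

lemma closed_csubspace_subspace: "closed_csubspace K \<Longrightarrow> subspace K"
  using closed_csubspace_add closed_csubspace_scaleR
  by (auto simp: subspace_def) (simp add: closed_csubspace_def)

lemma cinner_eqI:
  assumes "closed_csubspace K" and "x \<in> K" and "y \<in> K"
    and "\<And>z. z \<in> K \<Longrightarrow> cinner x z = cinner y z"
  shows "x = y"
proof -
  have "cinner (x - y) (x - y) = 0"
    using assms closed_csubspace_diff[OF assms(1-3)] by (simp add: cinner_diff_left)
  then have "(x - y) \<bullet> (x - y) = 0" by (simp flip: Re_cinner)
  then show ?thesis by simp
qed

section \<open>Weak boundedness and weak derivatives\<close>

text \<open>
  The gliding hump argument. If \<open>w\<^sub>n\<close> has norm at least \<open>4\<^sup>n\<close>, then moving a point by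
  \<open>\<plusminus>3\<^sup>-\<^sup>n\<close> along \<open>w\<^sub>n\<close>, with the better sign, makes its product with \<open>w\<^sub>n\<close> at least
  \<open>3\<^sup>-\<^sup>n \<parallel>w\<^sub>n\<parallel>\<close>; all later moves together undo at most half of this. Hence the products with the
  limit point are unbounded.
\<close>

lemma weakly_bounded_imp_bounded:
  fixes W :: "'k::{real_inner,banach} set"
  assumes K: "closed K" "subspace K" "W \<subseteq> K"
    and weak: "\<And>x. x \<in> K \<Longrightarrow> \<exists>C. \<forall>w\<in>W. \<bar>w \<bullet> x\<bar> \<le> C"
  shows "\<exists>C. \<forall>w\<in>W. norm w \<le> C"
proof (rule ccontr)
  assume "\<not> ?thesis"
  then have "\<exists>w\<in>W. 4 ^ n < norm w" for n :: nat by (meson not_le)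
  then obtain w where w: "\<And>n. w n \<in> W" "\<And>n::nat. 4 ^ n < norm (w n)" by metis
  have w0: "norm (w n) > 0" for n using w(2)[of n] by (rule order_less_trans[rotated]) simp
  define h where "h n = (1 / 3 ^ n) *\<^sub>R (w n /\<^sub>R norm (w n))" for n
  define x where "x = rec_nat 0 (\<lambda>n x. if \<bar>w n \<bullet> (x + h n)\<bar> \<ge> \<bar>w n \<bullet> (x - h n)\<bar> then x + h n else x - h n)"
  have nh: "norm (h n) = 1 / 3 ^ n" for n using w0[of n] by (simp add: h_def)
  have wh: "w n \<bullet> h n = norm (w n) / 3 ^ n" for n
    using w0[of n] by (simp add: h_def dot_square_norm power2_eq_square)
  have x_Suc: "x (Suc n) = (if \<bar>w n \<bullet> (x n + h n)\<bar> \<ge> \<bar>w n \<bullet> (x n - h n)\<bar> then x n + h n else x n - h n)" for n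
    by (simp add: x_def)
  have step: "norm (x (Suc n) - x n) \<le> 1 / 3 ^ n" for n
    using nh[of n] by (simp add: x_Suc)
  have hump: "\<bar>w n \<bullet> x (Suc n)\<bar> \<ge> norm (w n) / 3 ^ n" for n
    using wh[of n] w0[of n] by (auto simp: x_Suc inner_add_right inner_diff_right)
  have xK: "x n \<in> K" for n
  proof (induction n)
    case 0
    show ?case using K(2) by (simp add: x_def subspace_0)
  next
    case (Suc n)
    have "h n \<in> K" using w(1) K by (auto simp: h_def intro!: subspace_scale)
    with Suc show ?case using K(2) by (simp add: x_Suc subspace_add subspace_diff)
  qed
  have far: "norm (x (Suc n + m) - x (Suc n)) \<le> 1 / (2 * 3 ^ n) * (1 - 1 / 3 ^ m)" for n m
  proof (induction m)
    case (Suc m)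
    have "norm (x (Suc n + Suc m) - x (Suc n)) \<le>
        norm (x (Suc (Suc n + m)) - x (Suc n + m)) + norm (x (Suc n + m) - x (Suc n))"
      using norm_triangle_ineq[of "x (Suc (Suc n + m)) - x (Suc n + m)" "x (Suc n + m) - x (Suc n)"] by simp
    also have "\<dots> \<le> 1 / 3 ^ (Suc n + m) + 1 / (2 * 3 ^ n) * (1 - 1 / 3 ^ m)"
      using step[of "Suc n + m"] Suc.IH by (intro add_mono) auto
    also have "\<dots> = 1 / (2 * 3 ^ n) * (1 - 1 / 3 ^ Suc m)"
      by (simp add: field_simps power_add)
    finally show ?case .
  qed simp
  have "summable (\<lambda>n. norm (x (Suc n) - x n))"
  proof (rule summable_comparison_test)
    show "\<exists>N. \<forall>n\<ge>N. norm (norm (x (Suc n) - x n)) \<le> (1 / 3) ^ n"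
      using step by (auto simp: power_one_over)
  qed simp
  then have "summable (\<lambda>n. x (Suc n) - x n)" by (rule summable_norm_cancel)
  then have "convergent x"
    using summable_iff_convergent[of "\<lambda>n. x (Suc n) - x n"] convergent_diff_const_right_iff[of x "x 0"]
    by (simp add: sum_lessThan_telescope)
  then obtain l where l: "x \<longlonglongrightarrow> l" by (auto simp: convergent_def)
  have "l \<in> K" using K(1) xK l by (metis closed_sequentially)
  then obtain C where C: "\<And>v. v \<in> W \<Longrightarrow> \<bar>v \<bullet> l\<bar> \<le> C" using weak by blast
  have "norm (l - x (Suc n)) \<le> 1 / (2 * 3 ^ n)" for n
  proof (rule tendsto_upperbound)
    show "(\<lambda>m. norm (x (Suc n + m) - x (Suc n))) \<longlonglongrightarrow> norm (l - x (Suc n))"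
      using LIMSEQ_ignore_initial_segment[OF l, of "Suc n"]
      by (intro tendsto_norm tendsto_diff tendsto_const) (simp add: add.commute)
    show "\<forall>\<^sub>F m in sequentially. norm (x (Suc n + m) - x (Suc n)) \<le> 1 / (2 * 3 ^ n)"
    proof (rule always_eventually, rule allI)
      fix m show "norm (x (Suc n + m) - x (Suc n)) \<le> 1 / (2 * 3 ^ n)"
        using far[of n m] by (rule order_trans) (simp add: field_simps)
    qed
  qed simp
  then have tail: "\<bar>w n \<bullet> (l - x (Suc n))\<bar> \<le> norm (w n) / (2 * 3 ^ n)" for n
    using order_trans[OF Cauchy_Schwarz_ineq2[of "w n" "l - x (Suc n)"] mult_left_mono[OF _ norm_ge_zero]]
    by fastforce
  have "(4 / 3) ^ n / 2 \<le> C" for n :: nat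
  proof -
    have "(4 / 3) ^ n / 2 \<le> norm (w n) / (2 * 3 ^ n)"
      using w(2)[of n] by (simp add: power_divide field_simps)
    also have "\<dots> = norm (w n) / 3 ^ n - norm (w n) / (2 * 3 ^ n)" by simp
    also have "\<dots> \<le> \<bar>w n \<bullet> l\<bar>"
      using hump[of n] tail[of n] by (simp add: inner_diff_right abs_if split: if_splits)
    finally show ?thesis using C[OF w(1)[of n]] by simp
  qed
  then have "(4 / 3) ^ n \<le> 2 * C" for n :: nat by (simp add: field_simps)
  moreover obtain n where "2 * C < (4 / 3) ^ n" using real_arch_pow[of "4 / 3" "2 * C"] by auto
  ultimately show False by (meson not_le)
qed

text \<open>
  Apply the mean value inequality to \<open>\<langle>f, x\<rangle>\<close> with \<open>x\<close> the error of the linear approximation itself: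
  this bounds the norm of the error, although the hypothesis only concerns one functional at a time.
  Continuity of \<open>G\<close> in finitely many directions makes it continuous in the operator norm.
\<close>

lemma weak_derivative_imp_derivative:
  fixes f :: "'e::real_inner \<Rightarrow> 'k::real_inner"
  assumes frame: "parseval_frame (B::'e set)" and "open W" and "subspace K"
    and f: "\<And>y. y \<in> W \<Longrightarrow> f y \<in> K" and G: "\<And>y v. y \<in> W \<Longrightarrow> G y v \<in> K"
    and lin: "\<And>y. y \<in> W \<Longrightarrow> linear (G y)"
    and cont: "\<And>b. b \<in> B \<Longrightarrow> continuous_on W (\<lambda>y. G y b)"
    and weak: "\<And>x y. x \<in> K \<Longrightarrow> y \<in> W \<Longrightarrow>
      ((\<lambda>z. f z \<bullet> x) has_derivative (\<lambda>v. G y v \<bullet> x)) (at y)"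
    and y: "y \<in> W"
  shows "(f has_derivative G y) (at y)"
proof -
  have fin: "finite B" using frame by (simp add: parseval_frame_def)
  have expand: "G z v = (\<Sum>b\<in>B. (v \<bullet> b) *\<^sub>R G z b)" if "z \<in> W" for z v
    by (rule linear_parseval_frame[OF lin[OF that] frame])
  have "bounded_linear (\<lambda>v. \<Sum>b\<in>B. (v \<bullet> b) *\<^sub>R G y b)"
    by (intro bounded_linear_sum bounded_linear_compose[OF bounded_linear_scaleR_left] bounded_linear_inner_left)
  moreover have "G y = (\<lambda>v. \<Sum>b\<in>B. (v \<bullet> b) *\<^sub>R G y b)" by (rule ext) (rule expand[OF y])
  ultimately have bl: "bounded_linear (G y)" by (rule ssubst[rotated])
  define \<delta> where "\<delta> z = (\<Sum>b\<in>B. norm b * norm (G z b - G y b))" for z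
  have \<delta>: "norm (G z v - G y v) \<le> \<delta> z * norm v" if "z \<in> W" for z v
  proof -
    have "norm (G z v - G y v) = norm (\<Sum>b\<in>B. (v \<bullet> b) *\<^sub>R (G z b - G y b))"
      using expand[OF that, of v] expand[OF y, of v] by (simp add: sum_subtractf scaleR_diff_right)
    also have "\<dots> \<le> (\<Sum>b\<in>B. (norm v * norm b) * norm (G z b - G y b))"
      by (rule sum_norm_le) (auto intro!: mult_right_mono Cauchy_Schwarz_ineq2)
    also have "\<dots> = \<delta> z * norm v" by (simp add: \<delta>_def sum_distrib_left mult_ac)
    finally show ?thesis .
  qed
  show ?thesis
    unfolding has_derivative_at_alt
  proof (intro conjI bl allI impI)
    fix e :: real assume e: "e > 0"
    have "continuous_on W \<delta>"
      unfolding \<delta>_def by (intro continuous_intros cont)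
    then have "open (W \<inter> \<delta> -` {..<e})"
      using \<open>open W\<close> by (simp add: continuous_open_preimage)
    moreover have "y \<in> W \<inter> \<delta> -` {..<e}" using y e by (simp add: \<delta>_def)
    ultimately obtain d where d: "d > 0" "ball y d \<subseteq> W \<inter> \<delta> -` {..<e}" by (meson openE)
    have "norm (f z - f y - G y (z - y)) \<le> e * norm (z - y)" if "norm (z - y) < d" for z
    proof -
      have z: "z \<in> ball y d" using that by (simp add: dist_norm norm_minus_commute)
      \<comment> \<open>The functional against which the error is tested is the error itself.\<close>
      define x where "x = f z - f y - G y (z - y)"
      have x: "x \<in> K"
        using z d y f G \<open>subspace K\<close> unfolding x_def by (intro subspace_diff) auto
      define \<phi> where "\<phi> u = f u \<bullet> x - G y u \<bullet> x" for u
      have D: "(\<phi> has_derivative (\<lambda>v. G u v \<bullet> x - G y v \<bullet> x)) (at u within ball y d)"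
        if "u \<in> ball y d" for u
      proof -
        have "u \<in> W" using that d by auto
        then show ?thesis
          unfolding \<phi>_def
          by (intro has_derivative_at_withinI[OF has_derivative_diff] weak[OF x]
              bounded_linear_imp_has_derivative bounded_linear_compose[OF bounded_linear_inner_left bl])
      qed
      have "norm (\<phi> z - \<phi> y) \<le> (e * norm x) * norm (z - y)"
      proof (rule differentiable_bound[OF convex_ball D])
        fix u assume u: "u \<in> ball y d"
        show "onorm (\<lambda>v. G u v \<bullet> x - G y v \<bullet> x) \<le> e * norm x"
        proof (rule onorm_bound)
          show "0 \<le> e * norm x" using e by simp
          fix v
          have "norm (G u v \<bullet> x - G y v \<bullet> x) \<le> norm (G u v - G y v) * norm x"
            using Cauchy_Schwarz_ineq2[of "G u v - G y v" x] by (simp add: inner_diff_left)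
          also have "\<dots> \<le> (\<delta> u * norm v) * norm x"
            using \<delta>[of u v] u d by (intro mult_right_mono) auto
          also have "\<dots> \<le> (e * norm v) * norm x"
          proof -
            have "\<delta> u \<le> e" using u d(2) by (auto intro: less_imp_le)
            then show ?thesis by (intro mult_right_mono) auto
          qed
          finally show "norm (G u v \<bullet> x - G y v \<bullet> x) \<le> e * norm x * norm v" by (simp add: mult_ac)
        qed
      qed (use z d in auto)
      moreover have "\<phi> z - \<phi> y = x \<bullet> x"
        using linear_diff[OF lin[OF y], of z y]
        by (simp add: \<phi>_def x_def inner_diff_left)
      ultimately have "norm x * norm x \<le> (e * norm (z - y)) * norm x"
        by (simp add: dot_square_norm power2_eq_square mult_ac)
      then have "norm x \<le> e * norm (z - y)"
        using e by (cases "x = 0") auto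
      then show ?thesis by (simp add: x_def)
    qed
    then show "\<exists>d>0. \<forall>z. norm (z - y) < d \<longrightarrow> norm (f z - f y - G y (z - y)) \<le> e * norm (z - y)"
      using d(1) by blast
  qed
qed


section \<open>Manifolds and vector fields\<close>

locale smooth_manifold =
  fixes \<A> :: "('m::{t2_space,second_countable_topology}, 'e::real_inner) chart set"
  assumes atlas: "smooth_atlas \<A>"
begin

lemma frame_exists: "\<exists>B::'e set. parseval_frame B"
  using atlas parseval_frame_exists unfolding smooth_atlas_def by blast

lemma chart_at: obtains c where "c \<in> \<A>" "\<xi> \<in> fst c"
  using atlas unfolding smooth_atlas_def by blast

lemma open_chart: "c \<in> \<A> \<Longrightarrow> open (fst c)"
  using atlas unfolding smooth_atlas_def by blast

lemma chart_homeomorphism: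
  "c \<in> \<A> \<Longrightarrow> homeomorphism (fst c) (snd c ` fst c) (snd c) (chart_inv c)"
  using atlas unfolding smooth_atlas_def by blast

lemma chart_inv_chart: "c \<in> \<A> \<Longrightarrow> \<xi> \<in> fst c \<Longrightarrow> chart_inv c (snd c \<xi>) = \<xi>"
  using chart_homeomorphism by (auto simp: homeomorphism_def)

lemma chart_image_cases:
  assumes "c \<in> \<A>" and "y \<in> snd c ` (fst c \<inter> V)"
  shows "chart_inv c y \<in> fst c" "chart_inv c y \<in> V" "snd c (chart_inv c y) = y"
  using assms by (auto simp: chart_inv_chart)

lemma open_chart_image:
  assumes "c \<in> \<A>" and "open V"
  shows "open (snd c ` (fst c \<inter> V))"
proof -
  have "openin (top_of_set (fst c)) (fst c \<inter> V)"
    using assms(2) by (simp add: openin_open_Int)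
  then have "openin (top_of_set (snd c ` fst c)) (snd c ` (fst c \<inter> V))"
    by (rule homeomorphism_imp_open_map[OF chart_homeomorphism[OF assms(1)]])
  moreover have "open (snd c ` fst c)"
    using atlas assms(1) unfolding smooth_atlas_def by blast
  ultimately show ?thesis using openin_open_trans by blast
qed

lemma continuous_on_chart: "c \<in> \<A> \<Longrightarrow> continuous_on (fst c) (snd c)"
  using chart_homeomorphism by (auto simp: homeomorphism_def)

lemma continuous_on_chart_inv: "c \<in> \<A> \<Longrightarrow> continuous_on (snd c ` fst c) (chart_inv c)"
  using chart_homeomorphism by (auto simp: homeomorphism_def)

lemma open_chart_vimage:
  assumes "c \<in> \<A>" and "open W"
  shows "open (fst c \<inter> snd c -` W)"
  using continuous_open_preimage[OF continuous_on_chart open_chart] assms by blast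

lemma transition_smooth:
  "c \<in> \<A> \<Longrightarrow> d \<in> \<A> \<Longrightarrow> smooth_on (snd c ` (fst c \<inter> fst d)) (\<lambda>y. snd d (chart_inv c y))"
  using atlas unfolding smooth_atlas_def comp_def by blast

lemma transition_has_derivative:
  assumes "c \<in> \<A>" and "d \<in> \<A>" and "\<xi> \<in> fst c" and "\<xi> \<in> fst d"
  shows "((\<lambda>y. snd d (chart_inv c y)) has_derivative chart_deriv c (snd d) \<xi>) (at (snd c \<xi>))"
  using smooth_on_has_derivative[OF transition_smooth[OF assms(1,2)], of "snd c \<xi>"] assms(3,4)
  by (auto simp: chart_deriv_def comp_def)


subsection \<open>Maps of class \<open>C\<^sup>n\<close>\<close>

definition Ck_map :: "nat \<Rightarrow> 'm set \<Rightarrow> ('m \<Rightarrow> 'f::real_normed_vector) \<Rightarrow> bool" where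
  "Ck_map n V f \<longleftrightarrow> (\<forall>c\<in>\<A>. Ck_on n (snd c ` (fst c \<inter> V)) (\<lambda>y. f (chart_inv c y)))"

lemma smooth_map_iff: "smooth_map \<A> V f \<longleftrightarrow> (\<forall>n. Ck_map n V f)"
  by (auto simp: smooth_map_def smooth_on_def Ck_map_def comp_def)

lemma Ck_map_subset: "Ck_map n V f \<Longrightarrow> V' \<subseteq> V \<Longrightarrow> Ck_map n V' f"
  unfolding Ck_map_def by (metis Ck_on_subset Int_mono image_mono subset_refl)

lemma Ck_map_cong:
  assumes "open V" and "\<And>\<xi>. \<xi> \<in> V \<Longrightarrow> f \<xi> = g \<xi>" and "Ck_map n V f"
  shows "Ck_map n V g"
  unfolding Ck_map_def
proof
  fix c assume c: "c \<in> \<A>"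
  show "Ck_on n (snd c ` (fst c \<inter> V)) (\<lambda>y. g (chart_inv c y))"
  proof (rule Ck_on_cong_imp[OF open_chart_image[OF c assms(1)]])
    show "f (chart_inv c y) = g (chart_inv c y)" if "y \<in> snd c ` (fst c \<inter> V)" for y
      using chart_image_cases[OF c that] assms(2) by blast
  qed (use c assms(3) in \<open>simp add: Ck_map_def\<close>)
qed

lemma Ck_map_local:
  assumes "\<And>\<xi>. \<xi> \<in> V \<Longrightarrow> \<exists>V'. open V' \<and> \<xi> \<in> V' \<and> Ck_map n V' f"
  shows "Ck_map n V f"
  unfolding Ck_map_def
proof
  fix c assume c: "c \<in> \<A>"
  show "Ck_on n (snd c ` (fst c \<inter> V)) (\<lambda>y. f (chart_inv c y))"
  proof (rule Ck_on_local)
    fix y assume y: "y \<in> snd c ` (fst c \<inter> V)"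
    then obtain V' where V': "open V'" "chart_inv c y \<in> V'" "Ck_map n V' f"
      using assms chart_image_cases[OF c y] by blast
    have "y \<in> snd c ` (fst c \<inter> V')"
      using chart_image_cases[OF c y] V'(2) by (intro image_eqI[of _ _ "chart_inv c y"]) auto
    then show "\<exists>W. open W \<and> y \<in> W \<and> Ck_on n W (\<lambda>y. f (chart_inv c y))"
      using open_chart_image[OF c V'(1)] V'(3) c unfolding Ck_map_def by blast
  qed
qed

text \<open>The transition maps are smooth, so regularity in one chart carries over to all others.\<close>

lemma Ck_map_chartI:
  assumes "c \<in> \<A>" and "open V" and "V \<subseteq> fst c" and "Ck_on n (snd c ` V) (\<lambda>y. f (chart_inv c y))"
  shows "Ck_map n V f"
  unfolding Ck_map_def
proof
  fix d assume d: "d \<in> \<A>"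
  obtain B :: "'e set" where B: "parseval_frame B" using frame_exists by blast
  let ?W = "snd d ` (fst d \<inter> V)"
  have V: "snd c ` V = snd c ` (fst c \<inter> V)" using assms(3) by (simp add: Int_absorb1)
  have "Ck_on n ?W (\<lambda>y. f (chart_inv c (snd c (chart_inv d y))))"
  proof (rule Ck_on_compose[OF B open_chart_image[OF d assms(2)] _ _ _ assms(4)])
    show "open (snd c ` V)" unfolding V by (rule open_chart_image[OF assms(1,2)])
    show "(\<lambda>y. snd c (chart_inv d y)) ` ?W \<subseteq> snd c ` V"
      using chart_image_cases[OF d] by blast
    have "Ck_on n (snd d ` (fst d \<inter> fst c)) (\<lambda>y. snd c (chart_inv d y))"
      by (rule smooth_onD[OF transition_smooth[OF d assms(1)]])
    then show "Ck_on n ?W (\<lambda>y. snd c (chart_inv d y))"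
      by (rule Ck_on_subset) (use assms(3) in auto)
  qed
  then show "Ck_on n ?W (\<lambda>y. f (chart_inv d y))"
  proof (rule Ck_on_cong_imp[OF open_chart_image[OF d assms(2)], rotated])
    fix y assume "y \<in> ?W"
    then have "chart_inv d y \<in> fst c" using chart_image_cases[OF d] assms(3) by blast
    then show "f (chart_inv c (snd c (chart_inv d y))) = f (chart_inv d y)"
      by (simp add: chart_inv_chart[OF assms(1)])
  qed
qed

text \<open>
  Charts are homeomorphisms, so continuity is the same on the manifold and in coordinates.
\<close>

lemma Ck_map_0_iff:
  assumes "open V"
  shows "Ck_map 0 V f \<longleftrightarrow> continuous_on V f"
proof
  assume f: "Ck_map 0 V f"
  show "continuous_on V f"
  proof (rule continuous_at_imp_continuous_on, rule ballI)
    fix \<xi> assume \<xi>: "\<xi> \<in> V"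
    obtain c where c: "c \<in> \<A>" "\<xi> \<in> fst c" by (rule chart_at)
    have "continuous_on (fst c \<inter> V) (\<lambda>\<mu>. f (chart_inv c (snd c \<mu>)))"
      using f c(1) unfolding Ck_map_def Ck_on.simps
      by (intro continuous_on_compose2[of _ "\<lambda>y. f (chart_inv c y)" _ "snd c"]
          continuous_on_subset[OF continuous_on_chart[OF c(1)]]) auto
    then have "continuous_on (fst c \<inter> V) f"
      by (rule continuous_on_eq) (auto simp: chart_inv_chart[OF c(1)])
    then show "isCont f \<xi>"
      using c \<xi> continuous_on_eq_continuous_at[OF open_Int[OF open_chart[OF c(1)] assms]] by blast
  qed
next
  assume f: "continuous_on V f"
  show "Ck_map 0 V f"
    unfolding Ck_map_def Ck_on.simps
  proof
    fix c assume c: "c \<in> \<A>"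
    show "continuous_on (snd c ` (fst c \<inter> V)) (\<lambda>y. f (chart_inv c y))"
      using chart_image_cases[OF c]
      by (intro continuous_on_compose2[OF f] continuous_on_subset[OF continuous_on_chart_inv[OF c]]) auto
  qed
qed

lemma Ck_map_imp_continuous_on: "Ck_map n V f \<Longrightarrow> open V \<Longrightarrow> continuous_on V f"
  using Ck_on_imp_continuous_on Ck_map_0_iff[of V f] unfolding Ck_map_def Ck_on.simps by blast

lemma Ck_map_bounded_linear:
  assumes "bounded_linear L" and "open V" and "Ck_map n V f"
  shows "Ck_map n V (\<lambda>\<xi>. L (f \<xi>))"
  using assms(3) Ck_on_bounded_linear_compose[OF assms(1) open_chart_image[OF _ assms(2)]]
  unfolding Ck_map_def by blast

lemma Ck_map_add: "open V \<Longrightarrow> Ck_map n V f \<Longrightarrow> Ck_map n V g \<Longrightarrow> Ck_map n V (\<lambda>\<xi>. f \<xi> + g \<xi>)"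
  using Ck_on_add[OF open_chart_image] unfolding Ck_map_def by blast

lemma Ck_map_diff: "open V \<Longrightarrow> Ck_map n V f \<Longrightarrow> Ck_map n V g \<Longrightarrow> Ck_map n V (\<lambda>\<xi>. f \<xi> - g \<xi>)"
  using Ck_on_diff[OF open_chart_image] unfolding Ck_map_def by blast

lemma smooth_map_const: "smooth_map \<A> V (\<lambda>_. a)"
  by (simp add: smooth_map_iff Ck_map_def Ck_on_const)


subsection \<open>Derivatives along vector fields\<close>

definition differentiable_at :: "('m \<Rightarrow> 'f::real_normed_vector) \<Rightarrow> 'm \<Rightarrow> bool" where
  "differentiable_at f \<xi> \<longleftrightarrow>
     (\<exists>c\<in>\<A>. \<xi> \<in> fst c \<and> (\<lambda>y. f (chart_inv c y)) differentiable (at (snd c \<xi>)))"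

lemma chart_deriv_chain:
  assumes "c \<in> \<A>" and "d \<in> \<A>" and "\<xi> \<in> fst c" and "\<xi> \<in> fst d"
    and "((\<lambda>y. f (chart_inv d y)) has_derivative L) (at (snd d \<xi>))"
  shows "((\<lambda>y. f (chart_inv c y)) has_derivative (\<lambda>v. L (chart_deriv c (snd d) \<xi> v))) (at (snd c \<xi>))"
proof -
  have eq: "snd d (chart_inv c (snd c \<xi>)) = snd d \<xi>" by (simp add: chart_inv_chart assms)
  have "((\<lambda>y. f (chart_inv d (snd d (chart_inv c y)))) has_derivative
      (\<lambda>v. L (chart_deriv c (snd d) \<xi> v))) (at (snd c \<xi>))"
    by (rule has_derivative_compose[OF transition_has_derivative[OF assms(1-4)]])
      (simp add: eq assms(5))
  then show ?thesis
  proof (rule has_derivative_transform_within_open[OF _ open_chart_image[OF assms(1) open_chart[OF assms(2)]]])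
    fix y assume "y \<in> snd c ` (fst c \<inter> fst d)"
    then show "f (chart_inv d (snd d (chart_inv c y))) = f (chart_inv c y)"
      using chart_image_cases[OF assms(1)] by (simp add: chart_inv_chart[OF assms(2)])
  qed (use assms in auto)
qed

lemma differentiable_at_has_derivative:
  assumes "differentiable_at f \<xi>" and "c \<in> \<A>" and "\<xi> \<in> fst c"
  shows "((\<lambda>y. f (chart_inv c y)) has_derivative chart_deriv c f \<xi>) (at (snd c \<xi>))"
proof -
  obtain d L where "d \<in> \<A>" "\<xi> \<in> fst d" "((\<lambda>y. f (chart_inv d y)) has_derivative L) (at (snd d \<xi>))"
    using assms(1) unfolding differentiable_at_def differentiable_def by blast
  from chart_deriv_chain[OF assms(2) this(1) assms(3) this(2,3)]
  have "(\<lambda>y. f (chart_inv c y)) differentiable (at (snd c \<xi>))" by (auto simp: differentiable_def)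
  then show ?thesis by (simp add: chart_deriv_def comp_def frechet_derivative_works)
qed

lemma differentiable_atI:
  "c \<in> \<A> \<Longrightarrow> \<xi> \<in> fst c \<Longrightarrow> ((\<lambda>y. f (chart_inv c y)) has_derivative L) (at (snd c \<xi>)) \<Longrightarrow>
    differentiable_at f \<xi>"
  unfolding differentiable_at_def differentiable_def by blast

lemma chart_deriv_eqI:
  "((\<lambda>y. f (chart_inv c y)) has_derivative L) (at (snd c \<xi>)) \<Longrightarrow> chart_deriv c f \<xi> = L"
  by (simp add: chart_deriv_def comp_def frechet_derivative_eqI)

lemma differentiable_at_bounded_linear:
  assumes "bounded_linear L" and "differentiable_at f \<xi>"
  shows "differentiable_at (\<lambda>\<mu>. L (f \<mu>)) \<xi>"
    and "c \<in> \<A> \<Longrightarrow> \<xi> \<in> fst c \<Longrightarrow> chart_deriv c (\<lambda>\<mu>. L (f \<mu>)) \<xi> v = L (chart_deriv c f \<xi> v)"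
proof -
  have *: "((\<lambda>y. L (f (chart_inv c y))) has_derivative (\<lambda>v. L (chart_deriv c f \<xi> v))) (at (snd c \<xi>))"
    if "c \<in> \<A>" "\<xi> \<in> fst c" for c
    by (rule bounded_linear.has_derivative[OF assms(1) differentiable_at_has_derivative[OF assms(2) that]])
  obtain d where "d \<in> \<A>" "\<xi> \<in> fst d" by (rule chart_at)
  then show "differentiable_at (\<lambda>\<mu>. L (f \<mu>)) \<xi>" using * by (blast intro: differentiable_atI)
  show "chart_deriv c (\<lambda>\<mu>. L (f \<mu>)) \<xi> v = L (chart_deriv c f \<xi> v)" if "c \<in> \<A>" "\<xi> \<in> fst c"
    using chart_deriv_eqI[OF *[OF that]] by simp
qed

lemma Ck_map_differentiable_at:
  assumes "Ck_map (Suc n) V f" and "\<xi> \<in> V"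
  shows "differentiable_at f \<xi>"
proof -
  obtain c where c: "c \<in> \<A>" "\<xi> \<in> fst c" by (rule chart_at)
  then have "Ck_on (Suc n) (snd c ` (fst c \<inter> V)) (\<lambda>y. f (chart_inv c y))"
    using assms(1) by (simp add: Ck_map_def)
  from Ck_on_SucD(1)[OF this] show ?thesis using c assms(2) by (auto intro: differentiable_atI)
qed

lemma vectD:
  assumes "X \<in> vect \<A> V"
  shows "\<not> (c \<in> \<A> \<and> \<xi> \<in> fst c \<inter> V) \<Longrightarrow> X \<xi> c = 0"
    and "c \<in> \<A> \<Longrightarrow> d \<in> \<A> \<Longrightarrow> \<xi> \<in> fst c \<Longrightarrow> \<xi> \<in> fst d \<Longrightarrow> \<xi> \<in> V \<Longrightarrow>
      X \<xi> d = map_prod (chart_deriv c (snd d) \<xi>) (chart_deriv c (snd d) \<xi>) (X \<xi> c)"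
    and "c \<in> \<A> \<Longrightarrow> smooth_on (snd c ` (fst c \<inter> V)) (\<lambda>y. X (chart_inv c y) c)"
  using assms unfolding vect_def by blast+

text \<open>
  The chain rule cancels the transformation law for the components of \<open>X\<close>, so any chart may be used
  in place of the chosen one.
\<close>

lemma vf_apply_chart:
  fixes f :: "'m \<Rightarrow> 'f::complex_hilbert"
  assumes "X \<in> vect \<A> V" and "\<xi> \<in> V" and "differentiable_at f \<xi>" and "c \<in> \<A>" and "\<xi> \<in> fst c"
  shows "vf_apply \<A> X f \<xi> =
    chart_deriv c f \<xi> (fst (X \<xi> c)) + \<i> *\<^sub>C chart_deriv c f \<xi> (snd (X \<xi> c))"
proof -
  define d where "d = (SOME c. c \<in> \<A> \<and> \<xi> \<in> fst c)"
  have d: "d \<in> \<A>" "\<xi> \<in> fst d"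
    using someI[of "\<lambda>c. c \<in> \<A> \<and> \<xi> \<in> fst c" c] assms(4,5) by (auto simp: d_def)
  have "chart_deriv c f \<xi> = (\<lambda>v. chart_deriv d f \<xi> (chart_deriv c (snd d) \<xi> v))"
    by (rule chart_deriv_eqI[OF chart_deriv_chain[OF assms(4) d(1) assms(5) d(2)
          differentiable_at_has_derivative[OF assms(3) d]]])
  moreover have "X \<xi> d = map_prod (chart_deriv c (snd d) \<xi>) (chart_deriv c (snd d) \<xi>) (X \<xi> c)"
    by (rule vectD(2)[OF assms(1,4) d(1) assms(5) d(2) assms(2)])
  ultimately show ?thesis by (simp add: vf_apply_def d_def[symmetric] Let_def)
qed

lemma vf_apply_cong: "X \<xi> = Y \<xi> \<Longrightarrow> vf_apply \<A> X f \<xi> = vf_apply \<A> Y f \<xi>"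
  by (simp add: vf_apply_def)

lemma vf_apply_cinner:
  fixes f :: "'m \<Rightarrow> 'k::complex_hilbert"
  assumes "X \<in> vect \<A> V" and "\<xi> \<in> V" and "differentiable_at f \<xi>"
  shows "vf_apply \<A> X (\<lambda>\<mu>. cinner (f \<mu>) x) \<xi> = cinner (vf_apply \<A> X f \<xi>) x"
proof -
  obtain c where c: "c \<in> \<A>" "\<xi> \<in> fst c" by (rule chart_at)
  note d = differentiable_at_bounded_linear[OF bounded_linear_cinner_left assms(3)]
  show ?thesis
    unfolding vf_apply_chart[OF assms c] vf_apply_chart[OF assms(1,2) d(1) c] d(2)[OF c]
    by (simp add: cinner_add_left cinner_scaleC_left scaleC_complex_def)
qed

lemma Ck_map_vf_apply:
  fixes f :: "'m \<Rightarrow> 'f::complex_hilbert"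
  assumes "open V" and "X \<in> vect \<A> V" and f: "Ck_map (Suc n) V f"
  shows "Ck_map n V (vf_apply \<A> X f)"
  unfolding Ck_map_def
proof
  fix c assume c: "c \<in> \<A>"
  let ?W = "snd c ` (fst c \<inter> V)" and ?F = "\<lambda>y. f (chart_inv c y)"
  obtain B :: "'e set" where B: "parseval_frame B" using frame_exists by blast
  have W: "open ?W" by (rule open_chart_image[OF c assms(1)])
  have F: "Ck_on (Suc n) ?W ?F" using f c by (simp add: Ck_map_def)
  have DF: "Ck_on n ?W (\<lambda>y. frechet_derivative ?F (at y) (u y))" if "Ck_on n ?W u" for u
    by (rule Ck_on_derivative_apply[OF B W _ Ck_on_SucD(2)[OF F] that])
      (rule has_derivative_linear[OF Ck_on_SucD(1)[OF F]])
  have X: "Ck_on n ?W (\<lambda>y. X (chart_inv c y) c)" by (rule smooth_onD[OF vectD(3)[OF assms(2) c]])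
  have "Ck_on n ?W (\<lambda>y. frechet_derivative ?F (at y) (fst (X (chart_inv c y) c)) +
      \<i> *\<^sub>C frechet_derivative ?F (at y) (snd (X (chart_inv c y) c)))"
    by (intro Ck_on_add[OF W] Ck_on_bounded_linear_compose[OF bounded_linear_scaleC W] DF
        Ck_on_bounded_linear_compose[OF bounded_linear_fst W X]
        Ck_on_bounded_linear_compose[OF bounded_linear_snd W X])
  then show "Ck_on n ?W (\<lambda>y. vf_apply \<A> X f (chart_inv c y))"
  proof (rule Ck_on_cong_imp[OF W, rotated])
    fix y assume y: "y \<in> ?W"
    note i = chart_image_cases[OF c y]
    show "frechet_derivative ?F (at y) (fst (X (chart_inv c y) c)) +
      \<i> *\<^sub>C frechet_derivative ?F (at y) (snd (X (chart_inv c y) c)) = vf_apply \<A> X f (chart_inv c y)"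
      unfolding vf_apply_chart[OF assms(2) i(2) Ck_map_differentiable_at[OF f i(2)] c i(1)]
      by (simp add: chart_deriv_def comp_def i(3))
  qed
qed

lemma smooth_map_vf_apply:
  fixes f :: "'m \<Rightarrow> 'f::complex_hilbert"
  shows "open V \<Longrightarrow> X \<in> vect \<A> V \<Longrightarrow> smooth_map \<A> V f \<Longrightarrow> smooth_map \<A> V (vf_apply \<A> X f)"
  using Ck_map_vf_apply unfolding smooth_map_iff by blast

text \<open>
  Difference quotients lie in \<open>K\<close>, and \<open>K\<close> is closed.
\<close>

lemma closed_csubspace_vf_apply:
  fixes f :: "'m \<Rightarrow> 'k::complex_hilbert"
  assumes "closed_csubspace K" and "open V" and "X \<in> vect \<A> V" and "\<xi> \<in> V"
    and "differentiable_at f \<xi>" and fK: "f ` V \<subseteq> K"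
  shows "vf_apply \<A> X f \<xi> \<in> K"
proof -
  obtain c where c: "c \<in> \<A>" "\<xi> \<in> fst c" by (rule chart_at)
  have "chart_deriv c f \<xi> v \<in> K" for v
  proof -
    have d: "((\<lambda>y. f (chart_inv c y)) has_derivative chart_deriv c f \<xi>) (at (snd c \<xi>))"
      by (rule differentiable_at_has_derivative[OF assms(5) c])
    have "((\<lambda>t. snd c \<xi> + t *\<^sub>R v) has_derivative (\<lambda>t. t *\<^sub>R v)) (at 0)"
      by (auto intro!: derivative_eq_intros)
    from has_derivative_compose[OF this, of "\<lambda>y. f (chart_inv c y)" "chart_deriv c f \<xi>"] d
    have "((\<lambda>t. f (chart_inv c (snd c \<xi> + t *\<^sub>R v))) has_derivative (\<lambda>t. t *\<^sub>R chart_deriv c f \<xi> v)) (at 0)"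
      by (simp add: linear_scale[OF has_derivative_linear[OF d]])
    then have lim0: "((\<lambda>t. norm (f (chart_inv c (snd c \<xi> + t *\<^sub>R v)) - f \<xi> - t *\<^sub>R chart_deriv c f \<xi> v) / norm t) \<longlongrightarrow> 0) (at 0)"
      by (simp add: has_derivative_at chart_inv_chart[OF c])
    have quot: "norm (u - t *\<^sub>R w) / norm t = norm ((1 / t) *\<^sub>R u - w)" if "t \<noteq> 0" for u w :: 'k and t
    proof -
      have "(1 / t) *\<^sub>R u - w = (1 / t) *\<^sub>R (u - t *\<^sub>R w)" using that by (simp add: scaleR_diff_right)
      then show ?thesis by (simp add: divide_inverse_commute)
    qed
    have "((\<lambda>t. norm ((1 / t) *\<^sub>R (f (chart_inv c (snd c \<xi> + t *\<^sub>R v)) - f \<xi>) - chart_deriv c f \<xi> v)) \<longlongrightarrow> 0) (at 0)"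
      by (rule Lim_transform_eventually[OF lim0]) (use quot in \<open>simp add: eventually_at_filter always_eventually\<close>)
    then have lim: "((\<lambda>t. (1 / t) *\<^sub>R (f (chart_inv c (snd c \<xi> + t *\<^sub>R v)) - f \<xi>)) \<longlongrightarrow>
        chart_deriv c f \<xi> v) (at 0)"
      by (simp add: tendsto_norm_zero_iff Lim_null[symmetric])
    have W: "open (snd c ` (fst c \<inter> V))" by (rule open_chart_image[OF c(1) assms(2)])
    have "((\<lambda>t. snd c \<xi> + t *\<^sub>R v) \<longlongrightarrow> snd c \<xi> + 0 *\<^sub>R v) (at 0)" by (intro tendsto_intros)
    then have "\<forall>\<^sub>F t in at 0. snd c \<xi> + t *\<^sub>R v \<in> snd c ` (fst c \<inter> V)"
      by (rule topological_tendstoD[OF _ W]) (use c assms(4) in auto)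
    then have "\<forall>\<^sub>F t in at 0. (1 / t) *\<^sub>R (f (chart_inv c (snd c \<xi> + t *\<^sub>R v)) - f \<xi>) \<in> K"
    proof (rule eventually_mono)
      fix t assume "snd c \<xi> + t *\<^sub>R v \<in> snd c ` (fst c \<inter> V)"
      then have "f (chart_inv c (snd c \<xi> + t *\<^sub>R v)) \<in> K" using chart_image_cases(2)[OF c(1)] fK by blast
      then show "(1 / t) *\<^sub>R (f (chart_inv c (snd c \<xi> + t *\<^sub>R v)) - f \<xi>) \<in> K"
        using fK assms(1,4) by (intro closed_csubspace_scaleR closed_csubspace_diff) auto
    qed
    then show ?thesis
      using Lim_in_closed_set[OF _ _ _ lim] assms(1) by (simp add: closed_csubspace_def)
  qed
  then show ?thesis
    unfolding vf_apply_chart[OF assms(3,4,5) c]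
    using assms(1) by (intro closed_csubspace_add closed_csubspace_scaleC)
qed


subsection \<open>Localisation of vector fields\<close>

text \<open>
  A bump function of the model space is transported by a chart and extended by zero. Its support is
  compact, hence closed in the Hausdorff space \<open>'m\<close>, which makes the extension smooth.
\<close>

lemma bump_exists:
  assumes "open V" and "\<xi> \<in> V"
  obtains \<rho> :: "'m \<Rightarrow> real" and V1 Q where "smooth_map \<A> UNIV \<rho>"
    "open V1" "\<xi> \<in> V1" "V1 \<subseteq> V" "\<And>\<mu>. \<mu> \<in> V1 \<Longrightarrow> \<rho> \<mu> = 1"
    "closed Q" "Q \<subseteq> V" "\<And>\<mu>. \<mu> \<notin> Q \<Longrightarrow> \<rho> \<mu> = 0"
proof -
  obtain c where c: "c \<in> \<A>" "\<xi> \<in> fst c" by (rule chart_at)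
  obtain B :: "'e set" where B: "parseval_frame B" using frame_exists by blast
  let ?W = "snd c ` (fst c \<inter> V)"
  have W: "open ?W" by (rule open_chart_image[OF c(1) assms(1)])
  have "snd c \<xi> \<in> ?W" using c assms(2) by blast
  from smooth_bump_exists[OF B W this] obtain \<beta> :: "'e \<Rightarrow> real" and N L where
    \<beta>: "smooth_on UNIV \<beta>" and N: "open N" "snd c \<xi> \<in> N" "\<And>y. y \<in> N \<Longrightarrow> \<beta> y = 1"
    and L: "compact L" "L \<subseteq> ?W" "\<And>y. y \<notin> L \<Longrightarrow> \<beta> y = 0" by metis
  define \<rho> where "\<rho> \<mu> = (if \<mu> \<in> fst c then \<beta> (snd c \<mu>) else 0)" for \<mu>
  define Q where "Q = chart_inv c ` L"
  have "compact Q"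
    unfolding Q_def using L(1,2)
    by (intro compact_continuous_image continuous_on_subset[OF continuous_on_chart_inv[OF c(1)]]) auto
  then have Q: "closed Q" by (rule compact_imp_closed)
  have QV: "Q \<subseteq> fst c \<inter> V" using L(2) chart_image_cases[OF c(1)] by (auto simp: Q_def)
  have \<rho>0: "\<rho> \<mu> = 0" if "\<mu> \<notin> Q" for \<mu>
  proof (cases "\<mu> \<in> fst c")
    case True
    then have "snd c \<mu> \<notin> L" using that chart_inv_chart[OF c(1) True] by (force simp: Q_def)
    then show ?thesis using L(3) by (simp add: \<rho>_def)
  qed (simp add: \<rho>_def)
  have "Ck_map n UNIV \<rho>" for n
  proof (rule Ck_map_local)
    fix \<mu> :: 'm
    show "\<exists>V'. open V' \<and> \<mu> \<in> V' \<and> Ck_map n V' \<rho>"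
    proof (cases "\<mu> \<in> Q")
      case True
      have "Ck_on n (snd c ` fst c) (\<lambda>y. \<rho> (chart_inv c y))"
      proof (rule Ck_on_cong_imp[of _ \<beta>])
        show "open (snd c ` fst c)" using open_chart_image[OF c(1) open_UNIV] by simp
        show "\<beta> y = \<rho> (chart_inv c y)" if "y \<in> snd c ` fst c" for y
          using that chart_inv_chart[OF c(1)] by (auto simp: \<rho>_def)
        show "Ck_on n (snd c ` fst c) \<beta>" by (rule Ck_on_subset[OF smooth_onD[OF \<beta>]]) simp
      qed
      then have "Ck_map n (fst c) \<rho>" by (intro Ck_map_chartI[OF c(1)] open_chart c) auto
      then show ?thesis using True QV open_chart[OF c(1)] by blast
    next
      case False
      have "Ck_map n (- Q) (\<lambda>_. 0::real)" using smooth_map_const smooth_map_iff by blast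
      then have "Ck_map n (- Q) \<rho>"
        using Q \<rho>0 by (intro Ck_map_cong[of "- Q" "\<lambda>_. 0" \<rho>]) auto
      then show ?thesis using Q False by blast
    qed
  qed
  then have "smooth_map \<A> UNIV \<rho>" by (simp add: smooth_map_iff)
  moreover have "open (fst c \<inter> snd c -` (N \<inter> ?W))"
    using open_chart_vimage[OF c(1)] N(1) W by blast
  moreover have "fst c \<inter> snd c -` (N \<inter> ?W) \<subseteq> V"
    using chart_inv_chart[OF c(1)] chart_image_cases(2)[OF c(1)] by fastforce
  ultimately show thesis
    using c N assms(2) Q QV \<rho>0
    by (intro that[of \<rho> "fst c \<inter> snd c -` (N \<inter> ?W)" Q]) (auto simp: \<rho>_def)
qed

lemma vect_cutoff:
  assumes "open V" and X: "X \<in> vect \<A> V" and \<rho>: "smooth_map \<A> UNIV (\<rho> :: 'm \<Rightarrow> real)"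
    and "closed Q" and "Q \<subseteq> V" and "\<And>\<mu>. \<mu> \<notin> Q \<Longrightarrow> \<rho> \<mu> = 0"
  shows "(\<lambda>\<mu> c. \<rho> \<mu> *\<^sub>R X \<mu> c) \<in> vect \<A> UNIV"
  unfolding vect_def
proof (intro CollectI conjI allI impI ballI)
  fix \<mu> :: 'm and c :: "('m, 'e) chart"
  assume "\<not> (c \<in> \<A> \<and> \<mu> \<in> fst c \<inter> UNIV)"
  then have "X \<mu> c = 0" by (intro vectD(1)[OF X]) auto
  then show "\<rho> \<mu> *\<^sub>R X \<mu> c = 0" by simp
next
  fix c d \<mu> assume cd: "c \<in> \<A>" "d \<in> \<A>" "\<mu> \<in> fst c \<inter> fst d \<inter> UNIV"
  let ?D = "chart_deriv c (snd d) \<mu>"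
  have lin: "linear ?D"
    using has_derivative_linear[OF transition_has_derivative[OF cd(1,2)]] cd(3) by auto
  show "\<rho> \<mu> *\<^sub>R X \<mu> d = map_prod ?D ?D (\<rho> \<mu> *\<^sub>R X \<mu> c)"
  proof (cases "\<mu> \<in> V")
    case True
    then show ?thesis
      using vectD(2)[OF X cd(1,2)] cd(3)
      by (cases "X \<mu> c") (auto simp: linear_scale[OF lin])
  next
    case False
    then show ?thesis
      using vectD(1)[OF X, of _ \<mu>] linear_0[OF lin] by (simp add: zero_prod_def)
  qed
next
  fix c assume c: "c \<in> \<A>"
  show "smooth_on (snd c ` (fst c \<inter> UNIV)) (\<lambda>y. \<rho> (chart_inv c y) *\<^sub>R X (chart_inv c y) c)"
    unfolding smooth_on_def
  proof (intro allI Ck_on_local)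
    fix n y assume y: "y \<in> snd c ` (fst c \<inter> UNIV)"
    show "\<exists>W. open W \<and> y \<in> W \<and> Ck_on n W (\<lambda>y. \<rho> (chart_inv c y) *\<^sub>R X (chart_inv c y) c)"
    proof (cases "chart_inv c y \<in> Q")
      case True
      let ?W = "snd c ` (fst c \<inter> V)"
      have W: "open ?W" by (rule open_chart_image[OF c assms(1)])
      have "Ck_on n ?W (\<lambda>y. \<rho> (chart_inv c y))"
        using Ck_map_subset[of n UNIV \<rho> V] \<rho> c by (simp add: smooth_map_iff Ck_map_def)
      then have "Ck_on n ?W (\<lambda>y. \<rho> (chart_inv c y) *\<^sub>R X (chart_inv c y) c)"
        using vectD(3)[OF X c] by (intro Ck_on_scaleR W) (auto simp: smooth_on_def)
      moreover have "y \<in> ?W"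
        using chart_image_cases[OF c y] True assms(5) by (intro image_eqI[of _ _ "chart_inv c y"]) auto
      ultimately show ?thesis using W by blast
    next
      case False
      let ?W = "snd c ` (fst c \<inter> - Q)"
      have W: "open ?W" using assms(4) by (intro open_chart_image[OF c]) auto
      have "Ck_on n ?W (\<lambda>y. \<rho> (chart_inv c y) *\<^sub>R X (chart_inv c y) c)"
      proof (rule Ck_on_cong_imp[OF W _ Ck_on_const[of _ _ 0]])
        show "0 = \<rho> (chart_inv c y) *\<^sub>R X (chart_inv c y) c" if "y \<in> ?W" for y
          using chart_image_cases(2)[OF c that] assms(6) by simp
      qed
      moreover have "y \<in> ?W"
        using chart_image_cases[OF c y] False by (intro image_eqI[of _ _ "chart_inv c y"]) auto
      ultimately show ?thesis using W by blast
    qed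
  qed
qed

text \<open>
  A vector field on \<open>V\<close> need not extend to the manifold, but it does after multiplication by a function
  with support in \<open>V\<close> that equals 1 near \<open>\<xi>\<close>.
\<close>

lemma vect_extend:
  assumes "open V" and "X \<in> vect \<A> V" and "\<xi> \<in> V"
  obtains \<rho> :: "'m \<Rightarrow> real" and V1 where "(\<lambda>\<mu> c. \<rho> \<mu> *\<^sub>R X \<mu> c) \<in> vect \<A> UNIV"
    "open V1" "\<xi> \<in> V1" "V1 \<subseteq> V" "\<And>\<mu>. \<mu> \<in> V1 \<Longrightarrow> \<rho> \<mu> = 1"
proof -
  obtain \<rho> :: "'m \<Rightarrow> real" and V1 Q where b: "smooth_map \<A> UNIV \<rho>"
    "open V1" "\<xi> \<in> V1" "V1 \<subseteq> V" "\<And>\<mu>. \<mu> \<in> V1 \<Longrightarrow> \<rho> \<mu> = 1"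
    "closed Q" "Q \<subseteq> V" "\<And>\<mu>. \<mu> \<notin> Q \<Longrightarrow> \<rho> \<mu> = 0"
    using bump_exists[OF assms(1,3)] by blast
  show thesis by (rule that[OF vect_cutoff[OF assms(1,2) b(1,6,7,8)] b(2-5)])
qed

lemma vect_restrict:
  assumes "open V" and X: "X \<in> vect \<A> UNIV"
  shows "(\<lambda>\<mu> c. if \<mu> \<in> V then X \<mu> c else 0) \<in> vect \<A> V"
  unfolding vect_def
proof (intro CollectI conjI allI impI ballI)
  fix \<mu> :: 'm and c :: "('m, 'e) chart"
  assume "\<not> (c \<in> \<A> \<and> \<mu> \<in> fst c \<inter> V)"
  then show "(if \<mu> \<in> V then X \<mu> c else 0) = 0" using vectD(1)[OF X, of c \<mu>] by auto
next
  fix c d \<mu> assume cd: "c \<in> \<A>" "d \<in> \<A>" "\<mu> \<in> fst c \<inter> fst d \<inter> V"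
  then show "(if \<mu> \<in> V then X \<mu> d else 0) =
      map_prod (chart_deriv c (snd d) \<mu>) (chart_deriv c (snd d) \<mu>) (if \<mu> \<in> V then X \<mu> c else 0)"
    using vectD(2)[OF X cd(1,2)] by auto
next
  fix c assume c: "c \<in> \<A>"
  have W: "open (snd c ` (fst c \<inter> V))" by (rule open_chart_image[OF c assms(1)])
  have "Ck_on n (snd c ` (fst c \<inter> V)) (\<lambda>y. if chart_inv c y \<in> V then X (chart_inv c y) c else 0)" for n
  proof (rule Ck_on_cong_imp[OF W])
    show "Ck_on n (snd c ` (fst c \<inter> V)) (\<lambda>y. X (chart_inv c y) c)"
      by (rule Ck_on_subset[OF smooth_onD[OF vectD(3)[OF X c]]]) auto
    show "X (chart_inv c y) c = (if chart_inv c y \<in> V then X (chart_inv c y) c else 0)"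
      if "y \<in> snd c ` (fst c \<inter> V)" for y
      using chart_image_cases(2)[OF c that] by simp
  qed
  then show "smooth_on (snd c ` (fst c \<inter> V)) (\<lambda>y. if chart_inv c y \<in> V then X (chart_inv c y) c else 0)"
    by (simp add: smooth_on_def)
qed

lemma vect_cnj:
  assumes "open V" and X: "X \<in> vect \<A> V"
  shows "vf_cnj X \<in> vect \<A> V"
  unfolding vect_def
proof (intro CollectI conjI allI impI ballI)
  fix \<mu> :: 'm and c :: "('m, 'e) chart"
  assume "\<not> (c \<in> \<A> \<and> \<mu> \<in> fst c \<inter> V)"
  then show "vf_cnj X \<mu> c = 0" using vectD(1)[OF X, of c \<mu>] by (simp add: vf_cnj_def zero_prod_def)
next
  fix c d \<mu> assume cd: "c \<in> \<A>" "d \<in> \<A>" "\<mu> \<in> fst c \<inter> fst d \<inter> V"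
  then have "linear (chart_deriv c (snd d) \<mu>)"
    using has_derivative_linear[OF transition_has_derivative[OF cd(1,2)]] by auto
  then show "vf_cnj X \<mu> d = map_prod (chart_deriv c (snd d) \<mu>) (chart_deriv c (snd d) \<mu>) (vf_cnj X \<mu> c)"
    using vectD(2)[OF X cd(1,2), of \<mu>] cd(3)
    by (cases "X \<mu> c") (auto simp: vf_cnj_def linear_neg)
next
  fix c assume c: "c \<in> \<A>"
  have W: "open (snd c ` (fst c \<inter> V))" by (rule open_chart_image[OF c assms(1)])
  have bl: "bounded_linear (\<lambda>p::'e \<times> 'e. (fst p, - snd p))"
    by (intro bounded_linear_Pair bounded_linear_fst bounded_linear_minus bounded_linear_snd)
  have eq: "vf_cnj X \<mu> c = (fst (X \<mu> c), - snd (X \<mu> c))" for \<mu>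
    by (cases "X \<mu> c") (simp add: vf_cnj_def)
  show "smooth_on (snd c ` (fst c \<inter> V)) (\<lambda>y. vf_cnj X (chart_inv c y) c)"
    unfolding smooth_on_def eq
    by (intro allI Ck_on_bounded_linear_compose[OF bl W] smooth_onD vectD(3)[OF X c])
qed

text \<open>
  The coordinate field \<open>\<partial>\<^sub>v\<close>. It is real and thus equal to its conjugate.
\<close>

lemma coordinate_field_exists:
  fixes v :: 'e
  assumes c: "c \<in> \<A>"
  obtains X where "X \<in> vect \<A> (fst c)" "\<And>\<mu>. \<mu> \<in> fst c \<Longrightarrow> X \<mu> c = (v, 0)" "vf_cnj X = X"
proof
  define X :: "('m, 'e) vfield" where
    "X = (\<lambda>\<mu> d. if d \<in> \<A> \<and> \<mu> \<in> fst c \<inter> fst d then (chart_deriv c (snd d) \<mu> v, 0) else 0)"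
  show "vf_cnj X = X" by (intro ext) (auto simp: vf_cnj_def X_def zero_prod_def)
  show "X \<mu> c = (v, 0)" if "\<mu> \<in> fst c" for \<mu>
  proof -
    have "((\<lambda>y. snd c (chart_inv c y)) has_derivative (\<lambda>v. v)) (at (snd c \<mu>))"
      by (rule has_derivative_transform_within_open[OF has_derivative_ident
            open_chart_image[OF c open_UNIV]])
        (use that in \<open>auto simp: chart_inv_chart[OF c]\<close>)
    then have "chart_deriv c (snd c) \<mu> = (\<lambda>v. v)" by (rule chart_deriv_eqI)
    then show ?thesis using that c by (simp add: X_def)
  qed
  show "X \<in> vect \<A> (fst c)"
    unfolding vect_def
  proof (intro CollectI conjI allI impI ballI)
    fix \<mu> :: 'm and d :: "('m, 'e) chart"
    assume "\<not> (d \<in> \<A> \<and> \<mu> \<in> fst d \<inter> fst c)"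
    then show "X \<mu> d = 0" by (auto simp: X_def)
  next
    fix d e \<mu> assume de: "d \<in> \<A>" "e \<in> \<A>" "\<mu> \<in> fst d \<inter> fst e \<inter> fst c"
    have "((\<lambda>y. snd e (chart_inv c y)) has_derivative
        (\<lambda>v. chart_deriv d (snd e) \<mu> (chart_deriv c (snd d) \<mu> v))) (at (snd c \<mu>))"
      by (rule chart_deriv_chain[OF c de(1)]) (use de transition_has_derivative[OF de(1,2)] in auto)
    then have "chart_deriv c (snd e) \<mu> v = chart_deriv d (snd e) \<mu> (chart_deriv c (snd d) \<mu> v)"
      by (simp add: chart_deriv_eqI)
    moreover have "linear (chart_deriv d (snd e) \<mu>)"
      using has_derivative_linear[OF transition_has_derivative[OF de(1,2)]] de(3) by auto
    ultimately show "X \<mu> e = map_prod (chart_deriv d (snd e) \<mu>) (chart_deriv d (snd e) \<mu>) (X \<mu> d)"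
      using de by (simp add: X_def linear_0)
  next
    fix d assume d: "d \<in> \<A>"
    obtain B :: "'e set" where B: "parseval_frame B" using frame_exists by blast
    let ?W = "snd d ` (fst d \<inter> fst c)" and ?\<tau> = "\<lambda>y. snd d (chart_inv c y)"
    have W: "open ?W" by (rule open_chart_image[OF d open_chart[OF c]])
    have bl: "bounded_linear (\<lambda>u::'e. (u, 0::'e))"
      by (intro bounded_linear_Pair bounded_linear_ident bounded_linear_zero)
    have "Ck_on n ?W (\<lambda>y. X (chart_inv d y) d)" for n
    proof (rule Ck_on_cong_imp[OF W])
      have "Ck_on n (snd c ` (fst c \<inter> fst d)) (\<lambda>z. frechet_derivative ?\<tau> (at z) v)"
        by (rule smooth_onD[OF smooth_on_frechet_derivative[OF transition_smooth[OF c d]]])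
      then have "Ck_on n ?W (\<lambda>y. frechet_derivative ?\<tau> (at (snd c (chart_inv d y))) v)"
        by (rule Ck_on_compose[OF B W open_chart_image[OF c open_chart[OF d]] _
              smooth_onD[OF transition_smooth[OF d c]], rotated])
          (use chart_image_cases[OF d] in blast)
      then show "Ck_on n ?W (\<lambda>y. (frechet_derivative ?\<tau> (at (snd c (chart_inv d y))) v, 0::'e))"
        by (rule Ck_on_bounded_linear_compose[OF bl W])
      show "(frechet_derivative ?\<tau> (at (snd c (chart_inv d y))) v, 0) = X (chart_inv d y) d"
        if "y \<in> ?W" for y
        using chart_image_cases[OF d that] d by (simp add: X_def chart_deriv_def comp_def)
    qed
    then show "smooth_on ?W (\<lambda>y. X (chart_inv d y) d)" by (simp add: smooth_on_def)
  qed
qed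

text \<open>
  Hypotheses about all vector fields on \<open>V\<close> become statements about partial derivatives when applied to
  these fields, which live on \<open>V\<close> and not only on the domain of a chart.
\<close>

lemma local_coordinate_field:
  assumes "open V" and "\<xi> \<in> V" and c: "c \<in> \<A>" "\<xi> \<in> fst c"
  obtains X N where "X \<in> vect \<A> V" "open N" "\<xi> \<in> N" "N \<subseteq> V \<inter> fst c"
    "\<And>\<mu>. \<mu> \<in> N \<Longrightarrow> X \<mu> c = (v, 0)" "vf_cnj X = X"
proof -
  obtain Y where Y: "Y \<in> vect \<A> (fst c)" "\<And>\<mu>. \<mu> \<in> fst c \<Longrightarrow> Y \<mu> c = (v, 0)" "vf_cnj Y = Y"
    using coordinate_field_exists[OF c(1), where v = v] by blast
  obtain \<rho> :: "'m \<Rightarrow> real" and N where N: "(\<lambda>\<mu> c. \<rho> \<mu> *\<^sub>R Y \<mu> c) \<in> vect \<A> UNIV"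
    "open N" "\<xi> \<in> N" "N \<subseteq> fst c" "\<And>\<mu>. \<mu> \<in> N \<Longrightarrow> \<rho> \<mu> = 1"
    using vect_extend[OF open_chart[OF c(1)] Y(1) c(2)] by blast
  define X where "X = (\<lambda>\<mu> c. if \<mu> \<in> V then \<rho> \<mu> *\<^sub>R Y \<mu> c else 0)"
  have "X \<in> vect \<A> V" unfolding X_def by (rule vect_restrict[OF assms(1) N(1)])
  moreover have "vf_cnj X = X"
  proof (intro ext)
    fix \<mu> d
    have "map_prod id uminus (Y \<mu> d) = Y \<mu> d" using fun_cong[OF fun_cong[OF Y(3)], of \<mu> d] by (simp add: vf_cnj_def)
    then have "map_prod id uminus (\<rho> \<mu> *\<^sub>R Y \<mu> d) = \<rho> \<mu> *\<^sub>R Y \<mu> d"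
      by (cases "Y \<mu> d") (simp flip: scaleR_minus_right)
    then show "vf_cnj X \<mu> d = X \<mu> d" by (simp add: vf_cnj_def X_def zero_prod_def)
  qed
  moreover have "X \<mu> c = (v, 0)" if "\<mu> \<in> N \<inter> V" for \<mu>
    using that N(4,5) Y(2)[of \<mu>] by (auto simp: X_def)
  moreover have "open (N \<inter> V)" "\<xi> \<in> N \<inter> V" "N \<inter> V \<subseteq> V \<inter> fst c" using N assms by auto
  ultimately show thesis using that by blast
qed


subsection \<open>Regularity from weak derivatives\<close>

text \<open>
  In a chart, the functions \<open>g X\<close> belonging to the coordinate fields of a frame are assembled into a
  linear map \<open>G\<close>. It is the weak derivative of \<open>f\<close> and continuous, hence the derivative.
\<close>

lemma Ck_map_Suc_weak:
  fixes f :: "'m \<Rightarrow> 'k::complex_hilbert"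
  assumes "open V" and K: "closed_csubspace K" and fK: "f ` V \<subseteq> K"
    and gK: "\<And>X. X \<in> vect \<A> V \<Longrightarrow> g X ` V \<subseteq> K"
    and g: "\<And>X. X \<in> vect \<A> V \<Longrightarrow> Ck_map n V (g X)"
    and diff: "\<And>x \<xi>. x \<in> K \<Longrightarrow> \<xi> \<in> V \<Longrightarrow> differentiable_at (\<lambda>\<mu>. cinner (f \<mu>) x) \<xi>"
    and weak: "\<And>X x \<xi>. X \<in> vect \<A> V \<Longrightarrow> x \<in> K \<Longrightarrow> \<xi> \<in> V \<Longrightarrow>
      vf_apply \<A> X (\<lambda>\<mu>. cinner (f \<mu>) x) \<xi> = cinner (g X \<xi>) x"
  shows "Ck_map (Suc n) V f"
proof (rule Ck_map_local)
  fix \<xi> assume \<xi>: "\<xi> \<in> V"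
  obtain c where c: "c \<in> \<A>" "\<xi> \<in> fst c" by (rule chart_at)
  obtain B :: "'e set" where B: "parseval_frame B" using frame_exists by blast
  then have fin: "finite B" by (simp add: parseval_frame_def)
  have "\<forall>b. \<exists>X N. X \<in> vect \<A> V \<and> open N \<and> \<xi> \<in> N \<and> N \<subseteq> V \<inter> fst c \<and> (\<forall>\<mu>\<in>N. X \<mu> c = (b, 0))"
    using local_coordinate_field[OF assms(1) \<xi> c] by metis
  then obtain X N where X: "\<And>b. X b \<in> vect \<A> V" and N: "\<And>b. open (N b)" "\<And>b. \<xi> \<in> N b"
    "\<And>b. N b \<subseteq> V \<inter> fst c" and XN: "\<And>b \<mu>. \<mu> \<in> N b \<Longrightarrow> X b \<mu> c = (b, 0)" by metis
  define M where "M = V \<inter> fst c \<inter> (\<Inter>b\<in>B. N b)"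
  have M: "open M" "\<xi> \<in> M" "M \<subseteq> V" "M \<subseteq> fst c"
    using fin N \<xi> c assms(1) open_chart[OF c(1)] by (auto simp: M_def intro!: open_INT)
  have image: "snd c ` M = snd c ` (fst c \<inter> M)" using M(4) by (simp add: Int_absorb1)
  have W: "open (snd c ` M)" unfolding image by (rule open_chart_image[OF c(1) M(1)])
  have inv: "chart_inv c y \<in> M" "snd c (chart_inv c y) = y" "chart_inv c y \<in> V" "chart_inv c y \<in> fst c"
    if "y \<in> snd c ` M" for y
    using chart_image_cases[OF c(1), of y M] that image M by auto
  define G where "G y v = (\<Sum>b\<in>B. (v \<bullet> b) *\<^sub>R g (X b) (chart_inv c y))" for y v
  have gC: "Ck_on n (snd c ` M) (\<lambda>y. g (X b) (chart_inv c y))" for b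
    using Ck_map_subset[OF g[OF X] M(3)] c(1) by (simp add: Ck_map_def image)
  have GC: "Ck_on n (snd c ` M) (\<lambda>y. G y v)" for v
    unfolding G_def by (intro Ck_on_sum[OF W] Ck_on_scaleR[OF W Ck_on_const] gC)
  have "((\<lambda>y. f (chart_inv c y)) has_derivative G y) (at y)" if y: "y \<in> snd c ` M" for y
  proof (rule weak_derivative_imp_derivative[OF B W closed_csubspace_subspace[OF K]])
    show "f (chart_inv c y) \<in> K" if "y \<in> snd c ` M" for y using fK inv[OF that] by auto
    show "G y v \<in> K" if "y \<in> snd c ` M" for y v
    proof -
      have "g (X b) (chart_inv c y) \<in> K" for b using gK[OF X] inv(3)[OF that] by auto
      then show ?thesis
        unfolding G_def by (intro subspace_sum closed_csubspace_subspace[OF K] closed_csubspace_scaleR[OF K])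
    qed
    show "linear (G y)" for y
      unfolding G_def
      by (intro linear_compose_sum ballI linearI) (auto simp: inner_add_left scaleR_add_left)
    show "continuous_on (snd c ` M) (\<lambda>y. G y b)" for b
      by (rule Ck_on_imp_continuous_on[OF GC])
    fix x y assume x: "x \<in> K" and y: "y \<in> snd c ` M"
    let ?F = "\<lambda>\<mu>. cinner (f \<mu>) x" and ?\<mu> = "chart_inv c y"
    have d: "((\<lambda>y. ?F (chart_inv c y)) has_derivative chart_deriv c ?F ?\<mu>) (at y)"
      using differentiable_at_has_derivative[OF diff[OF x inv(3)[OF y]] c(1) inv(4)[OF y]] inv(2)[OF y]
      by simp
    then have lin: "linear (chart_deriv c ?F ?\<mu>)" by (rule has_derivative_linear)
    have "chart_deriv c ?F ?\<mu> b = cinner (g (X b) ?\<mu>) x" if "b \<in> B" for b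
    proof -
      have "X b ?\<mu> c = (b, 0)" using XN that inv(1)[OF y] by (auto simp: M_def)
      then show ?thesis
        using weak[OF X x inv(3)[OF y], of b] linear_0[OF lin]
          vf_apply_chart[OF X inv(3)[OF y] diff[OF x inv(3)[OF y]] c(1) inv(4)[OF y], of b]
        by (simp add: scaleC_complex_def)
    qed
    then have "chart_deriv c ?F ?\<mu> v = cinner (G y v) x" for v
      unfolding linear_parseval_frame[OF lin B, of v] G_def
      by (simp add: bounded_bilinear.sum_left[OF bounded_bilinear_cinner]
          bounded_bilinear.scaleR_left[OF bounded_bilinear_cinner])
    then have "chart_deriv c ?F ?\<mu> = (\<lambda>v. cinner (G y v) x)" by (rule ext)
    with d have "((\<lambda>y. Re (?F (chart_inv c y))) has_derivative (\<lambda>v. Re (cinner (G y v) x))) (at y)"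
      using bounded_linear.has_derivative[OF bounded_linear_Re] by metis
    then show "((\<lambda>y. f (chart_inv c y) \<bullet> x) has_derivative (\<lambda>v. G y v \<bullet> x)) (at y)"
      by (simp add: Re_cinner)
  qed (rule y)
  then have "Ck_on (Suc n) (snd c ` M) (\<lambda>y. f (chart_inv c y))"
    by (rule Ck_on_Suc_I[OF W _ GC])
  then have "Ck_map (Suc n) M f" by (rule Ck_map_chartI[OF c(1) M(1,4)])
  then show "\<exists>V'. open V' \<and> \<xi> \<in> V' \<and> Ck_map (Suc n) V' f" using M by blast
qed

end


section \<open>Locally uniform limits\<close>

text \<open>
  The counterpart of \<open>loc_unif_lim\<close> for functions with values in one metric space; sections are compared
  with such functions through \<open>T\<close>.
\<close>

definition loc_uniform ::
  "'a::topological_space set \<Rightarrow> (nat \<Rightarrow> 'a \<Rightarrow> 'b::metric_space) \<Rightarrow> ('a \<Rightarrow> 'b) \<Rightarrow> bool" where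
  "loc_uniform V f F \<longleftrightarrow> (\<forall>\<xi>\<in>V. \<exists>N. open N \<and> \<xi> \<in> N \<and> N \<subseteq> V \<and> uniform_limit N f F sequentially)"

lemma loc_uniform_tendsto: "loc_uniform V f F \<Longrightarrow> \<xi> \<in> V \<Longrightarrow> (\<lambda>j. f j \<xi>) \<longlonglongrightarrow> F \<xi>"
  unfolding loc_uniform_def using tendsto_uniform_limitI by metis

lemma loc_uniform_cong:
  assumes "\<And>j \<xi>. \<xi> \<in> V \<Longrightarrow> f j \<xi> = g j \<xi>" and "\<And>\<xi>. \<xi> \<in> V \<Longrightarrow> F \<xi> = G \<xi>"
    and "loc_uniform V f F"
  shows "loc_uniform V g G"
  unfolding loc_uniform_def
proof
  fix \<xi> assume "\<xi> \<in> V"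
  then obtain N where N: "open N" "\<xi> \<in> N" "N \<subseteq> V" "uniform_limit N f F sequentially"
    using assms(3) unfolding loc_uniform_def by blast
  have "uniform_limit N f F sequentially \<longleftrightarrow> uniform_limit N g G sequentially"
    using N(3) assms(1,2) by (intro uniform_limit_cong') auto
  then show "\<exists>N. open N \<and> \<xi> \<in> N \<and> N \<subseteq> V \<and> uniform_limit N g G sequentially" using N by blast
qed

lemma loc_uniform_common:
  assumes "loc_uniform V f F" and "loc_uniform V g G" and "\<xi> \<in> V"
  obtains N where "open N" "\<xi> \<in> N" "N \<subseteq> V" "uniform_limit N f F sequentially" "uniform_limit N g G sequentially"
proof -
  obtain N M where "open N" "\<xi> \<in> N" "N \<subseteq> V" "uniform_limit N f F sequentially"
    "open M" "\<xi> \<in> M" "M \<subseteq> V" "uniform_limit M g G sequentially"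
    using assms unfolding loc_uniform_def by metis
  then show thesis by (intro that[of "N \<inter> M"]) (auto intro: uniform_limit_on_subset)
qed

lemma loc_uniform_add:
  fixes f g :: "nat \<Rightarrow> 'a::topological_space \<Rightarrow> 'b::real_normed_vector"
  assumes "loc_uniform V f F" and "loc_uniform V g G"
  shows "loc_uniform V (\<lambda>j \<xi>. f j \<xi> + g j \<xi>) (\<lambda>\<xi>. F \<xi> + G \<xi>)"
  unfolding loc_uniform_def
proof
  fix \<xi> assume "\<xi> \<in> V"
  then obtain N where "open N" "\<xi> \<in> N" "N \<subseteq> V" "uniform_limit N f F sequentially" "uniform_limit N g G sequentially"
    using loc_uniform_common[OF assms] by blast
  then show "\<exists>N. open N \<and> \<xi> \<in> N \<and> N \<subseteq> V \<and>
      uniform_limit N (\<lambda>j \<xi>. f j \<xi> + g j \<xi>) (\<lambda>\<xi>. F \<xi> + G \<xi>) sequentially"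
    by (intro exI[of _ N]) (auto intro: uniform_limit_add)
qed

lemma loc_uniform_continuous_on:
  fixes V :: "'a::t2_space set"
  assumes "loc_uniform V f F" and "\<And>j. continuous_on V (f j)"
  shows "continuous_on V F"
proof (rule continuous_at_imp_continuous_on, rule ballI)
  fix \<xi> assume "\<xi> \<in> V"
  then obtain N where N: "open N" "\<xi> \<in> N" "N \<subseteq> V" "uniform_limit N f F sequentially"
    using assms(1) unfolding loc_uniform_def by blast
  have "continuous_on N F"
    by (rule uniform_limit_theorem[OF _ N(4)])
      (auto intro!: always_eventually continuous_on_subset[OF assms(2) N(3)])
  then show "isCont F \<xi>" using N(1,2) by (simp add: continuous_on_eq_continuous_at)
qed

lemma loc_uniform_bilinear:
  fixes V :: "'a::t2_space set"
  assumes P: "bounded_bilinear P" and f: "loc_uniform V f F" and g: "loc_uniform V g G"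
    and "open V" and F: "continuous_on V F" and G: "continuous_on V G"
  shows "loc_uniform V (\<lambda>j \<xi>. P (f j \<xi>) (g j \<xi>)) (\<lambda>\<xi>. P (F \<xi>) (G \<xi>))"
  unfolding loc_uniform_def
proof
  fix \<xi> assume \<xi>: "\<xi> \<in> V"
  obtain N where N: "open N" "\<xi> \<in> N" "N \<subseteq> V" "uniform_limit N f F sequentially" "uniform_limit N g G sequentially"
    using loc_uniform_common[OF f g \<xi>] by blast
  \<comment> \<open>On these neighbourhoods the limits are bounded, as the product of uniform limits requires.\<close>
  let ?M = "\<lambda>H. V \<inter> H -` ball (H \<xi>) 1"
  have M: "open (N \<inter> ?M F \<inter> ?M G)"
    using \<open>open V\<close> F G N(1) by (intro open_Int continuous_open_preimage) auto
  have "bounded (F ` (N \<inter> ?M F \<inter> ?M G))" "bounded (G ` (N \<inter> ?M F \<inter> ?M G))"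
    by (rule bounded_subset[OF bounded_ball]; force)+
  then have "uniform_limit (N \<inter> ?M F \<inter> ?M G) (\<lambda>j \<xi>. P (f j \<xi>) (g j \<xi>)) (\<lambda>\<xi>. P (F \<xi>) (G \<xi>)) sequentially"
    by (intro bounded_bilinear.bounded_uniform_limit[OF P] uniform_limit_on_subset[OF N(4)]
        uniform_limit_on_subset[OF N(5)]) auto
  then show "\<exists>N. open N \<and> \<xi> \<in> N \<and> N \<subseteq> V \<and>
      uniform_limit N (\<lambda>j \<xi>. P (f j \<xi>) (g j \<xi>)) (\<lambda>\<xi>. P (F \<xi>) (G \<xi>)) sequentially"
    using M N \<xi> by (intro exI[of _ "N \<inter> ?M F \<inter> ?M G"]) auto
qed

subsection \<open>Limits of derivatives along vector fields\<close>

context smooth_manifold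
begin

lemma vf_apply_fun_cong:
  fixes f :: "'m \<Rightarrow> 'f::complex_hilbert"
  assumes "open V" and "\<xi> \<in> V" and "\<And>\<mu>. \<mu> \<in> V \<Longrightarrow> f \<mu> = g \<mu>" and "differentiable_at f \<xi>"
  shows "differentiable_at g \<xi>" and "X \<in> vect \<A> V' \<Longrightarrow> \<xi> \<in> V' \<Longrightarrow> vf_apply \<A> X f \<xi> = vf_apply \<A> X g \<xi>"
proof -
  have *: "((\<lambda>y. g (chart_inv c y)) has_derivative chart_deriv c f \<xi>) (at (snd c \<xi>))"
    if c: "c \<in> \<A>" "\<xi> \<in> fst c" for c
  proof (rule has_derivative_transform_within_open[OF differentiable_at_has_derivative[OF assms(4) c]
        open_chart_image[OF c(1) assms(1)]])
    show "snd c \<xi> \<in> snd c ` (fst c \<inter> V)" using c assms(2) by blast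
    show "f (chart_inv c y) = g (chart_inv c y)" if "y \<in> snd c ` (fst c \<inter> V)" for y
      using chart_image_cases(2)[OF c(1) that] assms(3) by blast
  qed
  obtain c where c: "c \<in> \<A>" "\<xi> \<in> fst c" by (rule chart_at)
  show g: "differentiable_at g \<xi>" by (rule differentiable_atI[OF c *[OF c]])
  show "vf_apply \<A> X f \<xi> = vf_apply \<A> X g \<xi>" if "X \<in> vect \<A> V'" "\<xi> \<in> V'"
    unfolding vf_apply_chart[OF that assms(4) c] vf_apply_chart[OF that g c] chart_deriv_eqI[OF *[OF c]] ..
qed

text \<open>
  Near a point, uniform convergence of the derivatives along the coordinate fields of a frame is
  uniform convergence of the full derivatives in the operator norm. So limit and derivative may be
  interchanged.
\<close>

lemma vf_apply_limit:
  fixes f :: "nat \<Rightarrow> 'm \<Rightarrow> 'f::complex_hilbert"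
  assumes V: "open V" and diff: "\<And>j \<xi>. \<xi> \<in> V \<Longrightarrow> differentiable_at (f j) \<xi>"
    and lim: "\<And>\<xi>. \<xi> \<in> V \<Longrightarrow> (\<lambda>j. f j \<xi>) \<longlonglongrightarrow> F \<xi>"
    and D: "\<And>X. X \<in> vect \<A> V \<Longrightarrow> loc_uniform V (\<lambda>j. vf_apply \<A> X (f j)) (g X)"
    and \<xi>: "\<xi> \<in> V"
  shows "differentiable_at F \<xi>" and "X \<in> vect \<A> V \<Longrightarrow> vf_apply \<A> X F \<xi> = g X \<xi>"
proof -
  obtain c where c: "c \<in> \<A>" "\<xi> \<in> fst c" by (rule chart_at)
  obtain B :: "'e set" where B: "parseval_frame B" using frame_exists by blast
  then have fin: "finite B" by (simp add: parseval_frame_def)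
  have "\<exists>X N. X \<in> vect \<A> V \<and> open N \<and> \<xi> \<in> N \<and> N \<subseteq> V \<inter> fst c \<and> (\<forall>\<mu>\<in>N. X \<mu> c = (b, 0)) \<and>
      uniform_limit N (\<lambda>j. vf_apply \<A> X (f j)) (g X) sequentially" for b
  proof (rule local_coordinate_field[OF V \<xi> c, where v = b])
    fix X N assume X: "X \<in> vect \<A> V" "open N" "\<xi> \<in> N" "N \<subseteq> V \<inter> fst c"
      "\<And>\<mu>. \<mu> \<in> N \<Longrightarrow> X \<mu> c = (b, 0)"
    obtain M where "open M" "\<xi> \<in> M" "uniform_limit M (\<lambda>j. vf_apply \<A> X (f j)) (g X) sequentially"
      using D[OF X(1)] \<xi> unfolding loc_uniform_def by blast
    then show ?thesis
      using X by (intro exI[of _ X] exI[of _ "N \<inter> M"]) (auto intro: uniform_limit_on_subset)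
  qed
  then obtain X N where X: "\<And>b. X b \<in> vect \<A> V" and N: "\<And>b. open (N b)" "\<And>b. \<xi> \<in> N b"
    "\<And>b. N b \<subseteq> V \<inter> fst c" and XN: "\<And>b \<mu>. \<mu> \<in> N b \<Longrightarrow> X b \<mu> c = (b, 0)"
    and ul: "\<And>b. uniform_limit (N b) (\<lambda>j. vf_apply \<A> (X b) (f j)) (g (X b)) sequentially" by metis
  define M where "M = V \<inter> fst c \<inter> (\<Inter>b\<in>B. N b)"
  have M: "open M" "\<xi> \<in> M" "M \<subseteq> V" "M \<subseteq> fst c"
    using fin N \<xi> c V open_chart[OF c(1)] by (auto simp: M_def intro!: open_INT)
  have W: "open (snd c ` (fst c \<inter> M))" by (rule open_chart_image[OF c(1) M(1)])
  obtain r where r: "r > 0" "ball (snd c \<xi>) r \<subseteq> snd c ` (fst c \<inter> M)"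
    using openE[OF W, of "snd c \<xi>"] c(2) M(2) by blast
  let ?S = "ball (snd c \<xi>) r" and ?i = "chart_inv c"
  have inv: "?i y \<in> M" "snd c (?i y) = y" "?i y \<in> V" "?i y \<in> fst c" if "y \<in> ?S" for y
    using chart_image_cases[OF c(1) subsetD[OF r(2) that]] M(3) by auto
  define f' where "f' j y = chart_deriv c (f j) (?i y)" for j y
  define g' where "g' y v = (\<Sum>b\<in>B. (v \<bullet> b) *\<^sub>R g (X b) (?i y))" for y v
  have f': "((\<lambda>y. f j (?i y)) has_derivative f' j y) (at y)" if "y \<in> ?S" for j y
    using differentiable_at_has_derivative[OF diff[OF inv(3)[OF that]] c(1) inv(4)[OF that]] inv(2)[OF that]
    by (simp add: f'_def)
  have f'X: "f' j y b = vf_apply \<A> (X b) (f j) (?i y)" if "y \<in> ?S" "b \<in> B" for j y b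
  proof -
    have "X b (?i y) c = (b, 0)" using XN that inv(1)[OF that(1)] by (auto simp: M_def)
    then show ?thesis
      using vf_apply_chart[OF X inv(3)[OF that(1)] diff[OF inv(3)[OF that(1)]] c(1) inv(4)[OF that(1)], of b j]
        linear_0[OF has_derivative_linear[OF f'[OF that(1)]], of j] linear_0[OF bounded_linear.linear[OF bounded_linear_scaleC]]
      by (simp add: f'_def)
  qed
  \<comment> \<open>The added 1 keeps the constant positive when the model space has dimension 0.\<close>
  define C where "C = (\<Sum>b\<in>B. norm b) + 1"
  have C: "C > 0" by (simp add: C_def add_nonneg_pos sum_nonneg)
  have unif: "\<forall>\<^sub>F j in sequentially. \<forall>y\<in>?S. \<forall>v. norm (f' j y v - g' y v) \<le> e * norm v" if e: "e > 0" for e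
  proof -
    have "\<forall>\<^sub>F j in sequentially. \<forall>b\<in>B. \<forall>\<mu>\<in>N b. dist (vf_apply \<A> (X b) (f j) \<mu>) (g (X b) \<mu>) < e / C"
      using fin e C uniform_limitD[OF ul] by (intro eventually_ball_finite) auto
    then show ?thesis
    proof (rule eventually_mono, intro ballI allI)
      fix j y v
      assume j: "\<forall>b\<in>B. \<forall>\<mu>\<in>N b. dist (vf_apply \<A> (X b) (f j) \<mu>) (g (X b) \<mu>) < e / C" and y: "y \<in> ?S"
      have "norm (f' j y b - g (X b) (?i y)) \<le> e / C" if "b \<in> B" for b
      proof -
        have "?i y \<in> N b" using inv(1)[OF y] that by (auto simp: M_def)
        then show ?thesis using j that by (auto simp: f'X[OF y that] dist_norm intro: less_imp_le)
      qed
      then have b: "norm ((v \<bullet> b) *\<^sub>R (f' j y b - g (X b) (?i y))) \<le> norm v * norm b * (e / C)" if "b \<in> B" for b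
        using that unfolding norm_scaleR by (intro mult_mono) (auto simp: Cauchy_Schwarz_ineq2)
      have "f' j y v - g' y v = (\<Sum>b\<in>B. (v \<bullet> b) *\<^sub>R (f' j y b - g (X b) (?i y)))"
        unfolding g'_def linear_parseval_frame[OF has_derivative_linear[OF f'[OF y]] B, of j v]
        by (simp add: sum_subtractf scaleR_diff_right)
      also have "norm \<dots> \<le> (\<Sum>b\<in>B. norm v * norm b * (e / C))"
        by (rule sum_norm_le) (rule b)
      also have "\<dots> = (C - 1) / C * (e * norm v)"
        by (simp add: C_def sum_distrib_left sum_distrib_right sum_divide_distrib mult_ac)
      also have "\<dots> \<le> 1 * (e * norm v)"
        using C e by (intro mult_right_mono) auto
      finally show "norm (f' j y v - g' y v) \<le> e * norm v" by simp
    qed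
  qed
  have centre: "snd c \<xi> \<in> ?S" using r by simp
  obtain G where G: "\<And>y. y \<in> ?S \<Longrightarrow> (\<lambda>j. f j (?i y)) \<longlonglongrightarrow> G y"
    "\<And>y. y \<in> ?S \<Longrightarrow> (G has_derivative g' y) (at y within ?S)"
    using has_derivative_sequence[OF convex_ball has_derivative_at_withinI[OF f'] unif centre lim[OF inv(3)[OF centre]]]
    by blast
  have GF: "G y = F (?i y)" if "y \<in> ?S" for y
    by (rule LIMSEQ_unique[OF G(1)[OF that] lim[OF inv(3)[OF that]]])
  have "(G has_derivative g' (snd c \<xi>)) (at (snd c \<xi>))"
    using G(2)[OF centre] centre by (simp add: at_within_open[of _ ?S])
  then have F: "((\<lambda>y. F (?i y)) has_derivative g' (snd c \<xi>)) (at (snd c \<xi>))"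
    by (rule has_derivative_transform_within_open[OF _ open_ball centre]) (simp add: GF)
  then show dF: "differentiable_at F \<xi>" by (rule differentiable_atI[OF c])
  show "vf_apply \<A> Y F \<xi> = g Y \<xi>" if Y: "Y \<in> vect \<A> V" for Y
  proof (rule LIMSEQ_unique)
    show "(\<lambda>j. vf_apply \<A> Y (f j) \<xi>) \<longlonglongrightarrow> g Y \<xi>"
      by (rule loc_uniform_tendsto[OF D[OF Y] \<xi>])
    have "(\<lambda>j. f' j (snd c \<xi>) v) \<longlonglongrightarrow> g' (snd c \<xi>) v" for v
    proof (rule LIMSEQ_I)
      fix e :: real assume e: "e > 0"
      define d where "d = e / (2 * (norm v + 1))"
      have d: "d > 0" "d * norm v < e"
        using e by (auto simp: d_def field_simps add_pos_nonneg intro: add_nonneg_pos)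
      have "\<forall>\<^sub>F j in sequentially. norm (f' j (snd c \<xi>) v - g' (snd c \<xi>) v) < e"
        by (rule eventually_mono[OF unif[OF d(1)]]) (use centre d(2) in \<open>fastforce intro: order_le_less_trans\<close>)
      then show "\<exists>n0. \<forall>j\<ge>n0. norm (f' j (snd c \<xi>) v - g' (snd c \<xi>) v) < e"
        by (simp add: eventually_sequentially)
    qed
    then have "(\<lambda>j. chart_deriv c (f j) \<xi> v) \<longlonglongrightarrow> chart_deriv c F \<xi> v" for v
      using chart_deriv_eqI[OF F] by (simp add: f'_def chart_inv_chart[OF c])
    then show "(\<lambda>j. vf_apply \<A> Y (f j) \<xi>) \<longlonglongrightarrow> vf_apply \<A> Y F \<xi>"
      unfolding vf_apply_chart[OF Y \<xi> diff[OF \<xi>] c] vf_apply_chart[OF Y \<xi> dF c]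
      by (intro tendsto_add bounded_linear.tendsto[OF bounded_linear_scaleC])
  qed
qed

end


section \<open>A smooth field of Hilbert spaces with a fibrewise unitary map\<close>

text \<open>
  The unitary maps \<open>T(\<xi>)\<close> transport the structure of all fibers over \<open>U\<close> to \<open>K\<close>; fiberwise computations
  are carried out there.
\<close>

locale trivialised_hilbert_field =
  fixes S :: "('m::{t2_space,second_countable_topology}, 'e::real_inner, 'h) hfield"
    and U :: "'m set" and K :: "'k::complex_hilbert set" and T :: "'m \<Rightarrow> 'h \<Rightarrow> 'k"
  assumes field: "smooth_hilbert_field S"
    and open_U: "open U"
    and K: "closed_csubspace K"
    and unitary: "\<And>\<xi>. \<xi> \<in> U \<Longrightarrow> unitary_at S \<xi> K (T \<xi>)"
    and T_smooth: "\<And>\<phi>. \<phi> \<in> ssec S \<Longrightarrow> op_apply T \<phi> \<in> smooth_maps (atlas S) U K"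
    and adj_T_smooth: "\<And>x. x \<in> K \<Longrightarrow> op_apply (adj_field S T) (\<lambda>_. x) \<in> Gamma_inf S U"
begin

sublocale smooth_manifold "atlas S"
  using field by unfold_locales (simp add: smooth_hilbert_field_def)

abbreviation "\<A> \<equiv> atlas S"

lemma fiber_hilbert: "complex_hilbert_on (fiber S \<xi>) (fadd S) (fscale S) (finner S)"
  using field by (simp add: smooth_hilbert_field_def)

lemmas fiber_add = complex_hilbert_on.add_closed[OF fiber_hilbert]
lemmas fiber_scale = complex_hilbert_on.scale_closed[OF fiber_hilbert]
lemmas fiber_scale_one = complex_hilbert_on.scale_one[OF fiber_hilbert]

lemma T_in: "\<xi> \<in> U \<Longrightarrow> v \<in> fiber S \<xi> \<Longrightarrow> T \<xi> v \<in> K"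
  using unitary unfolding unitary_at_def bij_betw_def by blast

lemma T_surj: "\<xi> \<in> U \<Longrightarrow> x \<in> K \<Longrightarrow> \<exists>v\<in>fiber S \<xi>. T \<xi> v = x"
  using unitary unfolding unitary_at_def bij_betw_def by blast

lemma T_inj: "\<xi> \<in> U \<Longrightarrow> v \<in> fiber S \<xi> \<Longrightarrow> w \<in> fiber S \<xi> \<Longrightarrow> T \<xi> v = T \<xi> w \<Longrightarrow> v = w"
  using unitary unfolding unitary_at_def bij_betw_def inj_on_def by blast

lemma T_add: "\<xi> \<in> U \<Longrightarrow> v \<in> fiber S \<xi> \<Longrightarrow> w \<in> fiber S \<xi> \<Longrightarrow> T \<xi> (fadd S v w) = T \<xi> v + T \<xi> w"
  using unitary unfolding unitary_at_def by blast

lemma T_scale: "\<xi> \<in> U \<Longrightarrow> v \<in> fiber S \<xi> \<Longrightarrow> T \<xi> (fscale S a v) = a *\<^sub>C T \<xi> v"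
  using unitary unfolding unitary_at_def by blast

lemma finner_T: "\<xi> \<in> U \<Longrightarrow> v \<in> fiber S \<xi> \<Longrightarrow> w \<in> fiber S \<xi> \<Longrightarrow> finner S v w = cinner (T \<xi> v) (T \<xi> w)"
  using unitary unfolding unitary_at_def by metis

lemma fnorm_T: "\<xi> \<in> U \<Longrightarrow> v \<in> fiber S \<xi> \<Longrightarrow> fnorm S v = norm (T \<xi> v)"
  by (simp add: fnorm_def finner_T Re_cinner norm_eq_sqrt_inner)

lemma fdist_T: "\<xi> \<in> U \<Longrightarrow> v \<in> fiber S \<xi> \<Longrightarrow> w \<in> fiber S \<xi> \<Longrightarrow> fdist S v w = norm (T \<xi> v - T \<xi> w)"
  by (simp add: fdist_def fnorm_T fiber_add fiber_scale T_add T_scale scaleC_minus_one)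

lemma ssec_fiber: "\<phi> \<in> ssec S \<Longrightarrow> \<phi> \<xi> \<in> fiber S \<xi>"
  using field by (auto simp: smooth_hilbert_field_def sections_def)

lemma ssec_sections: "\<phi> \<in> ssec S \<Longrightarrow> \<phi> \<in> sections S U"
  by (simp add: sections_def ssec_fiber)

lemma ssec_add: "\<phi> \<in> ssec S \<Longrightarrow> \<psi> \<in> ssec S \<Longrightarrow> sec_add S \<phi> \<psi> \<in> ssec S"
  using field by (simp add: smooth_hilbert_field_def)

lemma ssec_mult: "\<phi> \<in> ssec S \<Longrightarrow> smooth_map \<A> UNIV a \<Longrightarrow> sec_mult S a \<phi> \<in> ssec S"
  using field unfolding smooth_hilbert_field_def by blast

lemma ssec_conn: "\<phi> \<in> ssec S \<Longrightarrow> X \<in> vect \<A> UNIV \<Longrightarrow> conn S X \<phi> \<in> ssec S"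
  using field unfolding smooth_hilbert_field_def by blast

lemma conn_vf_mult:
  "X \<in> vect \<A> UNIV \<Longrightarrow> \<phi> \<in> ssec S \<Longrightarrow> smooth_map \<A> UNIV a \<Longrightarrow>
    conn S (vf_mult a X) \<phi> = sec_mult S a (conn S X \<phi>)"
  using field unfolding smooth_hilbert_field_def by blast

lemma sec_inner_smooth:
  "\<phi> \<in> ssec S \<Longrightarrow> \<psi> \<in> ssec S \<Longrightarrow> smooth_map \<A> UNIV (sec_inner S \<phi> \<psi>)"
  using field unfolding smooth_hilbert_field_def by blast

lemma metric_connection:
  "\<phi> \<in> ssec S \<Longrightarrow> \<psi> \<in> ssec S \<Longrightarrow> X \<in> vect \<A> UNIV \<Longrightarrow>
    vf_apply \<A> X (sec_inner S \<phi> \<psi>) \<xi> =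
      sec_inner S (conn S X \<phi>) \<psi> \<xi> + sec_inner S \<phi> (conn S (vf_cnj X) \<psi>) \<xi>"
  using field unfolding smooth_hilbert_field_def by blast

lemma values_at_cases:
  assumes "v \<in> values_at S \<xi>"
  obtains \<phi> where "\<phi> \<in> ssec S" "\<phi> \<xi> = v"
  using assms by (auto simp: values_at_def)

lemma values_at_fiber: "v \<in> values_at S \<xi> \<Longrightarrow> v \<in> fiber S \<xi>"
  by (auto simp: values_at_def ssec_fiber)

lemma values_at_ssec: "\<phi> \<in> ssec S \<Longrightarrow> \<phi> \<xi> \<in> values_at S \<xi>"
  by (auto simp: values_at_def)

lemma values_at_add: "v \<in> values_at S \<xi> \<Longrightarrow> w \<in> values_at S \<xi> \<Longrightarrow> fadd S v w \<in> values_at S \<xi>"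
  using ssec_add by (fastforce simp: values_at_def sec_add_def)

lemma values_at_scale: "v \<in> values_at S \<xi> \<Longrightarrow> fscale S a v \<in> values_at S \<xi>"
  using ssec_mult[OF _ smooth_map_const] by (fastforce simp: values_at_def sec_mult_def)

lemma values_at_dense:
  assumes "\<xi> \<in> U" and "v \<in> fiber S \<xi>"
  obtains s where "\<And>n::nat. s n \<in> values_at S \<xi>" "(\<lambda>n. T \<xi> (s n)) \<longlonglongrightarrow> T \<xi> v"
proof -
  have "\<exists>w\<in>values_at S \<xi>. fdist S v w < inverse (Suc n)" for n
    using field assms(2) unfolding smooth_hilbert_field_def by simp
  then obtain s where s: "\<And>n. s n \<in> values_at S \<xi>" "\<And>n. fdist S v (s n) < inverse (Suc n)" by metis
  have "norm (T \<xi> (s n) - T \<xi> v) < inverse (Suc n)" for n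
    using s(2)[of n] fdist_T[OF assms values_at_fiber[OF s(1)]] by (simp add: norm_minus_commute)
  then have "(\<lambda>n. norm (T \<xi> (s n) - T \<xi> v)) \<longlonglongrightarrow> 0"
    by (intro tendsto_sandwich[OF _ _ tendsto_const LIMSEQ_inverse_real_of_nat])
      (auto intro!: always_eventually less_imp_le)
  then show thesis using s(1) by (intro that[of s]) (auto simp: tendsto_norm_zero_iff Lim_null[symmetric])
qed

text \<open>
  The values of smooth sections are dense in the fiber, so their images under \<open>T\<close> are dense in \<open>K\<close>.
\<close>

lemma eq_if_products_eq:
  assumes "\<xi> \<in> U" and "x \<in> K" and "y \<in> K"
    and "\<And>v. v \<in> values_at S \<xi> \<Longrightarrow> cinner x (T \<xi> v) = cinner y (T \<xi> v)"
  shows "x = y"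
proof (rule cinner_eqI[OF K assms(2,3)])
  fix z assume "z \<in> K"
  then obtain v where v: "v \<in> fiber S \<xi>" "T \<xi> v = z" using T_surj assms(1) by blast
  obtain s where s: "\<And>n::nat. s n \<in> values_at S \<xi>" "(\<lambda>n. T \<xi> (s n)) \<longlonglongrightarrow> z"
    using values_at_dense[OF assms(1) v(1)] v(2) by blast
  have "(\<lambda>n. cinner x (T \<xi> (s n))) \<longlonglongrightarrow> cinner x z" "(\<lambda>n. cinner y (T \<xi> (s n))) \<longlonglongrightarrow> cinner y z"
    by (intro bounded_linear.tendsto[OF bounded_linear_cinner_right] s(2))+
  then show "cinner x z = cinner y z"
    using assms(4)[OF s(1)] LIMSEQ_unique by auto
qed


subsection \<open>The connection on restricted sections\<close>

text \<open>
  Multiplied by a bump function \<open>a\<close> supported where the fields agree, they become equal; since \<open>\<nabla>\<close> is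
  linear over functions in the vector field, \<open>a(\<xi>) = 1\<close> can be cancelled.
\<close>

lemma conn_local:
  assumes X: "X \<in> vect \<A> UNIV" and Y: "Y \<in> vect \<A> UNIV" and \<phi>: "\<phi> \<in> ssec S"
    and V: "open V" "\<xi> \<in> V" and eq: "\<And>\<mu>. \<mu> \<in> V \<Longrightarrow> X \<mu> = Y \<mu>"
  shows "conn S X \<phi> \<xi> = conn S Y \<phi> \<xi>"
proof (rule bump_exists[OF V])
  fix \<rho> :: "'m \<Rightarrow> real" and V1 Q
  assume \<rho>: "smooth_map \<A> UNIV \<rho>" "\<xi> \<in> V1" "\<And>\<mu>. \<mu> \<in> V1 \<Longrightarrow> \<rho> \<mu> = 1"
    "Q \<subseteq> V" "\<And>\<mu>. \<mu> \<notin> Q \<Longrightarrow> \<rho> \<mu> = 0"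
  define a where "a \<mu> = complex_of_real (\<rho> \<mu>)" for \<mu>
  have a: "smooth_map \<A> UNIV a"
    using \<rho>(1) Ck_map_bounded_linear[OF bounded_linear_of_real open_UNIV, of _ \<rho>]
    unfolding smooth_map_iff a_def by blast
  have "vf_mult a X \<mu> = vf_mult a Y \<mu>" for \<mu>
  proof (cases "\<mu> \<in> V")
    case False
    then have "\<rho> \<mu> = 0" using \<rho>(4,5) by blast
    then show ?thesis by (simp add: vf_mult_def a_def split_def)
  qed (simp add: vf_mult_def eq)
  then have "vf_mult a X = vf_mult a Y" by (rule ext)
  then have "sec_mult S a (conn S X \<phi>) \<xi> = sec_mult S a (conn S Y \<phi>) \<xi>"
    using conn_vf_mult[OF X \<phi> a] conn_vf_mult[OF Y \<phi> a] by simp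
  moreover have "sec_mult S a (conn S Z \<phi>) \<xi> = conn S Z \<phi> \<xi>" if "Z \<in> vect \<A> UNIV" for Z
    using fiber_scale_one[OF ssec_fiber[OF ssec_conn[OF \<phi> that]]] \<rho>(2,3) by (simp add: sec_mult_def a_def)
  ultimately show ?thesis using X Y by simp
qed

text \<open>
  The definition of \<open>conn_on\<close> chooses a global field separately at each point. By locality, a single one
  serves a whole neighbourhood.
\<close>

lemma conn_on_local:
  assumes X: "X \<in> vect \<A> U" and \<xi>: "\<xi> \<in> U"
  obtains Y V where "Y \<in> vect \<A> UNIV" "open V" "\<xi> \<in> V" "V \<subseteq> U" "\<And>\<mu>. \<mu> \<in> V \<Longrightarrow> Y \<mu> = X \<mu>"
    "\<And>\<phi> \<mu>. \<phi> \<in> ssec S \<Longrightarrow> \<mu> \<in> V \<Longrightarrow> conn_on S U X \<phi> \<mu> = conn S Y \<phi> \<mu>"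
proof (rule vect_extend[OF open_U X \<xi>])
  fix \<rho> :: "'m \<Rightarrow> real" and V
  assume Y: "(\<lambda>\<mu> c. \<rho> \<mu> *\<^sub>R X \<mu> c) \<in> vect \<A> UNIV"
    and V: "open V" "\<xi> \<in> V" "V \<subseteq> U" and \<rho>: "\<And>\<mu>. \<mu> \<in> V \<Longrightarrow> \<rho> \<mu> = 1"
  define Y where "Y = (\<lambda>\<mu> c. \<rho> \<mu> *\<^sub>R X \<mu> c)"
  have Y: "Y \<in> vect \<A> UNIV" and YX: "\<And>\<mu>. \<mu> \<in> V \<Longrightarrow> Y \<mu> = X \<mu>"
    using Y \<rho> by (auto simp: Y_def)
  have "conn_on S U X \<phi> \<mu> = conn S Y \<phi> \<mu>" if \<phi>: "\<phi> \<in> ssec S" and \<mu>: "\<mu> \<in> V" for \<phi> \<mu>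
  proof -
    let ?P = "\<lambda>Y. Y \<in> vect \<A> UNIV \<and> (\<exists>V. open V \<and> \<mu> \<in> V \<and> V \<subseteq> U \<and> (\<forall>\<mu>\<in>V. Y \<mu> = X \<mu>))"
    have "?P Y" using Y YX V \<mu> by blast
    then have "?P (SOME Y. ?P Y)" by (rule someI[of ?P])
    then obtain N where N: "(SOME Y. ?P Y) \<in> vect \<A> UNIV" "open N" "\<mu> \<in> N"
      "\<And>\<nu>. \<nu> \<in> N \<Longrightarrow> (SOME Y. ?P Y) \<nu> = X \<nu>" by blast
    have "conn S (SOME Y. ?P Y) \<phi> \<mu> = conn S Y \<phi> \<mu>"
      by (rule conn_local[OF N(1) Y \<phi>, of "N \<inter> V"]) (use N V \<mu> YX in auto)
    then show ?thesis by (simp add: conn_on_def)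
  qed
  with Y V YX show thesis by (rule that)
qed

lemma conn_on_values:
  assumes "X \<in> vect \<A> U" and "\<xi> \<in> U" and "\<phi> \<in> ssec S"
  shows "conn_on S U X \<phi> \<xi> \<in> values_at S \<xi>"
proof (rule conn_on_local[OF assms(1,2)])
  fix Y V
  assume "Y \<in> vect \<A> UNIV" "\<xi> \<in> V"
    "\<And>\<phi> \<mu>. \<phi> \<in> ssec S \<Longrightarrow> \<mu> \<in> V \<Longrightarrow> conn_on S U X \<phi> \<mu> = conn S Y \<phi> \<mu>"
  then show ?thesis using values_at_ssec[OF ssec_conn[OF assms(3)]] assms(3) by metis
qed

lemma conn_on_sections: "X \<in> vect \<A> U \<Longrightarrow> \<phi> \<in> ssec S \<Longrightarrow> conn_on S U X \<phi> \<in> sections S U"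
  using conn_on_values values_at_fiber by (auto simp: sections_def)

lemma conn_on_metric:
  assumes X: "X \<in> vect \<A> U" and \<xi>: "\<xi> \<in> U" and \<phi>: "\<phi> \<in> ssec S" and \<psi>: "\<psi> \<in> ssec S"
  shows "vf_apply \<A> X (sec_inner S \<phi> \<psi>) \<xi> =
    sec_inner S (conn_on S U X \<phi>) \<psi> \<xi> + sec_inner S \<phi> (conn_on S U (vf_cnj X) \<psi>) \<xi>"
proof (rule conn_on_local[OF X \<xi>], rule conn_on_local[OF vect_cnj[OF open_U X] \<xi>])
  fix Y V Z W
  assume Y: "Y \<in> vect \<A> UNIV" "open V" "\<xi> \<in> V" "\<And>\<mu>. \<mu> \<in> V \<Longrightarrow> Y \<mu> = X \<mu>"
    "\<And>\<phi> \<mu>. \<phi> \<in> ssec S \<Longrightarrow> \<mu> \<in> V \<Longrightarrow> conn_on S U X \<phi> \<mu> = conn S Y \<phi> \<mu>"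
  assume Z: "Z \<in> vect \<A> UNIV" "open W" "\<xi> \<in> W" "\<And>\<mu>. \<mu> \<in> W \<Longrightarrow> Z \<mu> = vf_cnj X \<mu>"
    "\<And>\<phi> \<mu>. \<phi> \<in> ssec S \<Longrightarrow> \<mu> \<in> W \<Longrightarrow> conn_on S U (vf_cnj X) \<phi> \<mu> = conn S Z \<phi> \<mu>"
  have "conn S Z \<psi> \<xi> = conn S (vf_cnj Y) \<psi> \<xi>"
    by (rule conn_local[OF Z(1) vect_cnj[OF open_UNIV Y(1)] \<psi>, of "V \<inter> W"])
      (use Y(2-4) Z(2-4) in \<open>auto simp: vf_cnj_def\<close>)
  moreover have "vf_apply \<A> X (sec_inner S \<phi> \<psi>) \<xi> = vf_apply \<A> Y (sec_inner S \<phi> \<psi>) \<xi>"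
    by (rule vf_apply_cong) (simp add: Y(3,4))
  ultimately show ?thesis
    using metric_connection[OF \<phi> \<psi> Y(1), of \<xi>] Y(5)[OF \<phi> Y(3)] Z(5)[OF \<psi> Z(3)]
    by (simp add: sec_inner_def)
qed

lemma T_ssec_continuous: "\<phi> \<in> ssec S \<Longrightarrow> continuous_on U (\<lambda>\<mu>. T \<mu> (\<phi> \<mu>))"
  using T_smooth Ck_map_imp_continuous_on[OF _ open_U]
  unfolding smooth_maps_def smooth_map_iff op_apply_def by blast

lemma T_conn_on_continuous:
  assumes X: "X \<in> vect \<A> U" and \<phi>: "\<phi> \<in> ssec S"
  shows "continuous_on U (\<lambda>\<mu>. T \<mu> (conn_on S U X \<phi> \<mu>))"
proof (rule continuous_at_imp_continuous_on, rule ballI)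
  fix \<xi> assume \<xi>: "\<xi> \<in> U"
  show "isCont (\<lambda>\<mu>. T \<mu> (conn_on S U X \<phi> \<mu>)) \<xi>"
  proof (rule conn_on_local[OF X \<xi>])
    fix Y V
    assume Y: "Y \<in> vect \<A> UNIV" "open V" "\<xi> \<in> V" "V \<subseteq> U"
      "\<And>\<phi> \<mu>. \<phi> \<in> ssec S \<Longrightarrow> \<mu> \<in> V \<Longrightarrow> conn_on S U X \<phi> \<mu> = conn S Y \<phi> \<mu>"
    have "continuous_on V (\<lambda>\<mu>. T \<mu> (conn S Y \<phi> \<mu>))"
      by (rule continuous_on_subset[OF T_ssec_continuous[OF ssec_conn[OF \<phi> Y(1)]] Y(4)])
    then have "continuous_on V (\<lambda>\<mu>. T \<mu> (conn_on S U X \<phi> \<mu>))"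
      by (rule continuous_on_eq) (simp add: Y(5)[OF \<phi>])
    then show ?thesis using Y(2,3) by (simp add: continuous_on_eq_continuous_at)
  qed
qed


subsection \<open>Sections of class \<open>C\<^sup>1\<close>\<close>

lemma loc_unif_lim_iff:
  assumes s: "\<And>j. s j \<in> sections S U" and \<phi>: "\<phi> \<in> sections S U"
  shows "loc_unif_lim S U s \<phi> \<longleftrightarrow> loc_uniform U (\<lambda>j \<mu>. T \<mu> (s j \<mu>)) (\<lambda>\<mu>. T \<mu> (\<phi> \<mu>))"
proof -
  have "uniform_limit V (\<lambda>j \<mu>. fdist S (s j \<mu>) (\<phi> \<mu>)) (\<lambda>_. 0) sequentially \<longleftrightarrow>
      uniform_limit V (\<lambda>j \<mu>. T \<mu> (s j \<mu>)) (\<lambda>\<mu>. T \<mu> (\<phi> \<mu>)) sequentially" if V: "V \<subseteq> U" for V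
  proof -
    have "dist (fdist S (s j \<mu>) (\<phi> \<mu>)) 0 = dist (T \<mu> (s j \<mu>)) (T \<mu> (\<phi> \<mu>))" if "\<mu> \<in> V" for j \<mu>
      using that V s \<phi> fdist_T[of \<mu> "s j \<mu>" "\<phi> \<mu>"] by (auto simp: sections_def dist_norm)
    then show ?thesis by (simp add: uniform_limit_iff)
  qed
  then show ?thesis unfolding loc_unif_lim_def loc_uniform_def by (metis (no_types, lifting))
qed

text \<open>
  Membership in \<open>\<Gamma>\<^sup>1(U)\<close>, as far as it enters the product rule.
\<close>

definition C1_section :: "('m \<Rightarrow> 'h) \<Rightarrow> bool" where
  "C1_section \<phi> \<longleftrightarrow> \<phi> \<in> sections S U \<and> (\<exists>s. C1_approx S U s \<phi>)"

lemma C1_approx_ssec: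
  assumes \<phi>: "\<phi> \<in> ssec S"
  shows "C1_approx S U (\<lambda>_. \<phi>) \<phi>"
proof -
  have const: "loc_unif_lim S U (\<lambda>_. \<psi>) \<psi>" if "\<psi> \<in> sections S U" for \<psi>
    unfolding loc_unif_lim_iff[OF that that]
    using open_U by (auto simp: loc_uniform_def uniform_limit_iff)
  then show ?thesis
    unfolding C1_approx_def using \<phi> ssec_sections conn_on_sections by blast
qed

lemma C1_section_ssec: "\<phi> \<in> ssec S \<Longrightarrow> C1_section \<phi>"
  unfolding C1_section_def using C1_approx_ssec ssec_sections by blast

lemma C1_approxD:
  assumes "C1_approx S U s \<phi>" and "\<phi> \<in> sections S U"
  shows "\<And>j. s j \<in> ssec S"
    and "loc_uniform U (\<lambda>j \<mu>. T \<mu> (s j \<mu>)) (\<lambda>\<mu>. T \<mu> (\<phi> \<mu>))"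
    and "continuous_on U (\<lambda>\<mu>. T \<mu> (\<phi> \<mu>))"
proof -
  show s: "s j \<in> ssec S" for j using assms(1) by (simp add: C1_approx_def)
  show l: "loc_uniform U (\<lambda>j \<mu>. T \<mu> (s j \<mu>)) (\<lambda>\<mu>. T \<mu> (\<phi> \<mu>))"
    using assms loc_unif_lim_iff[OF ssec_sections[OF s] assms(2)] by (simp add: C1_approx_def)
  show "continuous_on U (\<lambda>\<mu>. T \<mu> (\<phi> \<mu>))"
    by (rule loc_uniform_continuous_on[OF l T_ssec_continuous[OF s]])
qed

lemma C1_approx_conn:
  assumes "C1_approx S U s \<phi>" and X: "X \<in> vect \<A> U"
  obtains \<psi> where "\<psi> \<in> sections S U" "loc_uniform U (\<lambda>j \<mu>. T \<mu> (conn_on S U X (s j) \<mu>)) (\<lambda>\<mu>. T \<mu> (\<psi> \<mu>))"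
    "continuous_on U (\<lambda>\<mu>. T \<mu> (\<psi> \<mu>))"
proof -
  have s: "s j \<in> ssec S" for j using assms(1) by (simp add: C1_approx_def)
  obtain \<psi> where \<psi>: "\<psi> \<in> sections S U" "loc_unif_lim S U (\<lambda>j. conn_on S U X (s j)) \<psi>"
    using assms by (auto simp: C1_approx_def)
  then have l: "loc_uniform U (\<lambda>j \<mu>. T \<mu> (conn_on S U X (s j) \<mu>)) (\<lambda>\<mu>. T \<mu> (\<psi> \<mu>))"
    using loc_unif_lim_iff[OF conn_on_sections[OF X s] \<psi>(1)] by simp
  then show thesis
    using \<psi>(1) loc_uniform_continuous_on[OF l T_conn_on_continuous[OF X s]] by (intro that)
qed

lemma C1_approx_conns:
  assumes "C1_approx S U s \<phi>"
  shows "\<exists>\<psi>. \<forall>X\<in>vect \<A> U. \<psi> X \<in> sections S U \<and>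
    loc_uniform U (\<lambda>j \<mu>. T \<mu> (conn_on S U X (s j) \<mu>)) (\<lambda>\<mu>. T \<mu> (\<psi> X \<mu>)) \<and>
    continuous_on U (\<lambda>\<mu>. T \<mu> (\<psi> X \<mu>))"
proof (rule bchoice, rule ballI)
  fix X assume "X \<in> vect \<A> U"
  then show "\<exists>\<psi>. \<psi> \<in> sections S U \<and> loc_uniform U (\<lambda>j \<mu>. T \<mu> (conn_on S U X (s j) \<mu>)) (\<lambda>\<mu>. T \<mu> (\<psi> \<mu>)) \<and>
      continuous_on U (\<lambda>\<mu>. T \<mu> (\<psi> \<mu>))"
    using C1_approx_conn[OF assms] by blast
qed

text \<open>
  The product rule holds for \<open>s j\<close> and \<open>t j\<close>, and both sides converge locally uniformly. The limits \<open>v\<close>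
  and \<open>w\<close> are those at the point \<open>\<xi>\<close> only, which makes the lemma applicable to arbitrary approximating
  sequences before \<open>conn_ext\<close> is known to be well defined.
\<close>

lemma product_rule_limit:
  assumes s: "C1_approx S U s \<phi>" "\<phi> \<in> sections S U" and t: "C1_approx S U t \<sigma>" "\<sigma> \<in> sections S U"
    and \<xi>: "\<xi> \<in> U"
  shows "differentiable_at (sec_inner S \<phi> \<sigma>) \<xi>"
    and "X \<in> vect \<A> U \<Longrightarrow> v \<in> fiber S \<xi> \<Longrightarrow> w \<in> fiber S \<xi> \<Longrightarrow>
      (\<lambda>j. T \<xi> (conn_on S U X (s j) \<xi>)) \<longlonglongrightarrow> T \<xi> v \<Longrightarrow>
      (\<lambda>j. T \<xi> (conn_on S U (vf_cnj X) (t j) \<xi>)) \<longlonglongrightarrow> T \<xi> w \<Longrightarrow>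
      vf_apply \<A> X (sec_inner S \<phi> \<sigma>) \<xi> = finner S v (\<sigma> \<xi>) + finner S (\<phi> \<xi>) w"
proof -
  note s' = C1_approxD[OF s] and t' = C1_approxD[OF t]
  let ?c = "\<lambda>\<phi> \<psi> \<mu>. cinner (T \<mu> (\<phi> \<mu>)) (T \<mu> (\<psi> \<mu>))"
  have sec: "sec_inner S \<alpha> \<beta> \<mu> = ?c \<alpha> \<beta> \<mu>" if "\<alpha> \<in> sections S U" "\<beta> \<in> sections S U" "\<mu> \<in> U" for \<alpha> \<beta> \<mu>
    using that by (simp add: sec_inner_def sections_def finner_T)
  note sU = ssec_sections[OF s'(1)] and tU = ssec_sections[OF t'(1)]
  note cU = conn_on_sections
  note cnj = vect_cnj[OF open_U]
  obtain \<psi> where "\<forall>X\<in>vect \<A> U. \<psi> X \<in> sections S U \<and>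
      loc_uniform U (\<lambda>j \<mu>. T \<mu> (conn_on S U X (s j) \<mu>)) (\<lambda>\<mu>. T \<mu> (\<psi> X \<mu>)) \<and>
      continuous_on U (\<lambda>\<mu>. T \<mu> (\<psi> X \<mu>))"
    using C1_approx_conns[OF s(1)] by (rule exE)
  then have \<psi>: "\<And>X. X \<in> vect \<A> U \<Longrightarrow> \<psi> X \<in> sections S U"
    "\<And>X. X \<in> vect \<A> U \<Longrightarrow> loc_uniform U (\<lambda>j \<mu>. T \<mu> (conn_on S U X (s j) \<mu>)) (\<lambda>\<mu>. T \<mu> (\<psi> X \<mu>))"
    "\<And>X. X \<in> vect \<A> U \<Longrightarrow> continuous_on U (\<lambda>\<mu>. T \<mu> (\<psi> X \<mu>))"
    by (simp_all only:)
  obtain \<tau> where "\<forall>X\<in>vect \<A> U. \<tau> X \<in> sections S U \<and>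
      loc_uniform U (\<lambda>j \<mu>. T \<mu> (conn_on S U X (t j) \<mu>)) (\<lambda>\<mu>. T \<mu> (\<tau> X \<mu>)) \<and>
      continuous_on U (\<lambda>\<mu>. T \<mu> (\<tau> X \<mu>))"
    using C1_approx_conns[OF t(1)] by (rule exE)
  then have \<tau>: "\<And>X. X \<in> vect \<A> U \<Longrightarrow> \<tau> X \<in> sections S U"
    "\<And>X. X \<in> vect \<A> U \<Longrightarrow> loc_uniform U (\<lambda>j \<mu>. T \<mu> (conn_on S U X (t j) \<mu>)) (\<lambda>\<mu>. T \<mu> (\<tau> X \<mu>))"
    "\<And>X. X \<in> vect \<A> U \<Longrightarrow> continuous_on U (\<lambda>\<mu>. T \<mu> (\<tau> X \<mu>))"
    by (simp_all only:)
  define g where "g X = (\<lambda>\<mu>. ?c (\<psi> X) \<sigma> \<mu> + ?c \<phi> (\<tau> (vf_cnj X)) \<mu>)" for X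
  have diff: "differentiable_at (sec_inner S (s j) (t j)) \<mu>" for j \<mu>
    using sec_inner_smooth[OF s'(1) t'(1)] unfolding smooth_map_iff
    by (blast intro: Ck_map_differentiable_at)
  have lim: "(\<lambda>j. sec_inner S (s j) (t j) \<mu>) \<longlonglongrightarrow> sec_inner S \<phi> \<sigma> \<mu>" if "\<mu> \<in> U" for \<mu>
    using loc_uniform_tendsto[OF s'(2) that] loc_uniform_tendsto[OF t'(2) that]
    unfolding sec[OF sU tU that] sec[OF s(2) t(2) that]
    by (rule bounded_bilinear.tendsto[OF bounded_bilinear_cinner])
  have D: "loc_uniform U (\<lambda>j. vf_apply \<A> X (sec_inner S (s j) (t j))) (g X)" if X: "X \<in> vect \<A> U" for X
  proof (rule loc_uniform_cong)
    show "loc_uniform U (\<lambda>j \<mu>. ?c (conn_on S U X (s j)) (t j) \<mu> + ?c (s j) (conn_on S U (vf_cnj X) (t j)) \<mu>) (g X)"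
      unfolding g_def
      by (intro loc_uniform_add loc_uniform_bilinear[OF bounded_bilinear_cinner] open_U
          \<psi>(2,3) \<tau>(2,3) s'(2,3) t'(2,3) X cnj)
    show "?c (conn_on S U X (s j)) (t j) \<mu> + ?c (s j) (conn_on S U (vf_cnj X) (t j)) \<mu> =
        vf_apply \<A> X (sec_inner S (s j) (t j)) \<mu>" if "\<mu> \<in> U" for j \<mu>
      unfolding conn_on_metric[OF X that s'(1) t'(1)] sec[OF cU[OF X s'(1)] tU that]
        sec[OF sU cU[OF cnj[OF X] t'(1)] that] ..
  qed simp
  show "differentiable_at (sec_inner S \<phi> \<sigma>) \<xi>"
    by (rule vf_apply_limit(1)[OF open_U diff lim D \<xi>])
  show "vf_apply \<A> X (sec_inner S \<phi> \<sigma>) \<xi> = finner S v (\<sigma> \<xi>) + finner S (\<phi> \<xi>) w"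
    if X: "X \<in> vect \<A> U" and vw: "v \<in> fiber S \<xi>" "w \<in> fiber S \<xi>"
      and v: "(\<lambda>j. T \<xi> (conn_on S U X (s j) \<xi>)) \<longlonglongrightarrow> T \<xi> v"
      and w: "(\<lambda>j. T \<xi> (conn_on S U (vf_cnj X) (t j) \<xi>)) \<longlonglongrightarrow> T \<xi> w"
  proof -
    have "T \<xi> (\<psi> X \<xi>) = T \<xi> v" by (rule LIMSEQ_unique[OF loc_uniform_tendsto[OF \<psi>(2)[OF X] \<xi>] v])
    moreover have "T \<xi> (\<tau> (vf_cnj X) \<xi>) = T \<xi> w"
      by (rule LIMSEQ_unique[OF loc_uniform_tendsto[OF \<tau>(2)[OF cnj[OF X]] \<xi>] w])
    moreover have "vf_apply \<A> X (sec_inner S \<phi> \<sigma>) \<xi> = g X \<xi>"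
      by (rule vf_apply_limit(2)[OF open_U diff lim D \<xi> X])
    ultimately show ?thesis
      using vw s(2) t(2) \<xi> by (simp add: g_def sections_def finner_T)
  qed
qed

text \<open>
  Independence of the approximating sequence. In the product rule for \<open>\<phi>\<close> and a smooth section \<open>\<omega>\<close>, all
  terms but one depend on \<open>\<phi>\<close> and \<open>\<omega>\<close> alone; hence so does the product of the limit with \<open>\<omega>(\<xi>)\<close>, and
  the values of smooth sections are dense.
\<close>

lemma conn_ext_limit:
  assumes s: "C1_approx S U s \<phi>" and \<phi>: "\<phi> \<in> sections S U" and X: "X \<in> vect \<A> U" and \<xi>: "\<xi> \<in> U"
  shows "conn_ext S U X \<phi> \<xi> \<in> fiber S \<xi>"
    and "(\<lambda>j. T \<xi> (conn_on S U X (s j) \<xi>)) \<longlonglongrightarrow> T \<xi> (conn_ext S U X \<phi> \<xi>)"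
proof -
  obtain \<psi> where \<psi>: "\<psi> \<in> sections S U" "loc_uniform U (\<lambda>j \<mu>. T \<mu> (conn_on S U X (s j) \<mu>)) (\<lambda>\<mu>. T \<mu> (\<psi> \<mu>))"
    using C1_approx_conn[OF s X] by blast
  have \<psi>\<xi>: "\<psi> \<xi> \<in> fiber S \<xi>" using \<psi>(1) \<xi> by (simp add: sections_def)
  have fd: "(\<lambda>j. fdist S (conn_on S U X (s j) \<xi>) v) \<longlonglongrightarrow> 0 \<longleftrightarrow>
      (\<lambda>j. T \<xi> (conn_on S U X (s j) \<xi>)) \<longlonglongrightarrow> T \<xi> v" if "C1_approx S U s \<phi>" "v \<in> fiber S \<xi>" for s v
    using fdist_T[OF \<xi> values_at_fiber[OF conn_on_values[OF X \<xi> C1_approxD(1)[OF that(1) \<phi>]]] that(2)]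
    by (simp add: tendsto_norm_zero_iff Lim_null[symmetric])
  have lim: "(\<lambda>j. T \<xi> (conn_on S U X (s j) \<xi>)) \<longlonglongrightarrow> T \<xi> (\<psi> \<xi>)"
    by (rule loc_uniform_tendsto[OF \<psi>(2) \<xi>])
  have unique: "v = \<psi> \<xi>" if v: "v \<in> fiber S \<xi>" and s': "C1_approx S U s' \<phi>"
    and lim': "(\<lambda>j. T \<xi> (conn_on S U X (s' j) \<xi>)) \<longlonglongrightarrow> T \<xi> v" for v s'
  proof (rule T_inj[OF \<xi> v \<psi>\<xi>], rule eq_if_products_eq[OF \<xi> T_in[OF \<xi> v] T_in[OF \<xi> \<psi>\<xi>]])
    fix u assume "u \<in> values_at S \<xi>"
    then obtain \<omega> where \<omega>: "\<omega> \<in> ssec S" "\<omega> \<xi> = u" by (rule values_at_cases)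
    let ?w = "conn_on S U (vf_cnj X) \<omega> \<xi>"
    have w: "?w \<in> fiber S \<xi>"
      by (rule values_at_fiber[OF conn_on_values[OF vect_cnj[OF open_U X] \<xi> \<omega>(1)]])
    note rule = product_rule_limit(2)[OF _ \<phi> C1_approx_ssec[OF \<omega>(1)] ssec_sections[OF \<omega>(1)] \<xi> X _ w _ tendsto_const]
    have "finner S v (\<omega> \<xi>) = finner S (\<psi> \<xi>) (\<omega> \<xi>)"
      using rule[OF s' v lim'] rule[OF s \<psi>\<xi> lim] by simp
    then show "cinner (T \<xi> v) (T \<xi> u) = cinner (T \<xi> (\<psi> \<xi>)) (T \<xi> u)"
      using finner_T[OF \<xi> v ssec_fiber[OF \<omega>(1)]] finner_T[OF \<xi> \<psi>\<xi> ssec_fiber[OF \<omega>(1)]] \<omega>(2) by simp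
  qed
  have "conn_ext S U X \<phi> \<xi> = \<psi> \<xi>"
    unfolding conn_ext_def using \<psi>\<xi> s lim unique fd by (intro the_equality) blast+
  then show "conn_ext S U X \<phi> \<xi> \<in> fiber S \<xi>"
    and "(\<lambda>j. T \<xi> (conn_on S U X (s j) \<xi>)) \<longlonglongrightarrow> T \<xi> (conn_ext S U X \<phi> \<xi>)"
    using \<psi>\<xi> lim by simp_all
qed

lemma conn_ext_ssec:
  assumes "\<phi> \<in> ssec S" and "X \<in> vect \<A> U" and "\<xi> \<in> U"
  shows "conn_ext S U X \<phi> \<xi> = conn_on S U X \<phi> \<xi>"
proof (rule T_inj[OF assms(3)])
  note l = conn_ext_limit[OF C1_approx_ssec[OF assms(1)] ssec_sections[OF assms(1)] assms(2,3)]
  show "conn_ext S U X \<phi> \<xi> \<in> fiber S \<xi>" by (rule l(1))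
  show "conn_on S U X \<phi> \<xi> \<in> fiber S \<xi>"
    by (rule values_at_fiber[OF conn_on_values[OF assms(2,3,1)]])
  show "T \<xi> (conn_ext S U X \<phi> \<xi>) = T \<xi> (conn_on S U X \<phi> \<xi>)"
    by (rule LIMSEQ_unique[OF l(2) tendsto_const])
qed

lemma product_rule:
  assumes "C1_section \<phi>" and "C1_section \<sigma>" and \<xi>: "\<xi> \<in> U"
  shows "differentiable_at (sec_inner S \<phi> \<sigma>) \<xi>"
    and "X \<in> vect \<A> U \<Longrightarrow> vf_apply \<A> X (sec_inner S \<phi> \<sigma>) \<xi> =
      finner S (conn_ext S U X \<phi> \<xi>) (\<sigma> \<xi>) + finner S (\<phi> \<xi>) (conn_ext S U (vf_cnj X) \<sigma> \<xi>)"
proof -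
  obtain s t where s: "C1_approx S U s \<phi>" "\<phi> \<in> sections S U" and t: "C1_approx S U t \<sigma>" "\<sigma> \<in> sections S U"
    using assms by (auto simp: C1_section_def)
  show "differentiable_at (sec_inner S \<phi> \<sigma>) \<xi>" by (rule product_rule_limit(1)[OF s t \<xi>])
  show "vf_apply \<A> X (sec_inner S \<phi> \<sigma>) \<xi> =
      finner S (conn_ext S U X \<phi> \<xi>) (\<sigma> \<xi>) + finner S (\<phi> \<xi>) (conn_ext S U (vf_cnj X) \<sigma> \<xi>)"
    if X: "X \<in> vect \<A> U"
    using conn_ext_limit[OF s X \<xi>] conn_ext_limit[OF t vect_cnj[OF open_U X] \<xi>]
    by (intro product_rule_limit(2)[OF s t \<xi> X])
qed

lemma Gamma_inf_C1_section: "\<phi> \<in> Gamma_inf S U \<Longrightarrow> C1_section \<phi>"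
proof -
  assume "\<phi> \<in> Gamma_inf S U"
  then have "\<phi> \<in> Gamma_n S U (Suc 0)" unfolding Gamma_inf_def by blast
  then show "C1_section \<phi>" by (simp add: C1_section_def)
qed

lemma Gamma_inf_fiber: "\<phi> \<in> Gamma_inf S U \<Longrightarrow> \<xi> \<in> U \<Longrightarrow> \<phi> \<xi> \<in> fiber S \<xi>"
  using Gamma_inf_C1_section by (auto simp: C1_section_def sections_def)

lemma Gamma_inf_T_continuous: "\<phi> \<in> Gamma_inf S U \<Longrightarrow> continuous_on U (\<lambda>\<mu>. T \<mu> (\<phi> \<mu>))"
  using Gamma_inf_C1_section C1_approxD(3) unfolding C1_section_def by blast

lemma Gamma_inf_conn_ext:
  assumes \<phi>: "\<phi> \<in> Gamma_inf S U" and X: "X \<in> vect \<A> U"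
  shows "conn_ext S U X \<phi> \<in> Gamma_inf S U"
proof -
  have Suc: "conn_ext S U X \<phi> \<in> Gamma_n S U (Suc n)" for n
  proof -
    have "\<phi> \<in> Gamma_n S U (Suc (Suc n))" using \<phi> unfolding Gamma_inf_def by blast
    then show ?thesis using X by simp
  qed
  moreover have "conn_ext S U X \<phi> \<in> Gamma_n S U 0" using Suc[of 0] by simp
  ultimately have "conn_ext S U X \<phi> \<in> Gamma_n S U n" for n by (cases n) simp_all
  then show ?thesis by (simp add: Gamma_inf_def)
qed


subsection \<open>Fields of operators with a smooth adjoint\<close>

text \<open>
  The type of operator field that is preserved by \<open>op_conn\<close>: \<open>\<sigma>\<close> is the adjoint on constant sections. The
  adjoint relation concerns values of smooth sections only, where \<open>op_conn\<close> is meaningful.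
\<close>

definition smooth_adjoint :: "('m \<Rightarrow> 'h \<Rightarrow> 'k) \<Rightarrow> ('k \<Rightarrow> 'm \<Rightarrow> 'h) \<Rightarrow> bool" where
  "smooth_adjoint A \<sigma> \<longleftrightarrow>
     (\<forall>\<phi>\<in>ssec S. op_apply A \<phi> \<in> smooth_maps \<A> U K) \<and>
     (\<forall>x\<in>K. \<sigma> x \<in> Gamma_inf S U) \<and>
     (\<forall>\<xi>\<in>U. \<forall>v\<in>values_at S \<xi>. \<forall>x\<in>K. cinner (A \<xi> v) x = finner S v (\<sigma> x \<xi>))"

lemma smooth_adjointD:
  assumes "smooth_adjoint A \<sigma>"
  shows "\<phi> \<in> ssec S \<Longrightarrow> smooth_map \<A> U (\<lambda>\<mu>. A \<mu> (\<phi> \<mu>))"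
    and "x \<in> K \<Longrightarrow> \<sigma> x \<in> Gamma_inf S U"
    and "\<xi> \<in> U \<Longrightarrow> v \<in> values_at S \<xi> \<Longrightarrow> x \<in> K \<Longrightarrow> cinner (A \<xi> v) x = cinner (T \<xi> v) (T \<xi> (\<sigma> x \<xi>))"
    and "\<xi> \<in> U \<Longrightarrow> v \<in> values_at S \<xi> \<Longrightarrow> A \<xi> v \<in> K"
proof -
  show "smooth_map \<A> U (\<lambda>\<mu>. A \<mu> (\<phi> \<mu>))" if "\<phi> \<in> ssec S"
    using assms that by (simp add: smooth_adjoint_def smooth_maps_def op_apply_def)
  show \<sigma>: "\<sigma> x \<in> Gamma_inf S U" if "x \<in> K" for x using assms that by (simp add: smooth_adjoint_def)
  show "cinner (A \<xi> v) x = cinner (T \<xi> v) (T \<xi> (\<sigma> x \<xi>))" if "\<xi> \<in> U" "v \<in> values_at S \<xi>" "x \<in> K"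
    using assms that finner_T[OF that(1) values_at_fiber[OF that(2)] Gamma_inf_fiber[OF \<sigma>[OF that(3)] that(1)]]
    by (simp add: smooth_adjoint_def)
  show "A \<xi> v \<in> K" if "\<xi> \<in> U" and v: "v \<in> values_at S \<xi>"
  proof -
    obtain \<phi> where "\<phi> \<in> ssec S" "\<phi> \<xi> = v" using v by (rule values_at_cases)
    then show ?thesis
      using assms that(1) by (auto simp: smooth_adjoint_def smooth_maps_def op_apply_def)
  qed
qed

lemma adj_field_T:
  assumes \<xi>: "\<xi> \<in> U" and x: "x \<in> K"
  shows "adj_field S T \<xi> x \<in> fiber S \<xi>" and "T \<xi> (adj_field S T \<xi> x) = x"
proof -
  obtain v where v: "v \<in> fiber S \<xi>" "T \<xi> v = x" using T_surj[OF assms] by blast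
  have "adj_field S T \<xi> x = v"
    unfolding adj_field_def
  proof (rule the_equality)
    show "v \<in> fiber S \<xi> \<and> (\<forall>u\<in>fiber S \<xi>. cinner (T \<xi> u) x = finner S u v)"
      using v finner_T[OF \<xi>] by auto
    fix w assume w: "w \<in> fiber S \<xi> \<and> (\<forall>u\<in>fiber S \<xi>. cinner (T \<xi> u) x = finner S u w)"
    show "w = v"
    proof (rule T_inj[OF \<xi>], rule_tac [3] cinner_eqI[OF K])
      fix z assume "z \<in> K"
      then obtain u where u: "u \<in> fiber S \<xi>" "T \<xi> u = z" using T_surj[OF \<xi>] by blast
      then have "cinner z (T \<xi> w) = cinner z (T \<xi> v)" using w v finner_T[OF \<xi>, of u w] finner_T[OF \<xi>, of u v] by auto
      then show "cinner (T \<xi> w) z = cinner (T \<xi> v) z" by (metis cinner_commute)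
    qed (use v w T_in[OF \<xi>] in auto)
  qed
  then show "adj_field S T \<xi> x \<in> fiber S \<xi>" and "T \<xi> (adj_field S T \<xi> x) = x" using v by simp_all
qed

lemma smooth_adjoint_T: "smooth_adjoint T (\<lambda>x. op_apply (adj_field S T) (\<lambda>_. x))"
  unfolding smooth_adjoint_def
proof (intro conjI ballI)
  fix \<xi> v x assume a: "\<xi> \<in> U" "v \<in> values_at S \<xi>" "x \<in> K"
  show "cinner (T \<xi> v) x = finner S v (op_apply (adj_field S T) (\<lambda>_. x) \<xi>)"
    using adj_field_T[OF a(1,3)] finner_T[OF a(1) values_at_fiber[OF a(2)]] by (simp add: op_apply_def)
qed (use T_smooth adj_T_smooth in auto)

lemma smooth_adjoint_sec_inner:
  assumes A: "smooth_adjoint A \<sigma>" and \<phi>: "\<phi> \<in> ssec S" and x: "x \<in> K" and \<mu>: "\<mu> \<in> U"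
  shows "sec_inner S \<phi> (\<sigma> x) \<mu> = cinner (A \<mu> (\<phi> \<mu>)) x"
  using smooth_adjointD(3)[OF A \<mu> values_at_ssec[OF \<phi>] x]
    finner_T[OF \<mu> ssec_fiber[OF \<phi>] Gamma_inf_fiber[OF smooth_adjointD(2)[OF A x] \<mu>]]
  by (simp add: sec_inner_def)

text \<open>
  Paired with \<open>x\<close>, the defining expression becomes the product rule for \<open>\<phi>\<close> and \<open>\<sigma> x\<close>. What remains
  depends on \<open>\<phi>\<close> only through its value at \<open>\<xi>\<close>, so the definite description denotes.
\<close>

lemma op_conn_eq:
  assumes A: "smooth_adjoint A \<sigma>" and X: "X \<in> vect \<A> U" and \<phi>: "\<phi> \<in> ssec S" and \<xi>: "\<xi> \<in> U"
  shows "op_conn S U X A \<xi> (\<phi> \<xi>) = vf_apply \<A> X (\<lambda>\<mu>. A \<mu> (\<phi> \<mu>)) \<xi> - A \<xi> (conn_on S U X \<phi> \<xi>)"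
    and "op_conn S U X A \<xi> (\<phi> \<xi>) \<in> K"
    and "x \<in> K \<Longrightarrow> cinner (op_conn S U X A \<xi> (\<phi> \<xi>)) x = finner S (\<phi> \<xi>) (conn_ext S U (vf_cnj X) (\<sigma> x) \<xi>)"
proof -
  define W where "W \<phi> = vf_apply \<A> X (\<lambda>\<mu>. A \<mu> (\<phi> \<mu>)) \<xi> - A \<xi> (conn_on S U X \<phi> \<xi>)" for \<phi>
  have diff: "differentiable_at (\<lambda>\<mu>. A \<mu> (\<phi> \<mu>)) \<xi>" if "\<phi> \<in> ssec S" for \<phi>
    using smooth_adjointD(1)[OF A that] \<xi> unfolding smooth_map_iff by (blast intro: Ck_map_differentiable_at)
  have WK: "W \<phi> \<in> K" if \<phi>: "\<phi> \<in> ssec S" for \<phi>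
    unfolding W_def
    using smooth_adjointD(4)[OF A _ values_at_ssec[OF \<phi>]]
    by (intro closed_csubspace_diff[OF K] closed_csubspace_vf_apply[OF K open_U X \<xi> diff[OF \<phi>]]
        smooth_adjointD(4)[OF A \<xi> conn_on_values[OF X \<xi> \<phi>]]) auto
  have Wx: "cinner (W \<phi>) x = finner S (\<phi> \<xi>) (conn_ext S U (vf_cnj X) (\<sigma> x) \<xi>)"
    if \<phi>: "\<phi> \<in> ssec S" and x: "x \<in> K" for \<phi> x
  proof -
    let ?n = "conn_on S U X \<phi> \<xi>"
    note C1 = C1_section_ssec[OF \<phi>] Gamma_inf_C1_section[OF smooth_adjointD(2)[OF A x]]
    have "cinner (vf_apply \<A> X (\<lambda>\<mu>. A \<mu> (\<phi> \<mu>)) \<xi>) x = vf_apply \<A> X (\<lambda>\<mu>. cinner (A \<mu> (\<phi> \<mu>)) x) \<xi>"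
      by (rule vf_apply_cinner[OF X \<xi> diff[OF \<phi>], symmetric])
    also have "\<dots> = vf_apply \<A> X (sec_inner S \<phi> (\<sigma> x)) \<xi>"
      by (rule vf_apply_fun_cong(2)[OF open_U \<xi> _ product_rule(1)[OF C1 \<xi>] X \<xi>, symmetric])
        (rule smooth_adjoint_sec_inner[OF A \<phi> x])
    also have "\<dots> = finner S ?n (\<sigma> x \<xi>) + finner S (\<phi> \<xi>) (conn_ext S U (vf_cnj X) (\<sigma> x) \<xi>)"
      using product_rule(2)[OF C1 \<xi> X] conn_ext_ssec[OF \<phi> X \<xi>] by simp
    also have "finner S ?n (\<sigma> x \<xi>) = cinner (A \<xi> ?n) x"
      using smooth_adjointD(3)[OF A \<xi> conn_on_values[OF X \<xi> \<phi>] x]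
        finner_T[OF \<xi> values_at_fiber[OF conn_on_values[OF X \<xi> \<phi>]]
          Gamma_inf_fiber[OF smooth_adjointD(2)[OF A x] \<xi>]] by simp
    finally show ?thesis by (simp add: W_def cinner_diff_left)
  qed
  have "op_conn S U X A \<xi> (\<phi> \<xi>) = W \<phi>"
    unfolding op_conn_def
  proof (rule the_equality)
    show "\<exists>\<phi>'\<in>ssec S. \<phi>' \<xi> = \<phi> \<xi> \<and> W \<phi> = vf_apply \<A> X (op_apply A \<phi>') \<xi> - A \<xi> (conn_on S U X \<phi>' \<xi>)"
      using \<phi> by (auto simp: W_def op_apply_def)
    fix w assume "\<exists>\<phi>'\<in>ssec S. \<phi>' \<xi> = \<phi> \<xi> \<and> w = vf_apply \<A> X (op_apply A \<phi>') \<xi> - A \<xi> (conn_on S U X \<phi>' \<xi>)"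
    then obtain \<phi>' where \<phi>': "\<phi>' \<in> ssec S" "\<phi>' \<xi> = \<phi> \<xi>" "w = W \<phi>'" by (auto simp: W_def op_apply_def)
    show "w = W \<phi>"
      unfolding \<phi>'(3) by (rule cinner_eqI[OF K WK[OF \<phi>'(1)] WK[OF \<phi>]]) (simp add: Wx \<phi> \<phi>')
  qed
  then show "op_conn S U X A \<xi> (\<phi> \<xi>) = vf_apply \<A> X (\<lambda>\<mu>. A \<mu> (\<phi> \<mu>)) \<xi> - A \<xi> (conn_on S U X \<phi> \<xi>)"
    and "op_conn S U X A \<xi> (\<phi> \<xi>) \<in> K"
    and "x \<in> K \<Longrightarrow> cinner (op_conn S U X A \<xi> (\<phi> \<xi>)) x = finner S (\<phi> \<xi>) (conn_ext S U (vf_cnj X) (\<sigma> x) \<xi>)"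
    using W_def WK[OF \<phi>] Wx[OF \<phi>] by simp_all
qed

lemma smooth_adjoint_op_conn:
  assumes A: "smooth_adjoint A \<sigma>" and X: "X \<in> vect \<A> U"
  shows "smooth_adjoint (op_conn S U X A) (\<lambda>x. conn_ext S U (vf_cnj X) (\<sigma> x))"
  unfolding smooth_adjoint_def
proof (intro conjI ballI)
  fix \<phi> assume \<phi>: "\<phi> \<in> ssec S"
  \<comment> \<open>The derivative of a smooth section along a field on U agrees near every point with a smooth section.\<close>
  have "Ck_map n U (\<lambda>\<mu>. A \<mu> (conn_on S U X \<phi> \<mu>))" for n
  proof (rule Ck_map_local)
    fix \<xi> assume \<xi>: "\<xi> \<in> U"
    show "\<exists>V. open V \<and> \<xi> \<in> V \<and> Ck_map n V (\<lambda>\<mu>. A \<mu> (conn_on S U X \<phi> \<mu>))"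
    proof (rule conn_on_local[OF X \<xi>])
      fix Y V
      assume Y: "Y \<in> vect \<A> UNIV" "open V" "\<xi> \<in> V" "V \<subseteq> U"
        "\<And>\<phi> \<mu>. \<phi> \<in> ssec S \<Longrightarrow> \<mu> \<in> V \<Longrightarrow> conn_on S U X \<phi> \<mu> = conn S Y \<phi> \<mu>"
      have "Ck_map n V (\<lambda>\<mu>. A \<mu> (conn S Y \<phi> \<mu>))"
        using smooth_adjointD(1)[OF A ssec_conn[OF \<phi> Y(1)]] Y(4)
        by (auto simp: smooth_map_iff intro: Ck_map_subset)
      then have "Ck_map n V (\<lambda>\<mu>. A \<mu> (conn_on S U X \<phi> \<mu>))"
        by (rule Ck_map_cong[OF Y(2), rotated]) (simp add: Y(5)[OF \<phi>])
      then show ?thesis using Y by blast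
    qed
  qed
  moreover have "Ck_map n U (vf_apply \<A> X (\<lambda>\<mu>. A \<mu> (\<phi> \<mu>)))" for n
    using smooth_map_vf_apply[OF open_U X smooth_adjointD(1)[OF A \<phi>]] by (simp add: smooth_map_iff)
  ultimately have "Ck_map n U (\<lambda>\<mu>. vf_apply \<A> X (\<lambda>\<mu>. A \<mu> (\<phi> \<mu>)) \<mu> - A \<mu> (conn_on S U X \<phi> \<mu>))" for n
    by (intro Ck_map_diff open_U)
  then have "Ck_map n U (op_apply (op_conn S U X A) \<phi>)" for n
    by (rule Ck_map_cong[OF open_U, rotated]) (simp add: op_apply_def op_conn_eq(1)[OF A X \<phi>])
  then show "op_apply (op_conn S U X A) \<phi> \<in> smooth_maps \<A> U K"
    using op_conn_eq(2)[OF A X \<phi>] by (auto simp: smooth_maps_def smooth_map_iff op_apply_def)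
next
  fix x assume "x \<in> K"
  then show "conn_ext S U (vf_cnj X) (\<sigma> x) \<in> Gamma_inf S U"
    by (intro Gamma_inf_conn_ext smooth_adjointD(2)[OF A] vect_cnj[OF open_U X])
next
  fix \<xi> v x assume a: "\<xi> \<in> U" "v \<in> values_at S \<xi>" "x \<in> K"
  obtain \<phi> where "\<phi> \<in> ssec S" "\<phi> \<xi> = v" using a(2) by (rule values_at_cases)
  then show "cinner (op_conn S U X A \<xi> v) x = finner S v (conn_ext S U (vf_cnj X) (\<sigma> x) \<xi>)"
    using op_conn_eq(3)[OF A X _ a(1) a(3)] by blast
qed

lemma smooth_adjoint_op_conns:
  "set Xs \<subseteq> vect \<A> U \<Longrightarrow> \<exists>\<sigma>. smooth_adjoint (op_conns S U Xs T) \<sigma>"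
proof (induction Xs)
  case Nil
  then show ?case using smooth_adjoint_T by (auto simp: op_conns_def)
next
  case (Cons X Xs)
  then obtain \<sigma> where "smooth_adjoint (op_conns S U Xs T) \<sigma>" by auto
  from smooth_adjoint_op_conn[OF this] Cons.prems show ?case by (auto simp: op_conns_def)
qed


subsection \<open>Boundedness and extension to the fibers\<close>

text \<open>
  The argument of Hellinger and Toeplitz: for each \<open>x\<close>, the products \<open>\<langle>A v, x\<rangle> = \<langle>v, \<sigma> x\<rangle>\<close> are bounded for
  \<open>v\<close> in the unit ball, so the vectors \<open>A v\<close> are weakly bounded. Linearity follows from the same identity.
\<close>

lemma smooth_adjoint_bounded:
  assumes A: "smooth_adjoint A \<sigma>"
  shows "bounded_op_field S U K A"
  unfolding bounded_op_field_def
proof (intro ballI conjI allI)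
  fix \<xi> assume \<xi>: "\<xi> \<in> U"
  note AK = smooth_adjointD(4)[OF A \<xi>] and adj = smooth_adjointD(3)[OF A \<xi>]
  note fib = values_at_fiber
  show "A \<xi> v \<in> K" if "v \<in> values_at S \<xi>" for v using AK[OF that] .
  show add: "A \<xi> (fadd S v w) = A \<xi> v + A \<xi> w" if v: "v \<in> values_at S \<xi>" and w: "w \<in> values_at S \<xi>" for v w
    by (rule cinner_eqI[OF K])
      (simp_all add: AK closed_csubspace_add[OF K] values_at_add v w cinner_add_left adj T_add[OF \<xi>] fib)
  show scale: "A \<xi> (fscale S a v) = a *\<^sub>C A \<xi> v" if v: "v \<in> values_at S \<xi>" for a v
    by (rule cinner_eqI[OF K])
      (simp_all add: AK closed_csubspace_scaleC[OF K] values_at_scale v cinner_scaleC_left adj T_scale[OF \<xi>] fib)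
  have "\<exists>C. \<forall>w\<in>{A \<xi> v | v. v \<in> values_at S \<xi> \<and> norm (T \<xi> v) \<le> 1}. norm w \<le> C"
  proof (rule weakly_bounded_imp_bounded[OF _ closed_csubspace_subspace[OF K]])
    show "closed K" using K by (simp add: closed_csubspace_def)
    show "{A \<xi> v | v. v \<in> values_at S \<xi> \<and> norm (T \<xi> v) \<le> 1} \<subseteq> K" using AK by blast
    fix x assume x: "x \<in> K"
    have "\<bar>A \<xi> v \<bullet> x\<bar> \<le> norm (T \<xi> (\<sigma> x \<xi>))" if v: "v \<in> values_at S \<xi>" "norm (T \<xi> v) \<le> 1" for v
    proof -
      have "\<bar>A \<xi> v \<bullet> x\<bar> \<le> cmod (cinner (A \<xi> v) x)" by (simp add: abs_Re_le_cmod flip: Re_cinner)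
      also have "\<dots> \<le> norm (T \<xi> v) * norm (T \<xi> (\<sigma> x \<xi>))" unfolding adj[OF v(1) x] by (rule norm_cinner_le)
      also have "\<dots> \<le> 1 * norm (T \<xi> (\<sigma> x \<xi>))" using v(2) by (rule mult_right_mono) simp
      finally show ?thesis by simp
    qed
    then show "\<exists>C. \<forall>w\<in>{A \<xi> v | v. v \<in> values_at S \<xi> \<and> norm (T \<xi> v) \<le> 1}. \<bar>w \<bullet> x\<bar> \<le> C" by blast
  qed
  then obtain C where C: "\<And>v. v \<in> values_at S \<xi> \<Longrightarrow> norm (T \<xi> v) \<le> 1 \<Longrightarrow> norm (A \<xi> v) \<le> C" by blast
  have "norm (A \<xi> v) \<le> C * fnorm S v" if v: "v \<in> values_at S \<xi>" for v
  proof (cases "T \<xi> v = 0")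
    case True
    have "A \<xi> v = 0"
      by (rule cinner_eqI[OF K AK[OF v]])
        (use K True in \<open>auto simp: adj[OF v] closed_csubspace_def
          bounded_bilinear.zero_left[OF bounded_bilinear_cinner]\<close>)
    then show ?thesis using True fnorm_T[OF \<xi> fib[OF v]] by simp
  next
    case False
    let ?r = "complex_of_real (1 / norm (T \<xi> v))"
    have "norm (T \<xi> (fscale S ?r v)) \<le> 1"
      using False T_scale[OF \<xi> fib[OF v]] by (simp add: norm_scaleC norm_divide)
    from C[OF values_at_scale[OF v] this] have "norm (A \<xi> v) / norm (T \<xi> v) \<le> C"
      by (simp add: scale[OF v] norm_scaleC norm_divide)
    then show ?thesis using False by (simp add: fnorm_T[OF \<xi> fib[OF v]] pos_divide_le_eq)
  qed
  then show "\<exists>C. \<forall>v\<in>values_at S \<xi>. norm (A \<xi> v) \<le> C * fnorm S v" by blast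
qed

text \<open>
  The bound makes \<open>A\<close> Lipschitz on a dense set; it therefore extends, and the adjoint relation passes
  to the limit.
\<close>

lemma op_ext_adjoint:
  assumes A: "smooth_adjoint A \<sigma>" and \<xi>: "\<xi> \<in> U" and v: "v \<in> fiber S \<xi>"
  shows "op_ext S A \<xi> v \<in> K"
    and "x \<in> K \<Longrightarrow> cinner (op_ext S A \<xi> v) x = finner S v (\<sigma> x \<xi>)"
proof -
  note fib = values_at_fiber
  obtain C where add: "\<And>v w. v \<in> values_at S \<xi> \<Longrightarrow> w \<in> values_at S \<xi> \<Longrightarrow> A \<xi> (fadd S v w) = A \<xi> v + A \<xi> w"
    and scale: "\<And>a v. v \<in> values_at S \<xi> \<Longrightarrow> A \<xi> (fscale S a v) = a *\<^sub>C A \<xi> v"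
    and C: "\<And>v. v \<in> values_at S \<xi> \<Longrightarrow> norm (A \<xi> v) \<le> C * fnorm S v"
    using smooth_adjoint_bounded[OF A] \<xi> unfolding bounded_op_field_def by metis
  have lip: "norm (A \<xi> v - A \<xi> w) \<le> \<bar>C\<bar> * norm (T \<xi> v - T \<xi> w)"
    if v: "v \<in> values_at S \<xi>" and w: "w \<in> values_at S \<xi>" for v w
  proof -
    have "norm (A \<xi> v - A \<xi> w) = norm (A \<xi> (fadd S v (fscale S (- 1) w)))"
      by (simp add: add scale v w values_at_scale scaleC_minus_one)
    also have "\<dots> \<le> C * fdist S v w"
      unfolding fdist_def by (intro C values_at_add values_at_scale v w)
    also have "\<dots> \<le> \<bar>C\<bar> * norm (T \<xi> v - T \<xi> w)"
      unfolding fdist_T[OF \<xi> fib[OF v] fib[OF w]] by (intro mult_right_mono) auto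
    finally show ?thesis .
  qed
  obtain s where s: "\<And>n::nat. s n \<in> values_at S \<xi>" "(\<lambda>n. T \<xi> (s n)) \<longlonglongrightarrow> T \<xi> v"
    using values_at_dense[OF \<xi> v] by blast
  have "Cauchy (\<lambda>n. A \<xi> (s n))"
  proof (rule CauchyI)
    fix e :: real assume e: "e > 0"
    then obtain M where M: "\<And>m n. m \<ge> M \<Longrightarrow> n \<ge> M \<Longrightarrow> norm (T \<xi> (s m) - T \<xi> (s n)) < e / (\<bar>C\<bar> + 1)"
      using CauchyD[OF LIMSEQ_imp_Cauchy[OF s(2)], of "e / (\<bar>C\<bar> + 1)"] by (auto simp: add_nonneg_pos)
    have "norm (A \<xi> (s m) - A \<xi> (s n)) < e" if "m \<ge> M" "n \<ge> M" for m n
    proof -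
      have "norm (A \<xi> (s m) - A \<xi> (s n)) \<le> \<bar>C\<bar> * norm (T \<xi> (s m) - T \<xi> (s n))" by (rule lip[OF s(1) s(1)])
      also have "\<dots> \<le> \<bar>C\<bar> * (e / (\<bar>C\<bar> + 1))" using M[OF that] by (intro mult_left_mono) auto
      also have "\<dots> < e" using e by (simp add: field_simps add_nonneg_pos)
      finally show ?thesis .
    qed
    then show "\<exists>M. \<forall>m\<ge>M. \<forall>n\<ge>M. norm (A \<xi> (s m) - A \<xi> (s n)) < e" by blast
  qed
  then obtain w where w: "(\<lambda>n. A \<xi> (s n)) \<longlonglongrightarrow> w" using Cauchy_convergent convergent_def by blast
  have fd: "(\<lambda>n. fdist S (t n) v) \<longlonglongrightarrow> 0 \<longleftrightarrow> (\<lambda>n. T \<xi> (t n)) \<longlonglongrightarrow> T \<xi> v"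
    if "\<And>n. t n \<in> values_at S \<xi>" for t :: "nat \<Rightarrow> 'h"
    using fdist_T[OF \<xi> fib[OF that] v] by (simp add: tendsto_norm_zero_iff Lim_null[symmetric])
  have "op_ext S A \<xi> v = w"
    unfolding op_ext_def
  proof (rule the_equality)
    show "\<forall>t. (\<forall>n. t n \<in> values_at S \<xi>) \<and> (\<lambda>n. fdist S (t n) v) \<longlonglongrightarrow> 0 \<longrightarrow> (\<lambda>n. A \<xi> (t n)) \<longlonglongrightarrow> w"
    proof (intro allI impI, elim conjE)
      fix t assume t: "\<forall>n. t n \<in> values_at S \<xi>" "(\<lambda>n. fdist S (t n) v) \<longlonglongrightarrow> 0"
      have "(\<lambda>n. T \<xi> (t n) - T \<xi> (s n)) \<longlonglongrightarrow> T \<xi> v - T \<xi> v"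
        using t fd by (intro tendsto_diff s(2)) auto
      then have "(\<lambda>n. \<bar>C\<bar> * norm (T \<xi> (t n) - T \<xi> (s n))) \<longlonglongrightarrow> 0"
        by (intro tendsto_mult_right_zero tendsto_norm_zero) simp
      then have "(\<lambda>n. A \<xi> (t n) - A \<xi> (s n)) \<longlonglongrightarrow> 0"
        by (rule Lim_null_comparison[rotated]) (use lip t(1) s(1) in \<open>auto intro: always_eventually\<close>)
      from tendsto_add[OF this w] show "(\<lambda>n. A \<xi> (t n)) \<longlonglongrightarrow> w" by simp
    qed
    fix w' assume "\<forall>t. (\<forall>n. t n \<in> values_at S \<xi>) \<and> (\<lambda>n. fdist S (t n) v) \<longlonglongrightarrow> 0 \<longrightarrow> (\<lambda>n. A \<xi> (t n)) \<longlonglongrightarrow> w'"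
    then have "(\<lambda>n. A \<xi> (s n)) \<longlonglongrightarrow> w'" using s fd by blast
    then show "w' = w" using w LIMSEQ_unique by blast
  qed
  note ext = this
  have "w \<in> K"
    using K w smooth_adjointD(4)[OF A \<xi> s(1)] closed_sequentially unfolding closed_csubspace_def by metis
  with ext show "op_ext S A \<xi> v \<in> K" by simp
  show "cinner (op_ext S A \<xi> v) x = finner S v (\<sigma> x \<xi>)" if x: "x \<in> K"
  proof -
    have "(\<lambda>n. cinner (A \<xi> (s n)) x) \<longlonglongrightarrow> cinner w x"
      by (rule bounded_linear.tendsto[OF bounded_linear_cinner_left w])
    moreover have "(\<lambda>n. cinner (A \<xi> (s n)) x) \<longlonglongrightarrow> cinner (T \<xi> v) (T \<xi> (\<sigma> x \<xi>))"
      unfolding smooth_adjointD(3)[OF A \<xi> s(1) x]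
      by (rule bounded_linear.tendsto[OF bounded_linear_cinner_left s(2)])
    ultimately have "cinner w x = cinner (T \<xi> v) (T \<xi> (\<sigma> x \<xi>))" by (rule LIMSEQ_unique)
    then show ?thesis
      using ext finner_T[OF \<xi> v Gamma_inf_fiber[OF smooth_adjointD(2)[OF A x] \<xi>]] by simp
  qed
qed

lemma op_ext_T:
  assumes \<xi>: "\<xi> \<in> U" and v: "v \<in> fiber S \<xi>"
  shows "op_ext S T \<xi> v = T \<xi> v"
proof (rule cinner_eqI[OF K])
  note ext = op_ext_adjoint[OF smooth_adjoint_T \<xi> v]
  show "op_ext S T \<xi> v \<in> K" by (rule ext(1))
  show "T \<xi> v \<in> K" by (rule T_in[OF \<xi> v])
  show "cinner (op_ext S T \<xi> v) x = cinner (T \<xi> v) x" if "x \<in> K" for x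
    using ext(2)[OF that] adj_field_T[OF \<xi> that] by (simp add: op_apply_def finner_T[OF \<xi> v])
qed

text \<open>
  This is the product rule for \<open>\<phi>\<close> and \<open>\<sigma> x\<close>, with each of its terms rewritten by the adjoint relation
  of \<open>A\<close> or of \<open>op_conn S U X A\<close>.
\<close>

lemma weak_derivative_op_ext:
  assumes A: "smooth_adjoint A \<sigma>" and \<phi>: "\<phi> \<in> Gamma_inf S U" and x: "x \<in> K" and \<xi>: "\<xi> \<in> U"
  shows "differentiable_at (\<lambda>\<mu>. cinner (op_ext S A \<mu> (\<phi> \<mu>)) x) \<xi>"
    and "X \<in> vect \<A> U \<Longrightarrow> vf_apply \<A> X (\<lambda>\<mu>. cinner (op_ext S A \<mu> (\<phi> \<mu>)) x) \<xi> =
      cinner (op_ext S (op_conn S U X A) \<xi> (\<phi> \<xi>) + op_ext S A \<xi> (conn_ext S U X \<phi> \<xi>)) x"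
proof -
  have eq: "sec_inner S \<phi> (\<sigma> x) \<mu> = cinner (op_ext S A \<mu> (\<phi> \<mu>)) x" if "\<mu> \<in> U" for \<mu>
    using op_ext_adjoint(2)[OF A that Gamma_inf_fiber[OF \<phi> that] x] by (simp add: sec_inner_def)
  note C1 = Gamma_inf_C1_section[OF \<phi>] Gamma_inf_C1_section[OF smooth_adjointD(2)[OF A x]]
  note cong = vf_apply_fun_cong[OF open_U \<xi> _ product_rule(1)[OF C1 \<xi>]]
  show "differentiable_at (\<lambda>\<mu>. cinner (op_ext S A \<mu> (\<phi> \<mu>)) x) \<xi>" by (rule cong(1)[OF eq])
  assume X: "X \<in> vect \<A> U"
  have "vf_apply \<A> X (\<lambda>\<mu>. cinner (op_ext S A \<mu> (\<phi> \<mu>)) x) \<xi> =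
      finner S (conn_ext S U X \<phi> \<xi>) (\<sigma> x \<xi>) + finner S (\<phi> \<xi>) (conn_ext S U (vf_cnj X) (\<sigma> x) \<xi>)"
    using cong(2)[OF eq X \<xi>] product_rule(2)[OF C1 \<xi> X] by simp
  also have "\<dots> = cinner (op_ext S A \<xi> (conn_ext S U X \<phi> \<xi>)) x + cinner (op_ext S (op_conn S U X A) \<xi> (\<phi> \<xi>)) x"
    using op_ext_adjoint(2)[OF A \<xi> Gamma_inf_fiber[OF Gamma_inf_conn_ext[OF \<phi> X] \<xi>] x]
      op_ext_adjoint(2)[OF smooth_adjoint_op_conn[OF A X] \<xi> Gamma_inf_fiber[OF \<phi> \<xi>] x] by simp
  finally show "vf_apply \<A> X (\<lambda>\<mu>. cinner (op_ext S A \<mu> (\<phi> \<mu>)) x) \<xi> =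
      cinner (op_ext S (op_conn S U X A) \<xi> (\<phi> \<xi>) + op_ext S A \<xi> (conn_ext S U X \<phi> \<xi>)) x"
    by (simp add: cinner_add_left)
qed


subsection \<open>Smoothness criteria\<close>

lemma op_ext_Ck_map_Suc:
  assumes A: "smooth_adjoint A \<sigma>" and \<phi>: "\<phi> \<in> Gamma_inf S U"
    and "\<And>X. X \<in> vect \<A> U \<Longrightarrow> Ck_map n U (\<lambda>\<mu>. op_ext S (op_conn S U X A) \<mu> (\<phi> \<mu>))"
    and "\<And>X. X \<in> vect \<A> U \<Longrightarrow> Ck_map n U (\<lambda>\<mu>. op_ext S A \<mu> (conn_ext S U X \<phi> \<mu>))"
  shows "Ck_map (Suc n) U (\<lambda>\<mu>. op_ext S A \<mu> (\<phi> \<mu>))"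
proof (rule Ck_map_Suc_weak[OF open_U K])
  let ?g = "\<lambda>X \<mu>. op_ext S (op_conn S U X A) \<mu> (\<phi> \<mu>) + op_ext S A \<mu> (conn_ext S U X \<phi> \<mu>)"
  show "(\<lambda>\<mu>. op_ext S A \<mu> (\<phi> \<mu>)) ` U \<subseteq> K"
    using op_ext_adjoint(1)[OF A _ Gamma_inf_fiber[OF \<phi>]] by blast
  show "?g X ` U \<subseteq> K" if X: "X \<in> vect \<A> U" for X
    using op_ext_adjoint(1)[OF A _ Gamma_inf_fiber[OF Gamma_inf_conn_ext[OF \<phi> X]]]
      op_ext_adjoint(1)[OF smooth_adjoint_op_conn[OF A X] _ Gamma_inf_fiber[OF \<phi>]]
    by (auto intro!: closed_csubspace_add[OF K])
  show "Ck_map n U (?g X)" if "X \<in> vect \<A> U" for X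
    by (intro Ck_map_add[OF open_U] assms(3,4) that)
qed (use weak_derivative_op_ext[OF A \<phi>] in auto)

text \<open>
  Once \<open>A\<phi>\<close> is differentiable, its weak derivative is the derivative. So \<open>\<nabla>\<^sub>X(A)\<phi>\<close> equals
  \<open>X(A\<phi>) - A\<nabla>\<^sub>X\<phi>\<close>, and both terms are smooth by induction.
\<close>

lemma smooth_imp_op_ext_smooth:
  assumes T: "\<And>\<phi>. \<phi> \<in> Gamma_inf S U \<Longrightarrow> smooth_map \<A> U (\<lambda>\<mu>. T \<mu> (\<phi> \<mu>))"
    and "set Xs \<subseteq> vect \<A> U" and "\<phi> \<in> Gamma_inf S U"
  shows "smooth_map \<A> U (\<lambda>\<mu>. op_ext S (op_conns S U Xs T) \<mu> (\<phi> \<mu>))"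
  using assms(2,3)
proof (induction Xs arbitrary: \<phi>)
  case Nil
  show ?case
    unfolding smooth_map_iff
  proof
    fix n
    have "Ck_map n U (\<lambda>\<mu>. T \<mu> (\<phi> \<mu>))" using T[OF Nil.prems(2)] by (simp add: smooth_map_iff)
    then show "Ck_map n U (\<lambda>\<mu>. op_ext S (op_conns S U [] T) \<mu> (\<phi> \<mu>))"
      by (rule Ck_map_cong[OF open_U, rotated])
        (simp add: op_conns_def op_ext_T Gamma_inf_fiber[OF Nil.prems(2)])
  qed
next
  case (Cons X Xs)
  let ?A = "op_conns S U Xs T"
  have X: "X \<in> vect \<A> U" and Xs: "set Xs \<subseteq> vect \<A> U" using Cons.prems by auto
  obtain \<sigma> where A: "smooth_adjoint ?A \<sigma>" using smooth_adjoint_op_conns[OF Xs] by blast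
  note \<phi> = Cons.prems(2)
  let ?f = "\<lambda>\<mu>. op_ext S ?A \<mu> (\<phi> \<mu>)" and ?h = "\<lambda>\<mu>. op_ext S ?A \<mu> (conn_ext S U X \<phi> \<mu>)"
  have f: "smooth_map \<A> U ?f" by (rule Cons.IH[OF Xs \<phi>])
  have h: "smooth_map \<A> U ?h" by (rule Cons.IH[OF Xs Gamma_inf_conn_ext[OF \<phi> X]])
  have eq: "vf_apply \<A> X ?f \<xi> - ?h \<xi> = op_ext S (op_conn S U X ?A) \<xi> (\<phi> \<xi>)" if \<xi>: "\<xi> \<in> U" for \<xi>
  proof (rule cinner_eqI[OF K])
    have df: "differentiable_at ?f \<xi>"
      using f \<xi> unfolding smooth_map_iff by (blast intro: Ck_map_differentiable_at)
    show "vf_apply \<A> X ?f \<xi> - ?h \<xi> \<in> K"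
      using op_ext_adjoint(1)[OF A _ Gamma_inf_fiber[OF \<phi>]]
        op_ext_adjoint(1)[OF A _ Gamma_inf_fiber[OF Gamma_inf_conn_ext[OF \<phi> X]]]
      by (intro closed_csubspace_diff[OF K] closed_csubspace_vf_apply[OF K open_U X \<xi> df]) (use \<xi> in auto)
    show "op_ext S (op_conn S U X ?A) \<xi> (\<phi> \<xi>) \<in> K"
      by (rule op_ext_adjoint(1)[OF smooth_adjoint_op_conn[OF A X] \<xi> Gamma_inf_fiber[OF \<phi> \<xi>]])
    show "cinner (vf_apply \<A> X ?f \<xi> - ?h \<xi>) x = cinner (op_ext S (op_conn S U X ?A) \<xi> (\<phi> \<xi>)) x"
      if x: "x \<in> K" for x
      using weak_derivative_op_ext(2)[OF A \<phi> x \<xi> X] vf_apply_cinner[OF X \<xi> df, of x]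
      by (simp add: cinner_diff_left cinner_add_left)
  qed
  show ?case
    unfolding smooth_map_iff
  proof
    fix n
    have "Ck_map n U (\<lambda>\<mu>. vf_apply \<A> X ?f \<mu> - ?h \<mu>)"
      using smooth_map_vf_apply[OF open_U X f] h
      by (intro Ck_map_diff[OF open_U]) (simp_all add: smooth_map_iff)
    then show "Ck_map n U (\<lambda>\<mu>. op_ext S (op_conns S U (X # Xs) T) \<mu> (\<phi> \<mu>))"
      by (rule Ck_map_cong[OF open_U, rotated]) (simp add: op_conns_def eq[unfolded op_conns_def])
  qed
qed

text \<open>
  The induction runs over all lists and sections simultaneously: the step to \<open>n + 1\<close> uses the case \<open>n\<close>
  for a longer list and for the section \<open>\<nabla>\<^sub>X\<phi>\<close>.
\<close>

lemma op_ext_continuous_imp_Ck_map: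
  assumes cont: "\<And>Xs \<phi>. set Xs \<subseteq> vect \<A> U \<Longrightarrow> \<phi> \<in> Gamma_inf S U \<Longrightarrow>
      continuous_on U (\<lambda>\<mu>. op_ext S (op_conns S U Xs T) \<mu> (\<phi> \<mu>))"
    and "set Xs \<subseteq> vect \<A> U" and "\<phi> \<in> Gamma_inf S U"
  shows "Ck_map n U (\<lambda>\<mu>. op_ext S (op_conns S U Xs T) \<mu> (\<phi> \<mu>))"
  using assms(2,3)
proof (induction n arbitrary: Xs \<phi>)
  case 0
  then show ?case by (simp add: Ck_map_0_iff[OF open_U] cont)
next
  case (Suc n)
  obtain \<sigma> where A: "smooth_adjoint (op_conns S U Xs T) \<sigma>"
    using smooth_adjoint_op_conns[OF Suc.prems(1)] by blast
  show ?case
  proof (rule op_ext_Ck_map_Suc[OF A Suc.prems(2)])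
    fix X assume X: "X \<in> vect \<A> U"
    show "Ck_map n U (\<lambda>\<mu>. op_ext S (op_conn S U X (op_conns S U Xs T)) \<mu> (\<phi> \<mu>))"
      using Suc.IH[of "X # Xs" \<phi>] Suc.prems X by (simp add: op_conns_def)
    show "Ck_map n U (\<lambda>\<mu>. op_ext S (op_conns S U Xs T) \<mu> (conn_ext S U X \<phi> \<mu>))"
      by (rule Suc.IH[OF Suc.prems(1) Gamma_inf_conn_ext[OF Suc.prems(2) X]])
  qed
qed

lemma T_Ck_map_iff:
  assumes "\<phi> \<in> Gamma_inf S U"
  shows "Ck_map n U (\<lambda>\<mu>. op_ext S T \<mu> (\<phi> \<mu>)) \<longleftrightarrow> Ck_map n U (\<lambda>\<mu>. T \<mu> (\<phi> \<mu>))"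
  using Ck_map_cong[OF open_U, of "\<lambda>\<mu>. op_ext S T \<mu> (\<phi> \<mu>)" "\<lambda>\<mu>. T \<mu> (\<phi> \<mu>)" n]
    Ck_map_cong[OF open_U, of "\<lambda>\<mu>. T \<mu> (\<phi> \<mu>)" "\<lambda>\<mu>. op_ext S T \<mu> (\<phi> \<mu>)" n]
  by (auto simp: op_ext_T Gamma_inf_fiber[OF assms])

text \<open>
  Since \<open>T\<close> undoes its adjoint, the weak derivative of \<open>T\<phi>\<close> is \<open>T\<close> applied to two elements of \<open>\<Gamma>\<^sup>\<infinity>(U)\<close>,
  to which the induction hypothesis applies.
\<close>

lemma conn_form_Gamma_inf_imp_Ck_map:
  assumes form: "\<And>X \<phi>. X \<in> vect \<A> U \<Longrightarrow> \<phi> \<in> Gamma_inf S U \<Longrightarrow>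
      op_apply (conn_form S U T X) \<phi> \<in> Gamma_inf S U"
    and "\<phi> \<in> Gamma_inf S U"
  shows "Ck_map n U (\<lambda>\<mu>. T \<mu> (\<phi> \<mu>))"
  using assms(2)
proof (induction n arbitrary: \<phi>)
  case 0
  then show ?case by (simp add: Ck_map_0_iff[OF open_U] Gamma_inf_T_continuous)
next
  case (Suc n)
  note \<phi> = Suc.prems
  have "Ck_map (Suc n) U (\<lambda>\<mu>. op_ext S T \<mu> (\<phi> \<mu>))"
  proof (rule op_ext_Ck_map_Suc[OF smooth_adjoint_T \<phi>])
    fix X assume X: "X \<in> vect \<A> U"
    show "Ck_map n U (\<lambda>\<mu>. op_ext S T \<mu> (conn_ext S U X \<phi> \<mu>))"
      using Suc.IH[OF Gamma_inf_conn_ext[OF \<phi> X]] T_Ck_map_iff[OF Gamma_inf_conn_ext[OF \<phi> X]] by simp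
    have "op_ext S (op_conn S U X T) \<mu> (\<phi> \<mu>) \<in> K" if "\<mu> \<in> U" for \<mu>
      by (rule op_ext_adjoint(1)[OF smooth_adjoint_op_conn[OF smooth_adjoint_T X] that Gamma_inf_fiber[OF \<phi> that]])
    then have eq: "T \<mu> (op_apply (conn_form S U T X) \<phi> \<mu>) = op_ext S (op_conn S U X T) \<mu> (\<phi> \<mu>)" if "\<mu> \<in> U" for \<mu>
      using that by (simp add: op_apply_def conn_form_def adj_field_T)
    show "Ck_map n U (\<lambda>\<mu>. op_ext S (op_conn S U X T) \<mu> (\<phi> \<mu>))"
      by (rule Ck_map_cong[OF open_U eq Suc.IH[OF form[OF X \<phi>]]])
  qed
  then show ?case using T_Ck_map_iff[OF \<phi>] by simp
qed

lemma op_apply_T_smooth_maps_iff: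
  assumes "\<phi> \<in> Gamma_inf S U"
  shows "op_apply T \<phi> \<in> smooth_maps \<A> U K \<longleftrightarrow> smooth_map \<A> U (\<lambda>\<mu>. T \<mu> (\<phi> \<mu>))"
  using T_in Gamma_inf_fiber[OF assms] by (auto simp: smooth_maps_def op_apply_def)

lemma op_apply_op_ext_cont_maps_iff:
  assumes "set Xs \<subseteq> vect \<A> U" and "\<phi> \<in> Gamma_inf S U"
  shows "op_apply (op_ext S (op_conns S U Xs T)) \<phi> \<in> cont_maps U K \<longleftrightarrow>
    continuous_on U (\<lambda>\<mu>. op_ext S (op_conns S U Xs T) \<mu> (\<phi> \<mu>))"
proof -
  obtain \<sigma> where "smooth_adjoint (op_conns S U Xs T) \<sigma>" using smooth_adjoint_op_conns[OF assms(1)] by blast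
  from op_ext_adjoint(1)[OF this] show ?thesis
    using Gamma_inf_fiber[OF assms(2)] by (auto simp: cont_maps_def op_apply_def)
qed

end

theorem proposition2p5:
  fixes S :: "('m::{t2_space,second_countable_topology}, 'e::real_inner, 'h) hfield"
    and I :: "'i set"
    and U :: "'i \<Rightarrow> 'm set"
    and K :: "'i \<Rightarrow> 'k::complex_hilbert set"
    and T :: "'i \<Rightarrow> 'm \<Rightarrow> 'h \<Rightarrow> 'k"
  assumes "smooth_hilbert_field S"
    and "\<And>i. i \<in> I \<Longrightarrow> open (U i)"
    and "(\<Union>i\<in>I. U i) = UNIV"
    and "\<And>i. i \<in> I \<Longrightarrow> closed_csubspace (K i)"
    and "\<And>i \<xi>. i \<in> I \<Longrightarrow> \<xi> \<in> U i \<Longrightarrow> unitary_at S \<xi> (K i) (T i \<xi>)"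
    and "\<And>i \<phi>. i \<in> I \<Longrightarrow> \<phi> \<in> ssec S \<Longrightarrow> op_apply (T i) \<phi> \<in> smooth_maps (atlas S) (U i) (K i)"
    and "\<And>i x. i \<in> I \<Longrightarrow> x \<in> K i \<Longrightarrow> op_apply (adj_field S (T i)) (\<lambda>_. x) \<in> Gamma_inf S (U i)"
  shows "\<forall>i\<in>I.
      (\<forall>Xs. set Xs \<subseteq> vect (atlas S) (U i) \<longrightarrow>
         bounded_op_field S (U i) (K i) (op_conns S (U i) Xs (T i)))
    \<and> ((\<forall>\<phi> \<in> Gamma_inf S (U i). op_apply (T i) \<phi> \<in> smooth_maps (atlas S) (U i) (K i)) \<longleftrightarrow>
       (\<forall>Xs. set Xs \<subseteq> vect (atlas S) (U i) \<longrightarrow>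
         (\<forall>\<phi> \<in> Gamma_inf S (U i).
            op_apply (op_ext S (op_conns S (U i) Xs (T i))) \<phi> \<in> cont_maps (U i) (K i))))
    \<and> ((\<forall>X \<in> vect (atlas S) (U i). \<forall>\<phi> \<in> Gamma_inf S (U i).
          op_apply (conn_form S (U i) (T i) X) \<phi> \<in> Gamma_inf S (U i)) \<longrightarrow>
       (\<forall>\<phi> \<in> Gamma_inf S (U i). op_apply (T i) \<phi> \<in> smooth_maps (atlas S) (U i) (K i)))"
proof (rule ballI)
  fix i assume i: "i \<in> I"
  interpret trivialised_hilbert_field S "U i" "K i" "T i"
    using assms(1) assms(2,4-7)[OF i] by unfold_locales
  show "(\<forall>Xs. set Xs \<subseteq> vect (atlas S) (U i) \<longrightarrow>
         bounded_op_field S (U i) (K i) (op_conns S (U i) Xs (T i)))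
    \<and> ((\<forall>\<phi> \<in> Gamma_inf S (U i). op_apply (T i) \<phi> \<in> smooth_maps (atlas S) (U i) (K i)) \<longleftrightarrow>
       (\<forall>Xs. set Xs \<subseteq> vect (atlas S) (U i) \<longrightarrow>
         (\<forall>\<phi> \<in> Gamma_inf S (U i).
            op_apply (op_ext S (op_conns S (U i) Xs (T i))) \<phi> \<in> cont_maps (U i) (K i))))
    \<and> ((\<forall>X \<in> vect (atlas S) (U i). \<forall>\<phi> \<in> Gamma_inf S (U i).
          op_apply (conn_form S (U i) (T i) X) \<phi> \<in> Gamma_inf S (U i)) \<longrightarrow>
       (\<forall>\<phi> \<in> Gamma_inf S (U i). op_apply (T i) \<phi> \<in> smooth_maps (atlas S) (U i) (K i)))"
  proof (intro conjI)
    show "\<forall>Xs. set Xs \<subseteq> vect (atlas S) (U i) \<longrightarrow>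
        bounded_op_field S (U i) (K i) (op_conns S (U i) Xs (T i))"
      using smooth_adjoint_op_conns smooth_adjoint_bounded by blast
    show "(\<forall>\<phi> \<in> Gamma_inf S (U i). op_apply (T i) \<phi> \<in> smooth_maps (atlas S) (U i) (K i)) \<longleftrightarrow>
       (\<forall>Xs. set Xs \<subseteq> vect (atlas S) (U i) \<longrightarrow>
         (\<forall>\<phi> \<in> Gamma_inf S (U i).
            op_apply (op_ext S (op_conns S (U i) Xs (T i))) \<phi> \<in> cont_maps (U i) (K i)))"
      (is "?smooth \<longleftrightarrow> ?cont")
    proof
      assume ?smooth
      then have "smooth_map (atlas S) (U i) (\<lambda>\<mu>. T i \<mu> (\<phi> \<mu>))" if "\<phi> \<in> Gamma_inf S (U i)" for \<phi>
        using op_apply_T_smooth_maps_iff[OF that] that by blast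
      then have "smooth_map (atlas S) (U i) (\<lambda>\<mu>. op_ext S (op_conns S (U i) Xs (T i)) \<mu> (\<phi> \<mu>))"
        if "set Xs \<subseteq> vect (atlas S) (U i)" "\<phi> \<in> Gamma_inf S (U i)" for Xs \<phi>
        using smooth_imp_op_ext_smooth that by blast
      then show ?cont
        using op_apply_op_ext_cont_maps_iff Ck_map_imp_continuous_on[OF _ open_U]
        unfolding smooth_map_iff by blast
    next
      assume ?cont
      then have cont: "continuous_on (U i) (\<lambda>\<mu>. op_ext S (op_conns S (U i) Xs (T i)) \<mu> (\<phi> \<mu>))"
        if "set Xs \<subseteq> vect (atlas S) (U i)" "\<phi> \<in> Gamma_inf S (U i)" for Xs \<phi>
        using op_apply_op_ext_cont_maps_iff[OF that] that by blast
      show ?smooth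
      proof
        fix \<phi> assume \<phi>: "\<phi> \<in> Gamma_inf S (U i)"
        have "Ck_map n (U i) (\<lambda>\<mu>. op_ext S (op_conns S (U i) [] (T i)) \<mu> (\<phi> \<mu>))" for n
          by (rule op_ext_continuous_imp_Ck_map[OF cont _ \<phi>]) simp_all
        then have "Ck_map n (U i) (\<lambda>\<mu>. op_ext S (T i) \<mu> (\<phi> \<mu>))" for n
          by (simp add: op_conns_def)
        then show "op_apply (T i) \<phi> \<in> smooth_maps (atlas S) (U i) (K i)"
          unfolding op_apply_T_smooth_maps_iff[OF \<phi>] smooth_map_iff T_Ck_map_iff[OF \<phi>] by blast
      qed
    qed
    show "(\<forall>X \<in> vect (atlas S) (U i). \<forall>\<phi> \<in> Gamma_inf S (U i).
          op_apply (conn_form S (U i) (T i) X) \<phi> \<in> Gamma_inf S (U i)) \<longrightarrow>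
       (\<forall>\<phi> \<in> Gamma_inf S (U i). op_apply (T i) \<phi> \<in> smooth_maps (atlas S) (U i) (K i))"
    proof (intro impI ballI)
      fix \<phi> assume form: "\<forall>X \<in> vect (atlas S) (U i). \<forall>\<phi> \<in> Gamma_inf S (U i).
          op_apply (conn_form S (U i) (T i) X) \<phi> \<in> Gamma_inf S (U i)" and \<phi>: "\<phi> \<in> Gamma_inf S (U i)"
      show "op_apply (T i) \<phi> \<in> smooth_maps (atlas S) (U i) (K i)"
        unfolding op_apply_T_smooth_maps_iff[OF \<phi>] smooth_map_iff
        using conn_form_Gamma_inf_imp_Ck_map[OF _ \<phi>] form by blast
    qed
  qed
qed

end
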